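(* Let $w\in A_2(\mathbb T)$ be such that $d\mu=\frac{w}{2\pi}d\theta$ is a probability measure on the unit circle $\mathbb T$. Then for every $\alpha\in\mathbb T$ the Aleksandrov–Clark measure $\mu_\alpha$ of $\mu$ is absolutely continuous, $d\mu_\alpha=\frac{w_\alpha}{2\pi}d\theta$, and moreover $w_\alpha\in A_2(\mathbb T)$.
   Context: $w\in A_2(\mathbb T)$ means $[w]_{A_2(\mathbb T)}:=\sup_I \langle w\rangle_I\langle w^{-1}\rangle_I<\infty$, supremum over arcs $I\subseteq\mathbb T$, $\langle g\rangle_I:=\frac1{|I|}\int_I g\,d\theta$. For a probability measure $\mu$ on $\mathbb T$ set $F(z)=\int_{\mathbb T}\frac{1+\bar\xi z}{1-\bar\xi z}\,d\mu(\xi)$ for $|z|<1$; then $\Re F>0$ in the unit disc $\mathbb D$ and $F(0)=1$. For $\alpha\in\mathbb T$ put $\zeta=\frac{1-\alpha}{1+\alpha}\in i(\mathbb R\cup\{\infty\})$ and $F_\alpha(z)=\frac{\zeta+F(z)}{1+\zeta F(z)}$, with $F_{-1}=1/F$ (the case $\zeta=\infty$). $F_\alpha$ has positive real part in $\mathbb D$ and $F_\alpha(0)=1$, so there is a unique probability measure $\mu_\alpha$ on $\mathbb T$ with $F_\alpha(z)=\int_{\mathbb T}\frac{1+\bar\xi z}{1-\bar\xi z}\,d\mu_\alpha(\xi)$, $z\in\mathbb D$. The measures $\mu_\alpha$ are the Aleksandrov–Clark measures of $\mu$. *)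

theory Defs
  imports "HOL-Probability.Probability"
begin

abbreviation unit_circle :: "complex set"
  where "unit_circle \<equiv> sphere 0 1"

text \<open>Arc length \<open>d\<theta>\<close> on the unit circle, of total mass \<open>2 * pi\<close>.\<close>

definition arc_length :: "complex measure"
  where "arc_length =
    distr (restrict_space lborel {0..<2 * pi}) (restrict_space borel unit_circle) cis"

lemma sets_arc_length: "sets arc_length = sets (restrict_space borel unit_circle)"
  by (simp add: arc_length_def)

lemma space_arc_length: "space arc_length = unit_circle"
  by (simp add: arc_length_def space_restrict_space)

lemma measurable_cis_circle:
  "cis \<in> restrict_space lborel {0..<2 * pi} \<rightarrow>\<^sub>M restrict_space borel unit_circle"
proof (rule measurable_restrict_space2)
  have "cis \<in> borel_measurable borel"
    by (intro borel_measurable_continuous_onI continuous_intros)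
  then show "cis \<in> restrict_space lborel {0..<2 * pi} \<rightarrow>\<^sub>M borel"
    by (intro measurable_restrict_space1) simp
qed auto

lemma emeasure_arc_length_circle: "emeasure arc_length unit_circle = ennreal (2 * pi)"
proof -
  have "cis -` unit_circle \<inter> {0..<2 * pi} = {0..<2 * pi}"
    by auto
  moreover have "unit_circle \<in> sets (restrict_space borel unit_circle)"
    by (simp add: sets_restrict_space_iff)
  ultimately show ?thesis
    unfolding arc_length_def
    by (subst emeasure_distr[OF measurable_cis_circle])
       (simp_all add: space_restrict_space emeasure_restrict_space)
qed

text \<open>Arcs of positive length, the whole circle included. Closed arcs suffice, since the
  endpoints carry no arc length.\<close>

definition arcs :: "complex set set"
  where "arcs = {cis ` {a..b} | a b. a < b \<and> b \<le> a + 2 * pi}"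

definition arc_avg :: "(complex \<Rightarrow> ennreal) \<Rightarrow> complex set \<Rightarrow> ennreal"
  where "arc_avg g I = (\<integral>\<^sup>+ \<xi> \<in> I. g \<xi> \<partial>arc_length) / emeasure arc_length I"

text \<open>All averages are taken in \<open>[0, \<infinity>]\<close>, where \<open>inverse 0 = \<infinity>\<close>.\<close>

definition A2_char :: "(complex \<Rightarrow> real) \<Rightarrow> ennreal"
  where "A2_char w =
    (SUP I \<in> arcs. arc_avg (\<lambda>\<xi>. ennreal (w \<xi>)) I * arc_avg (\<lambda>\<xi>. inverse (ennreal (w \<xi>))) I)"

text \<open>Positivity almost everywhere is required separately: \<open>0 * \<infinity> = 0\<close> in \<^typ>\<open>ennreal\<close>, so
  the zero function has a finite characteristic. Integrability of \<open>w\<close> and \<open>1 / w\<close> then follows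
  from the finiteness of the characteristic.\<close>

definition A2 :: "(complex \<Rightarrow> real) set"
  where "A2 = {w. w \<in> borel_measurable arc_length \<and> (AE \<xi> in arc_length. 0 < w \<xi>) \<and> A2_char w < \<infinity>}"

definition circle_prob :: "complex measure \<Rightarrow> bool"
  where "circle_prob \<mu> \<longleftrightarrow> prob_space \<mu> \<and> sets \<mu> = sets (restrict_space borel unit_circle)"

definition herglotz :: "complex measure \<Rightarrow> complex \<Rightarrow> complex"
  where "herglotz \<mu> z = (\<integral> \<xi>. (1 + cnj \<xi> * z) / (1 - cnj \<xi> * z) \<partial>\<mu>)"

definition clark_transform :: "complex measure \<Rightarrow> complex \<Rightarrow> complex \<Rightarrow> complex"
  where "clark_transform \<mu> \<alpha> z =
    (if \<alpha> = -1 then 1 / herglotz \<mu> z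
     else let \<zeta> = (1 - \<alpha>) / (1 + \<alpha>) in (\<zeta> + herglotz \<mu> z) / (1 + \<zeta> * herglotz \<mu> z))"

text \<open>\<open>\<nu>\<close> is the Aleksandrov--Clark measure of \<open>\<mu>\<close> at \<open>\<alpha>\<close>. By Herglotz' theorem there is exactly
  one such \<open>\<nu>\<close> whenever \<open>circle_prob \<mu>\<close> and \<open>norm \<alpha> = 1\<close>.\<close>

definition is_aleksandrov_clark :: "complex measure \<Rightarrow> complex \<Rightarrow> complex measure \<Rightarrow> bool"
  where "is_aleksandrov_clark \<mu> \<alpha> \<nu> \<longleftrightarrow>
    circle_prob \<nu> \<and> (\<forall>z \<in> ball 0 1. herglotz \<nu> z = clark_transform \<mu> \<alpha> z)"

end

theory Submission
  imports Defs "HOL-Complex_Analysis.Complex_Analysis"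
begin

text \<open>
  Let \<open>F\<close> and \<open>G\<close> be the Herglotz transforms of \<open>w d\<theta> / 2\<pi>\<close> and \<open>w\<^sup>-\<^sup>1 d\<theta> / 2\<pi>\<close>, with real parts
  \<open>u\<close> and \<open>v\<close>. The condition \<open>A\<^sub>2\<close> is equivalent to \<open>1 \<le> u v \<le> Q\<close> in the disc. The real part of the
  Clark transform is \<open>U = u / |K|\<^sup>2\<close> with \<open>K = a + b F\<close>, so \<open>1 / U\<close> is comparable to \<open>|K|\<^sup>2 v\<close>. Instead of the
  weighted norm inequality for the conjugate function, an explicit superharmonic function \<open>V\<close> of
  \<open>F\<close> and \<open>G\<close> is used, with \<open>1 / U \<le> V \<le> C / U\<close>. Its mean value inequality, transported by Moebius
  maps, bounds the means of \<open>1 / U\<close> over arcs by \<open>C / U\<close> at an interior point, which is the \<open>A\<^sub>2\<close> condition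
  for the Clark measure. Moreover \<open>U ln U - C\<^sup>2 / (V\<^sup>2 U)\<close> is superharmonic, so the dilates of \<open>U\<close> are
  uniformly integrable, which gives absolute continuity.
\<close>

section \<open>Superharmonic functions\<close>

text \<open>At the boundary the reciprocal of the Clark density is \<open>|K|^2 / w\<close>, and
  integrating it means bounding the conjugate function of \<open>w\<close> in the space weighted by
  \<open>1 / w\<close>; this is the inequality that \<open>V\<close> replaces. The obvious candidate
  \<open>|K|^2 v\<close> is not superharmonic: its Laplacian contains \<open>4 |K'|^2 v\<close> and
  a cross term between the gradients of \<open>|K|^2\<close> and \<open>v\<close>. What helps is
  that \<open>1 / (u^2 v)\<close> is subharmonic with a Laplacian bounded below by itself times the
  squared gradients of \<open>ln u\<close> and \<open>ln v\<close>, while the bounds on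
  \<open>u v\<close> keep it comparable to \<open>v\<close>. Unlike the condition on arcs,
  \<open>1 \<le> u v \<le> Q\<close> survives composition with holomorphic maps into the disc, so
  one computation of a Laplacian serves every arc. No boundary values of \<open>F\<close> or
  \<open>G\<close> are used: all estimates hold on circles of radius \<open>r < 1\<close> with
  constants free of \<open>r\<close>, and the limit is taken in measures. The entropy bound is used
  twice there, for absolute continuity and to control the limits of the dilates on arbitrary
  measurable sets, which the passage to the limit in the means of \<open>1 / U\<close>
  requires.\<close>

text \<open>Only pure second derivatives along a fixed direction \<open>e\<close> are recorded: the Laplacian is the sum
  of those along \<open>1\<close> and \<open>\<i>\<close>, and no mixed derivative is ever needed.\<close>

definition dir_C2 :: "complex set \<Rightarrow> complex \<Rightarrow> (complex \<Rightarrow> real) \<Rightarrow> (complex \<Rightarrow> real) \<Rightarrow> (complex \<Rightarrow> real) \<Rightarrow> bool"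
  where "dir_C2 S e f f1 f2 \<longleftrightarrow>
    continuous_on S f \<and> continuous_on S f1 \<and> continuous_on S f2 \<and>
    (\<forall>s\<in>S. ((\<lambda>x. f (s + of_real x * e)) has_real_derivative f1 s) (at 0) \<and>
           ((\<lambda>x. f1 (s + of_real x * e)) has_real_derivative f2 s) (at 0))"

section \<open>Closure rules for functions twice differentiable along a direction\<close>

lemma dir_C2D:
  assumes "dir_C2 S e f f1 f2"
  shows "continuous_on S f" "continuous_on S f1" "continuous_on S f2"
    "\<And>s. s \<in> S \<Longrightarrow> ((\<lambda>x. f (s + of_real x * e)) has_real_derivative f1 s) (at 0)"
    "\<And>s. s \<in> S \<Longrightarrow> ((\<lambda>x. f1 (s + of_real x * e)) has_real_derivative f2 s) (at 0)"
  using assms by (auto simp: dir_C2_def)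

lemma dir_C2_add:
  assumes f: "dir_C2 S e f f1 f2" and g: "dir_C2 S e g g1 g2"
  shows "dir_C2 S e (\<lambda>s. f s + g s) (\<lambda>s. f1 s + g1 s) (\<lambda>s. f2 s + g2 s)"
  unfolding dir_C2_def
  by (intro conjI ballI continuous_intros DERIV_add dir_C2D[OF f] dir_C2D[OF g])

lemma dir_C2_diff:
  assumes f: "dir_C2 S e f f1 f2" and g: "dir_C2 S e g g1 g2"
  shows "dir_C2 S e (\<lambda>s. f s - g s) (\<lambda>s. f1 s - g1 s) (\<lambda>s. f2 s - g2 s)"
  unfolding dir_C2_def
  by (intro conjI ballI continuous_intros DERIV_diff dir_C2D[OF f] dir_C2D[OF g])

lemma dir_C2_cmult:
  assumes f: "dir_C2 S e f f1 f2"
  shows "dir_C2 S e (\<lambda>s. c * f s) (\<lambda>s. c * f1 s) (\<lambda>s. c * f2 s)"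
  unfolding dir_C2_def
  by (intro conjI ballI continuous_intros DERIV_cmult dir_C2D[OF f])

lemma dir_C2_mult:
  assumes f: "dir_C2 S e f f1 f2" and g: "dir_C2 S e g g1 g2"
  shows "dir_C2 S e (\<lambda>s. f s * g s) (\<lambda>s. f1 s * g s + f s * g1 s)
           (\<lambda>s. f2 s * g s + 2 * (f1 s * g1 s) + f s * g2 s)"
  unfolding dir_C2_def
  by (auto intro!: continuous_intros dir_C2D[OF f] dir_C2D[OF g] derivative_eq_intros
      dir_C2D(4,5)[OF f] dir_C2D(4,5)[OF g])

lemma DERIV_inv_sq_mult:
  fixes u v :: "real \<Rightarrow> real"
  assumes "(u has_real_derivative du) (at x)" "(v has_real_derivative dv) (at x)" "u x \<noteq> 0" "v x \<noteq> 0"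
  shows "((\<lambda>x. 1 / ((u x)^2 * v x)) has_real_derivative
    - (2 * du / u x + dv / v x) / ((u x)^2 * v x)) (at x)"
  using assms(3,4) by (auto intro!: derivative_eq_intros assms(1,2) simp: field_simps power2_eq_square)

lemma DERIV_inv_sq_mult_2:
  fixes u v u1 v1 :: "real \<Rightarrow> real"
  assumes D: "(u has_real_derivative u1 x) (at x)" "(v has_real_derivative v1 x) (at x)"
    "(u1 has_real_derivative u2) (at x)" "(v1 has_real_derivative v2) (at x)" and nz: "u x \<noteq> 0" "v x \<noteq> 0"
  shows "((\<lambda>x. - (2 * u1 x / u x + v1 x / v x) / ((u x)^2 * v x)) has_real_derivative
    ((2 * u1 x / u x + v1 x / v x)^2 + 2 * (u1 x / u x)^2 + (v1 x / v x)^2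
           - 2 * u2 / u x - v2 / v x) / ((u x)^2 * v x)) (at x)"
  using nz by (auto intro!: derivative_eq_intros D simp: field_simps power2_eq_square)

lemma DERIV_xlnx:
  fixes u u1 :: "real \<Rightarrow> real"
  assumes D: "(u has_real_derivative u1 x) (at x)" "(u1 has_real_derivative u2) (at x)" and "0 < u x"
  shows "((\<lambda>x. u x * ln (u x)) has_real_derivative u1 x * (ln (u x) + 1)) (at x)"
    and "((\<lambda>x. u1 x * (ln (u x) + 1)) has_real_derivative u2 * (ln (u x) + 1) + (u1 x)^2 / u x) (at x)"
  using assms(3) by (auto intro!: derivative_eq_intros D simp: field_simps power2_eq_square)

text \<open>For harmonic \<open>u\<close> and \<open>v\<close> the terms linear in \<open>u2\<close>
  and \<open>v2\<close> cancel between the directions \<open>1\<close> and \<open>\<i>\<close>, and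
  \<open>1 / (u^2 v)\<close> times a sum of squares of logarithmic derivatives is left. The formula
  is kept in \<open>u1 / u\<close> and \<open>v1 / v\<close> to expose these squares, which absorb
  the bad terms in both superharmonicity proofs.\<close>

lemma dir_C2_inv_sq_mult:
  assumes u: "dir_C2 S e u u1 u2" and v: "dir_C2 S e v v1 v2"
    and pos: "\<forall>s\<in>S. 0 < u s" "\<forall>s\<in>S. 0 < v s"
  shows "dir_C2 S e (\<lambda>s. 1 / ((u s)^2 * v s))
     (\<lambda>s. - (2 * u1 s / u s + v1 s / v s) / ((u s)^2 * v s))
     (\<lambda>s. ((2 * u1 s / u s + v1 s / v s)^2 + 2 * (u1 s / u s)^2 + (v1 s / v s)^2
           - 2 * u2 s / u s - v2 s / v s) / ((u s)^2 * v s))"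
  unfolding dir_C2_def
proof (intro conjI ballI, goal_cases)
  have nz: "u s \<noteq> 0" "v s \<noteq> 0" "(u s)^2 * v s \<noteq> 0" if "s \<in> S" for s using pos that by auto
  {
    case 1
    show ?case using nz by (intro continuous_intros dir_C2D[OF u] dir_C2D[OF v]) auto
  next
    case 2
    show ?case using nz by (intro continuous_intros dir_C2D[OF u] dir_C2D[OF v]) auto
  next
    case 3
    show ?case using nz by (intro continuous_intros dir_C2D[OF u] dir_C2D[OF v]) auto
  next
    case (4 s)
    then show ?case
      using DERIV_inv_sq_mult[OF dir_C2D(4)[OF u 4] dir_C2D(4)[OF v 4]] nz by simp
  next
    case (5 s)
    then show ?case
      using DERIV_inv_sq_mult_2[where u="\<lambda>x. u (s + of_real x * e)" and v="\<lambda>x. v (s + of_real x * e)" and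
          ?u1.0="\<lambda>x. u1 (s + of_real x * e)" and ?v1.0="\<lambda>x. v1 (s + of_real x * e)" and x=0]
        dir_C2D(4,5)[OF u 5] dir_C2D(4,5)[OF v 5] nz by simp
  }
qed

lemma dir_C2_xlnx:
  assumes u: "dir_C2 S e u u1 u2" and pos: "\<forall>s\<in>S. 0 < u s"
  shows "dir_C2 S e (\<lambda>s. u s * ln (u s)) (\<lambda>s. u1 s * (ln (u s) + 1))
     (\<lambda>s. u2 s * (ln (u s) + 1) + (u1 s)^2 / u s)"
  unfolding dir_C2_def
proof (intro conjI ballI, goal_cases)
  have nz: "u s \<noteq> 0" if "s \<in> S" for s using pos that by auto
  {
    case 1
    show ?case using nz by (auto intro!: continuous_intros dir_C2D[OF u])
  next
    case 2
    show ?case using nz by (auto intro!: continuous_intros dir_C2D[OF u])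
  next
    case 3
    show ?case using nz by (auto intro!: continuous_intros dir_C2D[OF u])
  next
    case (4 s)
    then show ?case
      using DERIV_xlnx(1)[where u="\<lambda>x. u (s + of_real x * e)" and ?u1.0="\<lambda>x. u1 (s + of_real x * e)" and x=0]
        dir_C2D(4,5)[OF u 4] pos by simp
  next
    case (5 s)
    then show ?case
      using DERIV_xlnx(2)[where u="\<lambda>x. u (s + of_real x * e)" and ?u1.0="\<lambda>x. u1 (s + of_real x * e)" and x=0]
        dir_C2D(4,5)[OF u 5] pos by simp
  }
qed

text \<open>Differentiating along \<open>e\<close> multiplies by \<open>e\<close>, so the second
  derivatives along \<open>1\<close> and \<open>\<i>\<close> are those of \<open>f''\<close> and
  \<open>- f''\<close>; harmonicity is the identity \<open>1^2 + \<i>^2 = 0\<close>.\<close>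

lemma dir_C2_holomorphic:
  assumes f: "f holomorphic_on S" "open S"
  shows "dir_C2 S e (\<lambda>s. Re (f s)) (\<lambda>s. Re (e * deriv f s)) (\<lambda>s. Re (e^2 * deriv (deriv f) s))"
    and "dir_C2 S e (\<lambda>s. Im (f s)) (\<lambda>s. Im (e * deriv f s)) (\<lambda>s. Im (e^2 * deriv (deriv f) s))"
proof -
  have h1: "deriv f holomorphic_on S" using f by (rule holomorphic_deriv)
  have h2: "deriv (deriv f) holomorphic_on S" using h1 f(2) by (rule holomorphic_deriv)
  have *: "((\<lambda>x::real. g (s + of_real x * e)) has_vector_derivative e * deriv g s) (at 0)"
    if "g holomorphic_on S" "s \<in> S" for g s
  proof -
    have "(g has_field_derivative deriv g s) (at (s + of_real 0 * e))"
      using holomorphic_derivI[OF that(1) f(2) that(2)] by simp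
    then have "((\<lambda>x. g (s + x * e)) has_field_derivative deriv g s * e) (at (of_real 0))"
      by (intro DERIV_chain'[where f="\<lambda>x. s + x * e"]) (auto intro!: derivative_eq_intros)
    then show ?thesis
      using has_vector_derivative_real_field by (fastforce simp: mult.commute)
  qed
  have **: "((\<lambda>x::real. e * deriv f (s + of_real x * e)) has_vector_derivative e^2 * deriv (deriv f) s) (at 0)"
    if "s \<in> S" for s
    using has_vector_derivative_mult_right[OF *[OF h1 that], of e] by (simp add: power2_eq_square mult.assoc)
  show "dir_C2 S e (\<lambda>s. Re (f s)) (\<lambda>s. Re (e * deriv f s)) (\<lambda>s. Re (e^2 * deriv (deriv f) s))"
    "dir_C2 S e (\<lambda>s. Im (f s)) (\<lambda>s. Im (e * deriv f s)) (\<lambda>s. Im (e^2 * deriv (deriv f) s))"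
    unfolding dir_C2_def has_real_derivative_iff_has_vector_derivative
    using * ** f h1 h2
    by (auto intro!: continuous_intros holomorphic_on_imp_continuous_on holomorphic_intros bounded_linear.has_vector_derivative[OF bounded_linear_Re] bounded_linear.has_vector_derivative[OF bounded_linear_Im] simp del: times_complex.sel)
qed

text \<open>In the coordinate \<open>s = ln z\<close> the mean over \<open>Re s = t\<close> is concave in \<open>t\<close>: the second derivative along
  \<open>\<i>\<close> integrates to zero by periodicity. Being bounded as \<open>t\<close> tends to minus infinity, it is nonincreasing.\<close>

lemma superharmonic_mean_log:
  fixes b :: "complex \<Rightarrow> real"
  assumes S: "S = {s. Re s < c}" and c: "c > 0"
    and p: "dir_C2 S 1 b p1 p2" and q: "dir_C2 S \<i> b q1 q2"
    and sup: "\<And>s. s \<in> S \<Longrightarrow> p2 s + q2 s \<le> 0"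
    and per: "\<And>s. s \<in> S \<Longrightarrow> b (s + 2 * pi * \<i>) = b s"
    and lim: "\<And>\<epsilon>. \<epsilon> > 0 \<Longrightarrow> \<exists>T. \<forall>s. Re s \<le> T \<longrightarrow> b s \<le> L + \<epsilon> \<and> L - \<epsilon> \<le> b s"
  shows "integral {0..2*pi} (\<lambda>x. b (\<i> * x)) \<le> 2 * pi * L"
proof -
  note [continuous_intros] = continuous_on_compose2[OF dir_C2D(1)[OF p]]
    continuous_on_compose2[OF dir_C2D(2)[OF p]] continuous_on_compose2[OF dir_C2D(3)[OF p]]
    continuous_on_compose2[OF dir_C2D(2)[OF q]] continuous_on_compose2[OF dir_C2D(3)[OF q]]
  have inS: "Complex t x \<in> S \<longleftrightarrow> t < c" for t x by (simp add: S)
  have px: "((\<lambda>t. g (Complex t x)) has_real_derivative g' (Complex t x)) (at t)"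
    if "t < c" "\<And>s. s \<in> S \<Longrightarrow> ((\<lambda>x. g (s + of_real x * 1)) has_real_derivative g' s) (at 0)" for g g' t x
  proof -
    have "((\<lambda>y. g (Complex t x + of_real y * 1)) has_real_derivative g' (Complex t x)) (at (t - t))"
      using that inS by simp
    then have "((\<lambda>y. g (Complex t x + of_real (y - t) * 1)) has_real_derivative g' (Complex t x) * 1) (at t)"
      by (rule DERIV_chain'[where f="\<lambda>y. y - t", rotated]) (auto intro!: derivative_eq_intros)
    also have "(\<lambda>y. g (Complex t x + of_real (y - t) * 1)) = (\<lambda>y. g (Complex y x))"
      by (rule ext, rule arg_cong[of _ _ g]) (auto simp: complex_eq_iff)
    finally show ?thesis by simp
  qed
  have py: "((\<lambda>x. g (Complex t x)) has_real_derivative g' (Complex t x)) (at x)"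
    if "t < c" "\<And>s. s \<in> S \<Longrightarrow> ((\<lambda>x. g (s + of_real x * \<i>)) has_real_derivative g' s) (at 0)" for g g' t x
  proof -
    have "((\<lambda>y. g (Complex t x + of_real y * \<i>)) has_real_derivative g' (Complex t x)) (at (x - x))"
      using that inS by simp
    then have "((\<lambda>y. g (Complex t x + of_real (y - x) * \<i>)) has_real_derivative g' (Complex t x) * 1) (at x)"
      by (rule DERIV_chain'[where f="\<lambda>y. y - x", rotated]) (auto intro!: derivative_eq_intros)
    also have "(\<lambda>y. g (Complex t x + of_real (y - x) * \<i>)) = (\<lambda>y. g (Complex t y))"
      by (rule ext, rule arg_cong[of _ _ g]) (auto simp: complex_eq_iff)
    finally show ?thesis by simp
  qed
  define m where "m t = integral {0..2*pi} (\<lambda>x. b (Complex t x))" for t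
  define m1 where "m1 t = integral {0..2*pi} (\<lambda>x. p1 (Complex t x))" for t
  define m2 where "m2 t = integral {0..2*pi} (\<lambda>x. p2 (Complex t x))" for t
  have leib: "((\<lambda>t. integral {0..2*pi} (\<lambda>x. g (Complex t x))) has_real_derivative
       integral {0..2*pi} (\<lambda>x. g' (Complex t x))) (at t)"
    if t: "t < c" and g: "continuous_on S g" "continuous_on S g'"
      "\<And>s. s \<in> S \<Longrightarrow> ((\<lambda>x. g (s + of_real x * 1)) has_real_derivative g' s) (at 0)" for g g' t
  proof -
    note [continuous_intros] = continuous_on_compose2[OF g(1)] continuous_on_compose2[OF g(2)]
    have "((\<lambda>t. integral (cbox 0 (2*pi)) (\<lambda>x. g (Complex t x))) has_real_derivative
       integral (cbox 0 (2*pi)) (\<lambda>x. g' (Complex t x))) (at t within {..<c})"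
    proof (rule leibniz_rule_field_derivative)
      show "((\<lambda>t. g (Complex t x)) has_real_derivative g' (Complex t x)) (at t within {..<c})"
        if "t \<in> {..<c}" for t x
        using px[of t g g' x] that g(3) by (auto intro: has_field_derivative_at_within)
      show "(\<lambda>x. g (Complex t x)) integrable_on cbox 0 (2 * pi)" if "t \<in> {..<c}" for t
        using that by (intro integrable_continuous continuous_intros) (auto simp: S)
      show "continuous_on ({..<c} \<times> cbox 0 (2 * pi)) (\<lambda>(t, x). g' (Complex t x))"
        unfolding split_beta by (intro continuous_intros) (auto simp: S)
    qed (use t in auto)
    then show ?thesis using t by (simp add: at_within_open[of t "{..<c}"])
  qed
  have m: "(m has_real_derivative m1 t) (at t)" if "t < c" for t
    unfolding m_def[abs_def] m1_def by (intro leib that dir_C2D[OF p])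
  have m1: "(m1 has_real_derivative m2 t) (at t)" if "t < c" for t
    unfolding m1_def[abs_def] m2_def by (intro leib that dir_C2D[OF p])
  have m2: "m2 t \<le> 0" if t: "t < c" for t
  proof -
    \<comment> \<open>Periodicity of \<open>b\<close> identifies its derivatives at the two ends of
      the period, so the boundary terms of the integral of \<open>q2\<close> cancel.\<close>
    have q1: "q1 (Complex t (2*pi)) = q1 (Complex t 0)"
    proof -
      have 1: "((\<lambda>x. b (Complex t x)) has_real_derivative q1 (Complex t 0)) (at 0)"
        by (rule py[OF t dir_C2D(4)[OF q]])
      have "((\<lambda>x. b (Complex t x)) has_real_derivative q1 (Complex t (2*pi))) (at (0 + 2*pi))"
        using py[OF t dir_C2D(4)[OF q], of "2*pi"] by simp
      then have "((\<lambda>x. b (Complex t (x + 2*pi))) has_real_derivative q1 (Complex t (2*pi))) (at 0)"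
        by (subst (asm) DERIV_shift) simp
      also have "(\<lambda>x. b (Complex t (x + 2*pi))) = (\<lambda>x. b (Complex t x))"
      proof
        fix x have "Complex t (x + 2*pi) = Complex t x + 2 * pi * \<i>" by (simp add: complex_eq_iff)
        then show "b (Complex t (x + 2*pi)) = b (Complex t x)" using per[of "Complex t x"] t inS by simp
      qed
      finally show ?thesis using 1 DERIV_unique by blast
    qed
    have "((\<lambda>x. q2 (Complex t x)) has_integral (q1 (Complex t (2*pi)) - q1 (Complex t 0))) {0..2*pi}"
    proof (rule fundamental_theorem_of_calculus)
      fix x show "((\<lambda>x. q1 (Complex t x)) has_vector_derivative q2 (Complex t x)) (at x within {0..2*pi})"
        unfolding has_real_derivative_iff_has_vector_derivative[symmetric]
        by (rule has_field_derivative_at_within[OF py[OF t dir_C2D(5)[OF q]]])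
    qed simp
    from has_integral_neg[OF this] have q2: "((\<lambda>x. - q2 (Complex t x)) has_integral 0) {0..2*pi}"
      using q1 by simp
    have p2: "((\<lambda>x. p2 (Complex t x)) has_integral m2 t) {0..2*pi}"
      unfolding m2_def
      using t by (intro integrable_integral integrable_continuous_real continuous_intros) (auto simp: S)
    show ?thesis
    proof (rule has_integral_le[OF p2 q2])
      fix x show "p2 (Complex t x) \<le> - q2 (Complex t x)"
        using sup[of "Complex t x"] inS t by simp
    qed
  qed
  have anti: "m1 t \<le> m1 s" if "s \<le> t" "t < c" for s t
  proof (rule DERIV_nonpos_imp_nonincreasing[OF that(1)])
    fix x assume "s \<le> x" "x \<le> t"
    then show "\<exists>y. (m1 has_real_derivative y) (at x) \<and> y \<le> 0" using m1[of x] m2[of x] that by force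
  qed
  have lim': "\<exists>T. \<forall>t\<le>T. t < c \<longrightarrow> m t \<le> 2*pi*(L+\<epsilon>) \<and> 2*pi*(L-\<epsilon>) \<le> m t" if "\<epsilon> > 0" for \<epsilon>
  proof -
    obtain T where T: "\<And>s. Re s \<le> T \<Longrightarrow> b s \<le> L + \<epsilon> \<and> L - \<epsilon> \<le> b s" using lim[OF \<open>\<epsilon> > 0\<close>] by auto
    have "m t \<le> 2*pi*(L+\<epsilon>) \<and> 2*pi*(L-\<epsilon>) \<le> m t" if "t \<le> T" "t < c" for t
    proof -
      have I: "((\<lambda>x. b (Complex t x)) has_integral m t) {0..2*pi}"
        unfolding m_def
        using that by (intro integrable_integral integrable_continuous_real continuous_intros) (auto simp: S)
      have C: "((\<lambda>x. k) has_integral 2*pi*k) {0..2*pi}" for k :: real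
        using has_integral_const_real[of k 0 "2*pi"] by simp
      show ?thesis
        using has_integral_le[OF I C[of "L+\<epsilon>"]] has_integral_le[OF C[of "L-\<epsilon>"] I] T that by auto
    qed
    then show ?thesis by blast
  qed
  have m1_le: "m1 t0 \<le> 0" if "t0 < c" for t0
  proof (rule ccontr)
    assume "\<not> m1 t0 \<le> 0"
    define d where "d = m1 t0"
    have d: "d > 0" using \<open>\<not> m1 t0 \<le> 0\<close> by (simp add: d_def)
    obtain T where T: "\<And>t. t \<le> T \<Longrightarrow> t < c \<Longrightarrow> 2*pi*(L-1) \<le> m t" using lim'[of 1] by auto
    \<comment> \<open>So far to the left that a slope of at least \<open>d\<close> on all of
      \<open>[t, t0]\<close>, which holds because \<open>m1\<close> is nonincreasing, would push
      \<open>m t\<close> below the lower bound \<open>2*pi*(L-1)\<close>.\<close>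
    define t where "t = min (min T (t0 - 1)) (t0 - (m t0 - 2*pi*(L-1) + 1) / d)"
    have t: "t \<le> T" "t < t0" "t \<le> t0 - (m t0 - 2*pi*(L-1) + 1) / d" by (auto simp: t_def)
    have "\<exists>z>t. z < t0 \<and> m t0 - m t = (t0 - t) * m1 z"
      by (rule MVT2[OF t(2)]) (use m that in auto)
    then obtain z where z: "z > t" "z < t0" "m t0 - m t = (t0 - t) * m1 z" by blast
    have "(t0 - t) * m1 z \<ge> (t0 - t) * d" using anti[of z t0] z t that by (intro mult_left_mono) (auto simp: d_def)
    moreover have "(t0 - t) * d \<ge> m t0 - 2*pi*(L-1) + 1"
    proof -
      have "(m t0 - 2*pi*(L-1) + 1) / d \<le> t0 - t" using t by linarith
      then show ?thesis using d by (simp add: pos_divide_le_eq)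
    qed
    ultimately show False using T[OF t(1)] t that z by linarith
  qed
  have "m 0 \<le> 2*pi*(L+\<epsilon>)" if "\<epsilon> > 0" for \<epsilon>
  proof -
    obtain T where T: "\<And>t. t \<le> T \<Longrightarrow> t < c \<Longrightarrow> m t \<le> 2*pi*(L+\<epsilon>)"
      using lim'[OF \<open>\<epsilon> > 0\<close>] by blast
    have "m 0 \<le> m (min T 0)"
    proof (rule DERIV_nonpos_imp_nonincreasing[where f=m])
      fix x assume "min T 0 \<le> x" "x \<le> 0"
      then show "\<exists>y. (m has_real_derivative y) (at x) \<and> y \<le> 0" using m[of x] m1_le[of x] c by force
    qed simp
    moreover have "min T 0 < c" using c by simp
    ultimately show ?thesis using T[of "min T 0"] by linarith
  qed
  note m0 = this
  have "m 0 \<le> 2*pi*L"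
  proof (rule field_le_epsilon)
    fix e :: real assume "e > 0"
    then show "m 0 \<le> 2*pi*L + e" using m0[of "e / (2*pi)"] by (simp add: distrib_left)
  qed
  also have "m 0 = integral {0..2*pi} (\<lambda>x. b (\<i> * x))"
    unfolding m_def by (rule arg_cong[where f="integral _"], rule ext) (simp add: Complex_eq)
  finally show ?thesis .
qed

definition superharmonic :: "complex set \<Rightarrow> (complex \<Rightarrow> real) \<Rightarrow> bool"
  where "superharmonic S b \<longleftrightarrow> (\<exists>p1 p2 q1 q2. dir_C2 S 1 b p1 p2 \<and> dir_C2 S \<i> b q1 q2 \<and>
    (\<forall>s\<in>S. p2 s + q2 s \<le> 0))"

lemma superharmonicI:
  assumes "dir_C2 S 1 b p1 p2" "dir_C2 S \<i> b q1 q2" "\<And>s. s \<in> S \<Longrightarrow> p2 s + q2 s \<le> 0"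
  shows "superharmonic S b"
  using assms unfolding superharmonic_def by blast

text \<open>Passing to \<open>exp s\<close> only multiplies the Laplacian by \<open>|z|^2\<close>,
  and it unrolls the punctured disc into a half-plane where circles become vertical segments. The
  centre is not in the image of \<open>exp\<close>; it returns as the limit \<open>Re s\<close> to
  minus infinity, for which continuity of \<open>B\<close> at \<open>0\<close> suffices.\<close>

lemma superharmonic_mean_disc:
  assumes R: "R > 1" and sup: "superharmonic {s. Re s < ln R} (\<lambda>s. B (exp s))" and cont: "isCont B 0"
  shows "integral {0..2*pi} (\<lambda>x. B (cis x)) \<le> 2 * pi * B 0"
proof -
  obtain p1 p2 q1 q2 where p: "dir_C2 {s. Re s < ln R} 1 (\<lambda>s. B (exp s)) p1 p2"
    and q: "dir_C2 {s. Re s < ln R} \<i> (\<lambda>s. B (exp s)) q1 q2"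
    and le: "\<And>s. Re s < ln R \<Longrightarrow> p2 s + q2 s \<le> 0"
    using sup unfolding superharmonic_def by auto
  have lim: "\<exists>T. \<forall>s. Re s \<le> T \<longrightarrow> B (exp s) \<le> B 0 + \<epsilon> \<and> B 0 - \<epsilon> \<le> B (exp s)" if "\<epsilon> > 0" for \<epsilon>
  proof -
    obtain d where d: "d > 0" "\<And>z. dist z 0 < d \<Longrightarrow> dist (B z) (B 0) < \<epsilon>"
      using cont \<open>\<epsilon> > 0\<close> unfolding continuous_at_eps_delta by meson
    have "B (exp s) \<le> B 0 + \<epsilon> \<and> B 0 - \<epsilon> \<le> B (exp s)" if "Re s \<le> ln (d/2)" for s
    proof -
      have "exp (Re s) \<le> d/2" using that d(1) by (metis exp_le_cancel_iff exp_ln half_gt_zero)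
      then have "dist (exp s) 0 < d" using d(1) by simp
      from d(2)[OF this] show ?thesis by (auto simp: dist_real_def)
    qed
    then show ?thesis by blast
  qed
  have "integral {0..2*pi} (\<lambda>x. (\<lambda>s. B (exp s)) (\<i> * of_real x)) \<le> 2 * pi * B 0"
  proof (rule superharmonic_mean_log[OF refl _ p q])
    show "0 < ln R" using R by simp
    show "p2 s + q2 s \<le> 0" if "s \<in> {s. Re s < ln R}" for s using le that by simp
    show "B (exp (s + 2 * pi * \<i>)) = B (exp s)" for s
      using exp_plus_2pin[of s 1] by (simp add: mult.commute mult.left_commute)
  qed (rule lim)
  then show ?thesis by (simp add: cis_conv_exp)
qed

text \<open>With \<open>u = Re x\<close>, \<open>v = Re y\<close>, \<open>K = a + b x\<close> this is \<open>|K|\<^sup>2 (2 v - 1 / (u\<^sup>2 v)) + M (u - 1 / (u v\<^sup>2))\<close>. When \<open>uv\<close>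
  stays between 1 and \<open>Q\<close>, both bad terms of the Laplacian of \<open>|K|\<^sup>2 v\<close> are absorbed: the one of size \<open>|K|\<^sup>2 v\<close> by
  \<open>1 / (u\<^sup>2 v)\<close> and the one of size \<open>u\<close> by \<open>1 / (u v\<^sup>2)\<close>, whose weight \<open>M\<close> is chosen for this.\<close>

definition lyap :: "real \<Rightarrow> complex \<Rightarrow> complex \<Rightarrow> complex \<Rightarrow> complex \<Rightarrow> real"
  where "lyap Q a b x y = (norm (a + b * x))^2 * (2 * Re y - 1 / ((Re x)^2 * Re y)) +
    80 * Q ^ 5 * (norm b)^2 * (Re x - 1 / ((Re y)^2 * Re x))"

text \<open>The correction equals \<open>v / (u v)^2\<close>, hence is comparable to
  \<open>v\<close>: at most \<open>v\<close>, so that \<open>2 v\<close> minus it stays above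
  \<open>v\<close>, and at least \<open>v / Q^2\<close>, so that its Laplacian is strong enough to
  absorb.\<close>

lemma inv_sq_mult_bounds:
  fixes u v Q :: real
  assumes "0 < u" "0 < v" "1 \<le> u * v" "u * v \<le> Q"
  shows "v / Q^2 \<le> 1 / (u^2 * v)" "1 / (u^2 * v) \<le> v"
proof -
  have eq: "1 / (u^2 * v) = v / (u * v)^2"
    using assms by (simp add: field_simps power2_eq_square)
  have "(u * v)^2 \<le> Q^2" using assms by (intro power_mono) auto
  then show "v / Q^2 \<le> 1 / (u^2 * v)" unfolding eq using assms by (intro divide_left_mono) (auto intro!: mult_pos_pos zero_less_power)
  have "1 \<le> (u * v)^2" using assms by (simp add: one_le_power)
  then show "1 / (u^2 * v) \<le> v" unfolding eq using assms by (simp add: divide_le_eq)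
qed

text \<open>With \<open>U = u / |K|^2\<close> this is the two-sided comparison of the Lyapunov
  function with \<open>1 / U\<close>. The hypothesis on \<open>b\<close> bounds the auxiliary part
  \<open>|b|^2 u\<close> by \<open>|K|^2 / u\<close>.\<close>

lemma lyap_bounds:
  assumes Q: "0 < Re x" "0 < Re y" "1 \<le> Re x * Re y" "Re x * Re y \<le> Q"
    and b: "norm b * Re x \<le> norm (a + b * x)"
  shows "(norm (a + b * x))^2 / Re x \<le> lyap Q a b x y"
    and "lyap Q a b x y \<le> (2 * Q + 80 * Q ^ 5) * ((norm (a + b * x))^2 / Re x)"
proof -
  let ?u = "Re x" and ?v = "Re y" and ?N = "(norm (a + b * x))^2"
  have Q1: "Q \<ge> 1" using Q by linarith
  have E1: "1 / (?u^2 * ?v) \<le> ?v" "0 \<le> 1 / (?u^2 * ?v)" using inv_sq_mult_bounds[OF Q] Q by auto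
  have E2: "1 / (?v^2 * ?u) \<le> ?u" "0 \<le> 1 / (?v^2 * ?u)" using inv_sq_mult_bounds[of ?v ?u] Q by (auto simp: mult.commute)
  have v: "1 / ?u \<le> ?v" "?v \<le> Q / ?u" using Q by (auto simp: field_simps)
  have "?N / ?u \<le> ?N * ?v" using mult_left_mono[OF v(1), of ?N] by simp
  also have "... \<le> ?N * (2 * ?v - 1 / (?u^2 * ?v))" using E1 by (intro mult_left_mono) auto
  also have "... \<le> lyap Q a b x y" unfolding lyap_def using E2 Q1 by (simp add: mult_nonneg_nonneg)
  finally show "?N / ?u \<le> lyap Q a b x y" .
  have "?N * (2 * ?v - 1 / (?u^2 * ?v)) \<le> ?N * (2 * (Q / ?u))"
  proof (intro mult_left_mono)
    show "2 * ?v - 1 / (?u^2 * ?v) \<le> 2 * (Q / ?u)" using E1(2) v(2) by linarith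
  qed simp
  moreover have "80 * Q ^ 5 * (norm b)^2 * (?u - 1 / (?v^2 * ?u)) \<le> 80 * Q ^ 5 * (?N / ?u)"
  proof -
    have "(norm b * ?u)^2 \<le> ?N" using b Q by (intro power_mono) auto
    then have "(norm b)^2 * ?u \<le> ?N / ?u" using Q by (simp add: field_simps power2_eq_square)
    have "(norm b)^2 * (?u - 1 / (?v^2 * ?u)) \<le> (norm b)^2 * ?u" using E2 by (intro mult_left_mono) auto
    also note \<open>(norm b)^2 * ?u \<le> ?N / ?u\<close>
    finally have "(80 * Q ^ 5) * ((norm b)^2 * (?u - 1 / (?v^2 * ?u))) \<le> (80 * Q ^ 5) * (?N / ?u)"
      by (rule mult_left_mono) (use Q1 in simp)
    then show ?thesis by (simp only: mult.assoc)
  qed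
  ultimately show "lyap Q a b x y \<le> (2 * Q + 80 * Q ^ 5) * (?N / ?u)"
    unfolding lyap_def by (simp add: algebra_simps)
qed

text \<open>The Laplacian of \<open>lyap\<close> as an inequality between real numbers:
  \<open>k\<close> and \<open>l\<close> stand for the real and imaginary parts of \<open>K\<close>,
  \<open>\<beta>\<close> for the norm of \<open>b\<close>, \<open>G\<close> for the squared gradient
  of \<open>u\<close>, and \<open>L\<close> is the literal output of the rules for
  \<open>dir_C2\<close>. The hypothesis \<open>cr\<close> comes from the Cauchy-Riemann equations:
  the gradient of \<open>|K|^2\<close> is half as large, in the square, as Cauchy-Schwarz in each
  direction would give.\<close>

lemma lyap_laplacian_nonpos:
  fixes u v k l ux uy vx vy kx ky lx ly u2x u2y v2x v2y k2x k2y l2x l2y Q \<beta> G :: real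
  assumes pos: "0 < u" "0 < v" and Q: "1 \<le> u * v" "u * v \<le> Q"
    and harm: "u2x + u2y = 0" "v2x + v2y = 0" "k2x + k2y = 0" "l2x + l2y = 0"
    and G: "ux^2 + uy^2 = G" "kx^2 + lx^2 = \<beta>^2 * G" "ky^2 + ly^2 = \<beta>^2 * G"
    and cr: "(k * kx + l * lx)^2 + (k * ky + l * ly)^2 \<le> (k^2 + l^2) * (\<beta>^2 * G)"
  defines "L \<equiv> \<lambda>u1 u2 v1 v2 k1 k2 l1 l2.
    ((k2 * k + 2 * (k1 * k1) + k * k2) + (l2 * l + 2 * (l1 * l1) + l * l2)) * (2 * v - 1 / (u^2 * v)) +
    2 * (((k1 * k + k * k1) + (l1 * l + l * l1)) * (2 * v1 - - (2 * u1 / u + v1 / v) / (u^2 * v))) +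
    (k * k + l * l) * (2 * v2 - ((2 * u1 / u + v1 / v)^2 + 2 * (u1 / u)^2 + (v1 / v)^2
           - 2 * u2 / u - v2 / v) / (u^2 * v)) +
    80 * Q ^ 5 * \<beta>^2 * (u2 - ((2 * v1 / v + u1 / u)^2 + 2 * (v1 / v)^2 + (u1 / u)^2
           - 2 * v2 / v - u2 / u) / (v^2 * u))"
  shows "L ux u2x vx v2x kx k2x lx l2x + L uy u2y vy v2y ky k2y ly l2y \<le> 0"
proof -
  define E where "E = 1 / (u^2 * v)"
  define E' where "E' = 1 / (v^2 * u)"
  define ax where "ax = ux / u"
  define ay where "ay = uy / u"
  define bx where "bx = vx / v"
  define by' where "by' = vy / v"
  define N where "N = k^2 + l^2"
  define Nx where "Nx = 2 * (k * kx + l * lx)"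
  define Ny where "Ny = 2 * (k * ky + l * ly)"
  define Dx where "Dx = 2 * v * bx + E * (2 * ax + bx)"
  define Dy where "Dy = 2 * v * by' + E * (2 * ay + by')"
  define n where "n = ax^2 + ay^2 + bx^2 + by'^2"
  have eqs: "ux = u * ax" "uy = u * ay" "vx = v * bx" "vy = v * by'"
    "u2y = - u2x" "v2y = - v2x" "k2y = - k2x" "l2y = - l2x"
    using pos harm by (auto simp: ax_def ay_def bx_def by'_def)
  have Q1: "Q \<ge> 1" using Q by linarith
  have E: "v / Q^2 \<le> E" "E \<le> v" "0 < E" using inv_sq_mult_bounds[OF pos Q] pos by (auto simp: E_def)
  have E': "u / Q^2 \<le> E'" "0 < E'" using inv_sq_mult_bounds[of v u Q] pos Q by (auto simp: E'_def mult.commute)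
  have n0: "n \<ge> 0" by (simp add: n_def)
  have N0: "N \<ge> 0" by (simp add: N_def)
  have Geq: "G = u^2 * (ax^2 + ay^2)" using G(1) eqs by (simp add: algebra_simps power2_eq_square)
  have G0: "G \<ge> 0" by (simp add: Geq)
  have Gn: "G \<le> u^2 * n" unfolding Geq n_def by (intro mult_left_mono) auto
  \<comment> \<open>Harmonicity removes every second derivative. What remains is the gradient of
    \<open>K\<close>, the cross term between \<open>|K|^2\<close> and the bracket, and two negative
    multiples of sums of squares.\<close>
  have "L ux u2x vx v2x kx k2x lx l2x + L uy u2y vy v2y ky k2y ly l2y =
     2 * ((kx^2 + lx^2) + (ky^2 + ly^2)) * (2 * v - E) + 2 * (Nx * Dx + Ny * Dy)
     - N * (E * ((2*ax+bx)^2 + (2*ay+by')^2 + 2*ax^2 + 2*ay^2 + bx^2 + by'^2))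
     - 80 * Q^5 * \<beta>^2 * (E' * ((2*bx+ax)^2 + (2*by'+ay)^2 + 2*bx^2 + 2*by'^2 + ax^2 + ay^2))"
  proof -
    have *: "x / (u^2 * v) = x * E" "x / (v^2 * u) = x * E'" for x by (simp_all add: E_def E'_def)
    have **: "ux / u = ax" "uy / u = ay" "vx / v = bx" "vy / v = by'" "2 * ux / u = 2 * ax" "2 * uy / u = 2 * ay"
      "2 * vx / v = 2 * bx" "2 * vy / v = 2 * by'"
      by (simp_all add: ax_def ay_def bx_def by'_def)
    have ***: "2 * x / y = 2 * (x / y)" for x y :: real by simp
    define hu hv where "hu = u2x / u" and "hv = v2x / v"
    have ****: "u2x / u = hu" "v2x / v = hv" "2 * u2x / u = 2 * hu" "2 * v2x / v = 2 * hv"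
      "(- u2x) / u = - hu" "(- v2x) / v = - hv" "2 * (- u2x) / u = - 2 * hu" "2 * (- v2x) / v = - 2 * hv" by (auto simp: hu_def hv_def)
    show ?thesis
      unfolding L_def eqs(5-8) ** **** * Nx_def Ny_def Dx_def Dy_def N_def
      unfolding eqs(3,4) by (simp add: algebra_simps power2_eq_square)
  qed
  also have "... \<le> 8 * \<beta>^2 * G * v + 2 * (Nx * Dx + Ny * Dy) - N * (v / Q^2 * n) - 80 * Q^5 * \<beta>^2 * (u / Q^2 * n)"
  proof -
    have "2 * ((kx^2 + lx^2) + (ky^2 + ly^2)) * (2 * v - E) \<le> 2 * (2 * (\<beta>^2 * G)) * (2 * v)"
      unfolding G(2,3) using E G0 by (intro mult_mono) auto
    moreover have "N * (v / Q^2 * n) \<le> N * (E * ((2*ax+bx)^2 + (2*ay+by')^2 + 2*ax^2 + 2*ay^2 + bx^2 + by'^2))"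
      using E N0 n0 by (intro mult_left_mono mult_mono) (auto simp: n_def)
    moreover have "80 * Q^5 * \<beta>^2 * (u / Q^2 * n) \<le> 80 * Q^5 * \<beta>^2 * (E' * ((2*bx+ax)^2 + (2*by'+ay)^2 + 2*bx^2 + 2*by'^2 + ax^2 + ay^2))"
      using E' n0 Q1 by (intro mult_left_mono mult_mono) (auto simp: n_def)
    ultimately show ?thesis by linarith
  qed
  also have "2 * (Nx * Dx + Ny * Dy) \<le> N * (v / Q^2 * n) + 72 * \<beta>^2 * G * v * Q^2"
  proof (cases "N = 0")
    case True
    then have "k = 0" "l = 0" by (auto simp: N_def add_nonneg_eq_0_iff)
    then show ?thesis using True G0 pos by (simp add: Nx_def Ny_def)
  next
    case False
    \<comment> \<open>Chosen so that \<open>\<kappa> * (18 * v^2 * n)\<close> equals the available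
      negative term \<open>N * (v / Q^2 * n)\<close>. As \<open>\<kappa>\<close> vanishes with
      \<open>N\<close>, that case is separate. The number 18 rounds up \<open>2^2 + 3^2\<close>,
      which comes from \<open>E \<le> v\<close>.\<close>
    define \<kappa> where "\<kappa> = N / (18 * v * Q^2)"
    have \<kappa>: "\<kappa> > 0" using False N0 pos Q1 by (simp add: \<kappa>_def)
    have young: "2 * (p * q) \<le> \<kappa> * q^2 + p^2 / \<kappa>" for p q
    proof -
      have "0 \<le> (\<kappa> * q - p)^2 / \<kappa>" using \<kappa> by simp
      also have "(\<kappa> * q - p)^2 / \<kappa> = \<kappa> * q^2 + p^2 / \<kappa> - 2 * (p * q)"
        using \<kappa> by (simp add: field_simps power2_eq_square)
      finally show ?thesis by simp
    qed
    have D: "(2 * v * q + E * (2 * p + q))^2 \<le> 18 * v^2 * (p^2 + q^2)" for p q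
    proof -
      have "2 * v * q + E * (2 * p + q) = 2 * E * p + (2 * v + E) * q" by (simp add: algebra_simps)
      moreover have "(2 * E * p + (2 * v + E) * q)^2 \<le> ((2 * E)^2 + (2 * v + E)^2) * (p^2 + q^2)"
      proof -
        have "((2 * E)^2 + (2 * v + E)^2) * (p^2 + q^2) - (2 * E * p + (2 * v + E) * q)^2 = (2 * E * q - (2 * v + E) * p)^2"
          by (simp add: algebra_simps power2_eq_square)
        then show ?thesis by (metis diff_ge_0_iff_ge zero_le_power2)
      qed
      moreover have "((2 * E)^2 + (2 * v + E)^2) * (p^2 + q^2) \<le> (18 * v^2) * (p^2 + q^2)"
      proof (intro mult_right_mono)
        have "(2 * E)^2 \<le> (2 * v)^2" "(2 * v + E)^2 \<le> (3 * v)^2" using E pos by (intro power_mono; simp)+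
        moreover have "(2 * v)^2 + (3 * v)^2 \<le> 18 * v^2" by (simp add: power_mult_distrib)
        ultimately show "(2 * E)^2 + (2 * v + E)^2 \<le> 18 * v^2" by linarith
      qed simp
      ultimately show ?thesis by simp
    qed
    have "2 * (Nx * Dx + Ny * Dy) \<le> \<kappa> * (Dx^2 + Dy^2) + (Nx^2 + Ny^2) / \<kappa>"
      using young[of Nx Dx] young[of Ny Dy] by (simp add: distrib_left add_divide_distrib)
    also have "\<kappa> * (Dx^2 + Dy^2) \<le> \<kappa> * (18 * v^2 * n)"
      using D[of bx ax] D[of by' ay] \<kappa> unfolding Dx_def Dy_def n_def
      by (intro mult_left_mono) (auto simp: algebra_simps)
    also have "\<kappa> * (18 * v^2 * n) = N * (v / Q^2 * n)"
      using pos Q1 by (simp add: \<kappa>_def field_simps power2_eq_square)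
    also have "(Nx^2 + Ny^2) / \<kappa> \<le> (4 * (N * (\<beta>^2 * G))) / \<kappa>"
      using cr \<kappa> unfolding Nx_def Ny_def N_def power_mult_distrib by (intro divide_right_mono) auto
    also have "(4 * (N * (\<beta>^2 * G))) / \<kappa> = 72 * \<beta>^2 * G * v * Q^2"
      using False pos Q1 by (simp add: \<kappa>_def field_simps)
    finally show ?thesis by simp
  qed
  \<comment> \<open>Here the weight \<open>80 * Q ^ 5\<close> is explained: 80 is 8 from the
    gradient of \<open>K\<close> plus 72 from Young's inequality, and \<open>Q ^ 5\<close> collects
    \<open>Q^2\<close> from Young, \<open>Q\<close> from \<open>u * v \<le> Q\<close>, and
    \<open>Q^2\<close> lost in \<open>E' \<ge> u / Q^2\<close>.\<close>
  also have "8 * \<beta>^2 * G * v + (N * (v / Q^2 * n) + 72 * \<beta>^2 * G * v * Q^2) - N * (v / Q^2 * n) - 80 * Q^5 * \<beta>^2 * (u / Q^2 * n)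
     = \<beta>^2 * ((8 + 72 * Q^2) * (G * v) - 80 * Q^3 * (u * n))"
    using Q1 by (simp add: field_simps power2_eq_square eval_nat_numeral)
  also have "... \<le> 0"
  proof -
    have "G * v \<le> u^2 * n * v" using Gn pos by (intro mult_right_mono) auto
    also have "... = (u * v) * (u * n)" by (simp add: power2_eq_square)
    also have "... \<le> Q * (u * n)" using Q pos n0 by (intro mult_right_mono) auto
    finally have "G * v \<le> Q * (u * n)" .
    moreover have "8 + 72 * Q^2 \<le> 80 * Q^2" using one_le_power[OF Q1, of 2] by simp
    ultimately have "(8 + 72 * Q^2) * (G * v) \<le> (80 * Q^2) * (Q * (u * n))"
      using G0 pos by (intro mult_mono[of "8 + 72 * Q^2"]) auto
    then show ?thesis by (intro mult_nonneg_nonpos) (auto simp: power2_eq_square eval_nat_numeral algebra_simps)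
  qed
  finally show ?thesis by simp
qed

lemma superharmonic_lyap:
  assumes S: "open S" and f: "f holomorphic_on S" and g: "g holomorphic_on S"
    and Q: "\<And>s. s \<in> S \<Longrightarrow> 0 < Re (f s)" "\<And>s. s \<in> S \<Longrightarrow> 0 < Re (g s)"
      "\<And>s. s \<in> S \<Longrightarrow> 1 \<le> Re (f s) * Re (g s)" "\<And>s. s \<in> S \<Longrightarrow> Re (f s) * Re (g s) \<le> Q"
  shows "superharmonic S (\<lambda>s. lyap Q a b (f s) (g s))"
proof -
  define K where "K = (\<lambda>s. a + b * f s)"
  have K: "K holomorphic_on S" unfolding K_def by (intro holomorphic_intros f)
  have K': "deriv K s = b * deriv f s" if "s \<in> S" for s
    unfolding K_def using holomorphic_derivI[OF f S that]
    by (intro DERIV_imp_deriv) (auto intro!: derivative_eq_intros)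
  note u = dir_C2_holomorphic(1)[OF f S] note v = dir_C2_holomorphic(1)[OF g S]
  note k = dir_C2_holomorphic(1)[OF K S] note l = dir_C2_holomorphic(2)[OF K S]
  have eq: "(\<lambda>s. lyap Q a b (f s) (g s)) =
     (\<lambda>s. (Re (K s) * Re (K s) + Im (K s) * Im (K s)) * (2 * Re (g s) - 1 / ((Re (f s))^2 * Re (g s))) +
    80 * Q ^ 5 * (norm b)^2 * (Re (f s) - 1 / ((Re (g s))^2 * Re (f s))))"
    unfolding lyap_def K_def cmod_power2 by (simp add: power2_eq_square)
  have pos: "\<forall>s\<in>S. 0 < Re (f s)" "\<forall>s\<in>S. 0 < Re (g s)" using Q by auto
  note V = dir_C2_add[OF dir_C2_mult[OF dir_C2_add[OF dir_C2_mult[OF k k] dir_C2_mult[OF l l]]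
      dir_C2_diff[OF dir_C2_cmult[OF v] dir_C2_inv_sq_mult[OF u v pos]]]
      dir_C2_cmult[OF dir_C2_diff[OF u dir_C2_inv_sq_mult[OF v u pos(2,1)]]]]
  show ?thesis
    unfolding eq
  proof (rule superharmonicI[OF V V], goal_cases)
    case (1 s)
    note s = \<open>s \<in> S\<close>
    let ?f = "deriv f s" and ?K = "deriv K s"
    have cm: "(Re z)^2 + (Im z)^2 = (norm z)^2" for z by (simp add: cmod_power2)
    have nK: "(norm ?K)^2 = (norm b)^2 * (norm ?f)^2" by (simp add: K'[OF s] norm_mult power_mult_distrib)
    have G1: "(Re (1 * ?f))^2 + (Re (\<i> * ?f))^2 = (norm ?f)^2" by (simp add: cmod_power2)
    have G2: "(Re (1 * ?K))^2 + (Im (1 * ?K))^2 = (norm b)^2 * (norm ?f)^2"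
      "(Re (\<i> * ?K))^2 + (Im (\<i> * ?K))^2 = (norm b)^2 * (norm ?f)^2"
      unfolding cm nK[symmetric] by (simp_all add: norm_mult)
    have cr: "(Re (K s) * Re (1 * ?K) + Im (K s) * Im (1 * ?K))^2 + (Re (K s) * Re (\<i> * ?K) + Im (K s) * Im (\<i> * ?K))^2
       \<le> ((Re (K s))^2 + (Im (K s))^2) * ((norm b)^2 * (norm ?f)^2)"
      unfolding nK[symmetric] cm[of ?K, symmetric] by (simp add: algebra_simps power2_eq_square)
    have h: "Re (1^2 * z) + Re (\<i>^2 * z) = 0" "Im (1^2 * z) + Im (\<i>^2 * z) = 0" for z by simp_all
    show ?case
      by (rule lyap_laplacian_nonpos[OF Q(1-4)[OF s] h(1) h(1) h(1) h(2) G1 G2 cr])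
  qed
qed

text \<open>The term \<open>C\<^sup>2 / (V\<^sup>2 U)\<close> compensates the Laplacian \<open>|\<nabla>U|\<^sup>2 / U\<close> of \<open>U ln U\<close>.\<close>

lemma superharmonic_entropy:
  assumes S: "open S" and h: "h holomorphic_on S" and V: "superharmonic S V"
    and pos: "\<And>s. s \<in> S \<Longrightarrow> 0 < Re (h s)" "\<And>s. s \<in> S \<Longrightarrow> 0 < V s"
    and C: "\<And>s. s \<in> S \<Longrightarrow> Re (h s) * V s \<le> C"
  shows "superharmonic S (\<lambda>s. Re (h s) * ln (Re (h s)) - C^2 * (1 / ((V s)^2 * Re (h s))))"
proof -
  obtain p1 p2 q1 q2 where p: "dir_C2 S 1 V p1 p2" and q: "dir_C2 S \<i> V q1 q2"
    and le: "\<And>s. s \<in> S \<Longrightarrow> p2 s + q2 s \<le> 0"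
    using V unfolding superharmonic_def by auto
  note u = dir_C2_holomorphic(1)[OF h S]
  have pos': "\<forall>s\<in>S. 0 < Re (h s)" "\<forall>s\<in>S. 0 < V s" using pos by auto
  note D = dir_C2_diff[OF dir_C2_xlnx[OF u pos'(1)] dir_C2_cmult[OF dir_C2_inv_sq_mult[OF _ u pos'(2,1)]]]
  let ?T = "\<lambda>U W U1 U2 V1 V2. U2 * (ln U + 1) + U1^2 / U -
    C^2 * (((2 * V1 / W + U1 / U)^2 + 2 * (V1 / W)^2 + (U1 / U)^2 - 2 * V2 / W - U2 / U) / (W^2 * U))"
  have alg: "?T U W Ux U2x Vx V2x + ?T U W Uy U2y Vy V2y \<le> 0"
    if "0 < U" "0 < W" "U * W \<le> C" "U2x + U2y = 0" "V2x + V2y \<le> 0" for U W Ux Uy U2x U2y Vx Vy V2x V2y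
  proof -
    define X where "X = (2 * Vx / W + Ux / U)^2 + 2 * (Vx / W)^2 + (2 * Vy / W + Uy / U)^2 + 2 * (Vy / W)^2"
    define Y where "Y = (Ux / U)^2 + (Uy / U)^2"
    have e: "U2y = - U2x" using that by linarith
    have XY: "X \<ge> 0" "Y \<ge> 0" by (auto simp: X_def Y_def)
    have t: "1 \<le> C^2 / (W * U)^2"
      using power_mono[of "W * U" C 2] that by (simp add: mult.commute le_divide_eq)
    \<comment> \<open>Since \<open>U * W \<le> C\<close>, the factor \<open>C^2 / (W^2 * U)\<close>
      is at least \<open>U\<close>, so the one square \<open>Y\<close>, the squared gradient of
      \<open>ln U\<close>, absorbs the bad term \<open>U * Y\<close>. The squares in
      \<open>X\<close> are dropped, and superharmonicity of \<open>V\<close> gives the sign of the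
      remaining term.\<close>
    have "U * Y + C^2 / (W^2 * U) * (2 * (V2x + V2y) / W) - C^2 / (W^2 * U) * X - C^2 / (W^2 * U) * Y \<le> 0"
    proof -
      have "U * Y * 1 \<le> U * Y * (C^2 / (W * U)^2)" using t that XY by (intro mult_left_mono) auto
      also have "... = C^2 / (W^2 * U) * Y" using that by (simp add: field_simps power2_eq_square)
      finally have "U * Y \<le> C^2 / (W^2 * U) * Y" by simp
      moreover have "C^2 / (W^2 * U) * (2 * (V2x + V2y) / W) \<le> 0"
        using that by (intro mult_nonneg_nonpos divide_nonpos_pos) auto
      moreover have "0 \<le> C^2 / (W^2 * U) * X" using that XY by (intro mult_nonneg_nonneg) auto
      ultimately show ?thesis by linarith
    qed
    also have "U * Y + C^2 / (W^2 * U) * (2 * (V2x + V2y) / W) - C^2 / (W^2 * U) * X - C^2 / (W^2 * U) * Y =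
      ?T U W Ux U2x Vx V2x + ?T U W Uy U2y Vy V2y"
    proof -
      have *: "Ux^2 / U = U * (Ux / U)^2" "Uy^2 / U = U * (Uy / U)^2" using that by (auto simp: power2_eq_square)
      define c where "c = C^2 / (W^2 * U)"
      have c: "C^2 * (x / (W^2 * U)) = c * x" for x by (simp add: c_def)
      show ?thesis unfolding * c unfolding c_def[symmetric] X_def Y_def e
        by (simp add: algebra_simps add_divide_distrib diff_divide_distrib)
    qed
    finally show ?thesis .
  qed
  show ?thesis
  proof (rule superharmonicI[OF D[OF p] D[OF q]], goal_cases)
    case (1 s)
    note s = \<open>s \<in> S\<close>
    show ?case
      by (rule alg[OF pos[OF s] C[OF s] _ le[OF s]]) simp
  qed
qed

section \<open>Arcs and Poisson integrals\<close>

abbreviation mid_arc :: "real \<Rightarrow> real \<Rightarrow> complex set"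
  where "mid_arc \<theta> h \<equiv> cis ` {\<theta> - h..\<theta> + h}"

section \<open>Arc length in the angular coordinate\<close>

lemma cis_inj_on_period:
  assumes "cis x = cis y" "a \<le> x" "x < a + 2 * pi" "a \<le> y" "y < a + 2 * pi"
  shows "x = y"
proof -
  have "cis (x - y) = 1" using assms(1) by (simp add: cis_divide[symmetric])
  then have "cos (x - y) = 1" by (simp add: complex_eq_iff)
  then obtain k :: int where k: "x - y = k * 2 * pi" by (auto simp: cos_one_2pi_int)
  have "\<bar>of_int k * (2 * pi)\<bar> < 1 * (2 * pi)" using assms(2-) k[symmetric] by (simp add: mult.assoc)
  then have "\<bar>of_int k :: real\<bar> < 1" unfolding abs_mult by simp
  then have "k = 0" by linarith
  then show ?thesis using k by simp
qed

lemma cis_in_arc_iff: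
  assumes "b \<le> a + 2 * pi" "a \<le> x" "x < a + 2 * pi"
  shows "cis x \<in> cis ` {a..b} \<longleftrightarrow> x \<in> {a..b}"
proof
  assume "cis x \<in> cis ` {a..b}"
  then obtain y where y: "cis x = cis y" "a \<le> y" "y \<le> b" by auto
  show "x \<in> {a..b}"
  proof (cases "y < a + 2 * pi")
    case True
    then show ?thesis using cis_inj_on_period[OF y(1) assms(2,3) y(2) True] y by simp
  next
    case False
    then show ?thesis using assms y by simp
  qed
qed simp

lemma circle_eq_arc: "cis ` {0..2 * pi} = unit_circle"
proof -
  have "\<xi> \<in> cis ` {0..2*pi}" if "norm \<xi> = 1" for \<xi>
  proof -
    have "\<xi> = cis (Arg2pi \<xi>)" using Arg2pi_eq[of \<xi>] that by (simp add: cis_conv_exp)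
    then show ?thesis using Arg2pi[of \<xi>] by (intro image_eqI[of _ _ "Arg2pi \<xi>"]) auto
  qed
  then show ?thesis by auto
qed

lemma arc_in_sets [measurable]: "cis ` {a..b} \<in> sets arc_length"
proof -
  have "compact (cis ` {a..b})" by (intro compact_continuous_image continuous_intros) auto
  then have "cis ` {a..b} \<in> sets borel" by (simp add: borel_compact)
  then show ?thesis by (auto simp: sets_arc_length sets_restrict_space_iff)
qed

lemma cis_measurable_arc_length [measurable]: "cis \<in> borel \<rightarrow>\<^sub>M arc_length"
proof -
  have "cis \<in> borel \<rightarrow>\<^sub>M restrict_space borel unit_circle"
    by (rule measurable_restrict_space2) (auto intro!: borel_measurable_continuous_onI continuous_intros)
  then show ?thesis by (simp add: measurable_cong_sets[OF refl sets_arc_length])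
qed

lemma nn_integral_period:
  fixes h :: "real \<Rightarrow> ennreal"
  assumes [measurable]: "h \<in> borel_measurable borel" and per: "\<And>x. h (x + 2 * pi) = h x"
  shows "(\<integral>\<^sup>+x\<in>{a..<a + 2 * pi}. h x \<partial>lborel) = (\<integral>\<^sup>+x\<in>{0..<2 * pi}. h x \<partial>lborel)"
proof -
  define J where "J c d = (\<integral>\<^sup>+x\<in>{c..<d}. h x \<partial>lborel)" for c d
  have add: "J c e = J c d + J d e" if "c \<le> d" "d \<le> e" for c d e
  proof -
    have "J c e = (\<integral>\<^sup>+x. h x * indicator {c..<d} x + h x * indicator {d..<e} x \<partial>lborel)"
      unfolding J_def using that by (intro nn_integral_cong) (auto split: split_indicator)
    then show ?thesis unfolding J_def by (subst (asm) nn_integral_add) auto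
  qed
  have shift1: "J (c + 2 * pi) (d + 2 * pi) = J c d" for c d
  proof -
    have "J (c + 2 * pi) (d + 2 * pi) = (\<integral>\<^sup>+x. h (2 * pi + 1 * x) * indicator {c + 2 * pi..<d + 2 * pi} (2 * pi + 1 * x) \<partial>lborel)"
      unfolding J_def by (subst nn_integral_real_affine[where c=1 and t="2 * pi"]) auto
    also have "... = J c d" unfolding J_def
      using per by (intro nn_integral_cong) (auto split: split_indicator simp: add.commute)
    finally show ?thesis .
  qed
  have shift_nat: "J (c + 2 * pi * real n) (d + 2 * pi * real n) = J c d" for c d n
  proof (induction n)
    case (Suc n)
    then show ?case using shift1[of "c + 2 * pi * real n" "d + 2 * pi * real n"] by (simp add: algebra_simps)
  qed simp
  have shift: "J (c + 2 * pi * of_int k) (d + 2 * pi * of_int k) = J c d" for c d k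
  proof (cases "k \<ge> 0")
    case True
    then show ?thesis using shift_nat[of c "nat k" d] by simp
  next
    case False
    then show ?thesis using shift_nat[of "c + 2 * pi * of_int k" "nat (- k)" "d + 2 * pi * of_int k"] by simp
  qed
  \<comment> \<open>The interval is cut at the next multiple of \<open>2 * pi\<close>; the piece to
    the right, moved back by one period, completes the piece to the left.\<close>
  define k where "k = \<lfloor>a / (2 * pi)\<rfloor>"
  have "of_int k \<le> a / (2 * pi)" "a / (2 * pi) < of_int k + 1" unfolding k_def by linarith+
  then have k: "2 * pi * of_int k \<le> a" "a < 2 * pi * (of_int k + 1)"
    by (simp_all add: field_simps)
  have "J a (a + 2 * pi) = J a (2 * pi * (of_int k + 1)) + J (2 * pi * (of_int k + 1)) (a + 2 * pi)"
    using k by (intro add) (auto simp: algebra_simps)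
  also have "J (2 * pi * (of_int k + 1)) (a + 2 * pi) = J (2 * pi * of_int k) a"
    using shift1[of "2 * pi * of_int k" a] by (simp add: algebra_simps)
  also have "J a (2 * pi * (of_int k + 1)) + J (2 * pi * of_int k) a = J (2 * pi * of_int k) (2 * pi * (of_int k + 1))"
    using k by (subst add[of "2 * pi * of_int k" a]) (auto simp: add.commute)
  also have "... = J 0 (2 * pi)" using shift[of 0 k "2 * pi"] by (simp add: algebra_simps)
  finally show ?thesis by (simp add: J_def)
qed

text \<open>The free starting point \<open>a\<close> lets an arc that crosses the cut at angle
  \<open>0\<close> be treated as a single interval.\<close>

lemma nn_integral_arc_length:
  assumes [measurable]: "f \<in> borel_measurable arc_length"
  shows "(\<integral>\<^sup>+\<xi>. f \<xi> \<partial>arc_length) = (\<integral>\<^sup>+x\<in>{a..<a + 2 * pi}. f (cis x) \<partial>lborel)"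
proof -
  have f: "f \<in> borel_measurable (restrict_space borel unit_circle)"
    using assms by (simp add: measurable_cong_sets[OF sets_arc_length refl])
  have "(\<integral>\<^sup>+\<xi>. f \<xi> \<partial>arc_length) = (\<integral>\<^sup>+x\<in>{0..<2 * pi}. f (cis x) \<partial>lborel)"
    unfolding arc_length_def
    by (subst nn_integral_distr[OF measurable_cis_circle]) (use f in \<open>auto simp: nn_integral_restrict_space\<close>)
  also have "... = (\<integral>\<^sup>+x\<in>{a..<a + 2 * pi}. f (cis x) \<partial>lborel)"
  proof (rule nn_integral_period[symmetric])
    show "(\<lambda>x. f (cis x)) \<in> borel_measurable borel" by measurable
    show "f (cis (x + 2 * pi)) = f (cis x)" for x by (simp add: cis_mult[symmetric])
  qed
  finally show ?thesis .
qed

lemma nn_integral_arc: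
  assumes [measurable]: "f \<in> borel_measurable arc_length" and "a \<le> b" "b \<le> a + 2 * pi"
  shows "(\<integral>\<^sup>+\<xi>\<in>cis ` {a..b}. f \<xi> \<partial>arc_length) = (\<integral>\<^sup>+x\<in>{a..b}. f (cis x) \<partial>lborel)"
proof -
  have "(\<integral>\<^sup>+\<xi>\<in>cis ` {a..b}. f \<xi> \<partial>arc_length) =
    (\<integral>\<^sup>+x\<in>{a..<a + 2 * pi}. f (cis x) * indicator (cis ` {a..b}) (cis x) \<partial>lborel)"
    by (rule nn_integral_arc_length) measurable
  also have "... = (\<integral>\<^sup>+x\<in>{a..b}. f (cis x) \<partial>lborel)"
  proof (rule nn_integral_cong_AE)
    \<comment> \<open>For the full arc \<open>b = a + 2 * pi\<close> the right end lies outside the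
      half-open period; this one point is the only discrepancy.\<close>
    have "AE x in lborel. x \<noteq> a + 2 * pi" by (rule AE_lborel_singleton)
    then show "AE x in lborel. f (cis x) * indicator (cis ` {a..b}) (cis x) * indicator {a..<a + 2 * pi} x =
       f (cis x) * indicator {a..b} x"
    proof eventually_elim
      case (elim x)
      show ?case
      proof (cases "a \<le> x \<and> x < a + 2 * pi")
        case True
        then show ?thesis using cis_in_arc_iff[OF assms(3), of x] by (simp add: indicator_def)
      next
        case False
        then show ?thesis using elim assms by (auto simp: indicator_def)
      qed
    qed
  qed
  finally show ?thesis .
qed

lemma emeasure_arc:
  assumes "a \<le> b" "b \<le> a + 2 * pi"
  shows "emeasure arc_length (cis ` {a..b}) = ennreal (b - a)"
  using nn_integral_arc[of "\<lambda>_. 1" a b] assms by simp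

interpretation arc_length: finite_measure arc_length
  by (rule finite_measureI) (simp add: space_arc_length emeasure_arc_length_circle)

section \<open>The Poisson kernel, normalised to mass \<open>2 * pi\<close> against arc
  length\<close>

definition poisson :: "complex \<Rightarrow> complex \<Rightarrow> real"
  where "poisson z \<xi> = (1 - (norm z)^2) / (norm (\<xi> - z))^2"

lemma one_minus_cnj_mult_neq_0:
  assumes "norm \<xi> = 1" "norm z < 1" shows "1 - cnj \<xi> * z \<noteq> (0::complex)"
proof
  assume "1 - cnj \<xi> * z = 0"
  then have "norm (cnj \<xi> * z) = 1" by simp
  then show False using assms by (simp add: norm_mult)
qed

lemma Re_herglotz_kernel:
  assumes "norm \<xi> = 1" "norm z < 1"
  shows "Re ((1 + cnj \<xi> * z) / (1 - cnj \<xi> * z)) = poisson z \<xi>"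
proof -
  define q where "q = cnj \<xi> * z"
  have q: "norm q = norm z" using assms by (simp add: q_def norm_mult)
  have "\<xi> * (1 - q) = \<xi> - z" using assms complex_norm_square[of \<xi>] by (simp add: q_def algebra_simps)
  then have n: "norm (1 - q) = norm (\<xi> - z)" using assms by (metis mult_1 norm_mult)
  have "Re ((1 + q) / (1 - q)) = (1 - (norm q)^2) / (norm (1 - q))^2"
    unfolding Re_divide cmod_power2 by (simp add: algebra_simps power2_eq_square)
  then show ?thesis by (simp add: poisson_def q n q_def[symmetric])
qed

lemma poisson_pos: "norm z < 1 \<Longrightarrow> norm \<xi> = 1 \<Longrightarrow> 0 < poisson z \<xi>"
  unfolding poisson_def by (intro divide_pos_pos) (auto simp: abs_square_less_1)

lemma poisson_le:
  assumes "norm z < 1" "norm \<xi> = 1" shows "poisson z \<xi> \<le> (1 + norm z) / (1 - norm z)"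
proof -
  have "1 - norm z \<le> norm (\<xi> - z)" using norm_triangle_ineq2[of \<xi> z] assms by simp
  then have "(1 - norm z)^2 \<le> (norm (\<xi> - z))^2" using assms by (intro power_mono) auto
  then have "poisson z \<xi> \<le> (1 - (norm z)^2) / (1 - norm z)^2"
    unfolding poisson_def
  proof (intro divide_left_mono)
    have "norm (\<xi> - z) > 0" using \<open>1 - norm z \<le> norm (\<xi> - z)\<close> assms(1) by linarith
    then show "0 < (norm (\<xi> - z))^2 * (1 - norm z)^2" using assms by simp
  qed (use assms in \<open>auto simp: power_le_one\<close>)
  also have "1 - (norm z)^2 = (1 + norm z) * (1 - norm z)" by (simp add: algebra_simps power2_eq_square)
  also have "... / (1 - norm z)^2 = (1 + norm z) / (1 - norm z)" using assms by (simp add: power2_eq_square)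
  finally show ?thesis .
qed

text \<open>For unit vectors \<open>|\<xi> - r \<eta>|\<close> is symmetric. Under Fubini this turns
  the Poisson extension of an indicator, integrated against a measure, into the measure of that set
  with respect to a dilate.\<close>

lemma poisson_swap: "norm \<xi> = 1 \<Longrightarrow> norm \<eta> = 1 \<Longrightarrow> poisson (of_real r * \<eta>) \<xi> = poisson (of_real r * \<xi>) \<eta>"
proof -
  assume *: "norm \<xi> = 1" "norm \<eta> = 1"
  have "(norm (x - of_real r * y))^2 = (norm x)^2 + r^2 * (norm y)^2 - 2 * r * (Re x * Re y + Im x * Im y)"
    for x y :: complex
    unfolding cmod_power2 by (simp add: algebra_simps power2_eq_square)
  from this[of \<xi> \<eta>] this[of \<eta> \<xi>]
  have "(norm (\<xi> - of_real r * \<eta>))^2 = (norm (\<eta> - of_real r * \<xi>))^2"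
    unfolding * by (simp only: mult.commute[of "Re \<xi>"] mult.commute[of "Im \<xi>"])
  then show ?thesis using * by (simp add: poisson_def norm_mult)
qed

section \<open>Herglotz transforms of finite measures on the circle\<close>

locale circle_measure = finite_measure M for M :: "complex measure" +
  assumes sets_circle: "sets M = sets (restrict_space borel unit_circle)"
begin

lemma space_circle: "space M = unit_circle"
  using sets_eq_imp_space_eq[OF sets_circle] by (simp add: space_restrict_space)

lemma measurable_circle_continuous:
  fixes f :: "complex \<Rightarrow> 'b::topological_space"
  assumes "continuous_on unit_circle f"
  shows "f \<in> borel_measurable M"
  using borel_measurable_continuous_on_restrict[OF assms] by (simp add: measurable_cong_sets[OF sets_circle refl])

lemma integrable_circle_continuous:
  fixes f :: "complex \<Rightarrow> complex"
  assumes "continuous_on unit_circle f"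
  shows "integrable M f"
proof -
  have "compact (f ` unit_circle)" using assms by (intro compact_continuous_image) auto
  then have "bounded (f ` unit_circle)" by (rule compact_imp_bounded)
  then obtain B where B: "\<And>x. x \<in> unit_circle \<Longrightarrow> norm (f x) \<le> B"
    unfolding bounded_iff by blast
  show ?thesis
  proof (rule integrable_const_bound)
    show "AE x in M. norm (f x) \<le> B" using B by (intro AE_I2) (simp add: space_circle)
  qed (rule measurable_circle_continuous[OF assms])
qed

lemma continuous_on_herglotz_kernel:
  assumes "norm z < 1"
  shows "continuous_on unit_circle (\<lambda>\<xi>. (1 + cnj \<xi> * z) / (1 - cnj \<xi> * z))"
proof (intro continuous_intros ballI)
  fix \<xi> :: complex assume "\<xi> \<in> unit_circle"
  then show "1 - cnj \<xi> * z \<noteq> 0" using one_minus_cnj_mult_neq_0[OF _ assms, of \<xi>] by simp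
qed

text \<open>With \<open>q = cnj \<xi> * z\<close> the kernel is
  \<open>1 + 2 (q + q^2 + ...)\<close>, dominated by \<open>2 |z|^n\<close> uniformly in
  \<open>\<xi>\<close>. Holomorphy of the transform then follows from the power series, without
  differentiating under the integral.\<close>

lemma herglotz_sums:
  assumes z: "norm z < 1"
  shows "(\<lambda>n. (\<integral>\<xi>. (if n = 0 then 1 else 2) * cnj \<xi> ^ n \<partial>M) * z ^ n) sums herglotz M z"
proof -
  define f where "f n \<xi> = (if n = 0 then 1 else 2) * (cnj \<xi> * z) ^ n" for n and \<xi> :: complex
  have nf: "norm (f n \<xi>) \<le> 2 * norm z ^ n" if "norm \<xi> = 1" for n \<xi>
    using that by (auto simp: f_def norm_mult norm_power power_mult_distrib)
  have sm: "summable (\<lambda>n. 2 * norm z ^ n)" using z by (intro summable_mult summable_geometric) auto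
  have s: "(\<lambda>n. f n \<xi>) sums ((1 + cnj \<xi> * z) / (1 - cnj \<xi> * z))" if "norm \<xi> = 1" for \<xi>
  proof -
    have "norm (cnj \<xi> * z) < 1" using that z by (simp add: norm_mult)
    from sums_mult[OF geometric_sums[OF this], of 2]
    have "(\<lambda>n. 2 * (cnj \<xi> * z) ^ n - (if n = 0 then 1 else 0)) sums (2 * (1 / (1 - cnj \<xi> * z)) - 1)"
      by (intro sums_diff) (use sums_single[of 0 "\<lambda>_. 1::complex"] in simp)+
    moreover have "2 * (1 / (1 - cnj \<xi> * z)) - 1 = (1 + cnj \<xi> * z) / (1 - cnj \<xi> * z)"
      using one_minus_cnj_mult_neq_0[OF that z] by (simp add: field_simps)
    moreover have "(\<lambda>n. 2 * (cnj \<xi> * z) ^ n - (if n = 0 then 1 else 0)) = (\<lambda>n. f n \<xi>)"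
      by (auto simp: f_def)
    ultimately show ?thesis by simp
  qed
  have int: "integrable M (f n)" for n
    unfolding f_def by (intro integrable_circle_continuous continuous_intros)
  have "(\<lambda>n. integral\<^sup>L M (f n)) sums (\<integral>\<xi>. (\<Sum>n. f n \<xi>) \<partial>M)"
  proof (rule sums_integral[OF int])
    show "AE \<xi> in M. summable (\<lambda>n. norm (f n \<xi>))"
    proof (rule AE_I2)
      fix \<xi> assume "\<xi> \<in> space M"
      then show "summable (\<lambda>n. norm (f n \<xi>))"
        by (intro summable_comparison_test'[OF sm, of 0]) (simp add: nf space_circle)
    qed
    show "summable (\<lambda>n. \<integral>\<xi>. norm (f n \<xi>) \<partial>M)"
    proof (rule summable_comparison_test'[where N=0])
      show "summable (\<lambda>n. 2 * norm z ^ n * measure M (space M))" using sm by (rule summable_mult2)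
      fix n
      have "(\<integral>\<xi>. norm (f n \<xi>) \<partial>M) \<le> (\<integral>\<xi>. 2 * norm z ^ n \<partial>M)"
        using nf int by (intro integral_mono) (auto simp: space_circle)
      then show "norm (\<integral>\<xi>. norm (f n \<xi>) \<partial>M) \<le> 2 * norm z ^ n * measure M (space M)"
        by (simp add: mult_ac)
    qed
  qed
  also have "(\<integral>\<xi>. (\<Sum>n. f n \<xi>) \<partial>M) = herglotz M z"
    unfolding herglotz_def using s by (intro Bochner_Integration.integral_cong) (auto simp: space_circle sums_iff)
  also have "(\<lambda>n. integral\<^sup>L M (f n)) = (\<lambda>n. (\<integral>\<xi>. (if n = 0 then 1 else 2) * cnj \<xi> ^ n \<partial>M) * z ^ n)"
    unfolding f_def by (rule ext, subst integral_mult_left_zero[symmetric]) (simp add: power_mult_distrib mult.assoc)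
  finally show ?thesis .
qed

lemma herglotz_holomorphic: "herglotz M holomorphic_on ball 0 1"
  by (rule power_series_holomorphic[of 0 1 "\<lambda>n. \<integral>\<xi>. (if n = 0 then 1 else 2) * cnj \<xi> ^ n \<partial>M"])
     (use herglotz_sums in \<open>simp only: diff_zero mem_ball_0\<close>)

lemma herglotz_0: "herglotz M 0 = measure M (space M)"
  by (simp add: herglotz_def scaleR_conv_of_real)

lemma poisson_integrable:
  assumes "norm z < 1" shows "integrable M (poisson z)"
proof -
  have "integrable M (\<lambda>\<xi>. Re ((1 + cnj \<xi> * z) / (1 - cnj \<xi> * z)))"
    by (intro integrable_Re integrable_circle_continuous continuous_on_herglotz_kernel assms)
  also have "?this \<longleftrightarrow> ?thesis"
    by (rule Bochner_Integration.integrable_cong) (auto simp: Re_herglotz_kernel[OF _ assms] space_circle)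
  finally show ?thesis .
qed

lemma Re_herglotz:
  assumes "norm z < 1" shows "Re (herglotz M z) = (\<integral>\<xi>. poisson z \<xi> \<partial>M)"
proof -
  have "Re (herglotz M z) = (\<integral>\<xi>. Re ((1 + cnj \<xi> * z) / (1 - cnj \<xi> * z)) \<partial>M)"
    unfolding herglotz_def
    by (rule integral_Re[symmetric]) (intro integrable_circle_continuous continuous_on_herglotz_kernel assms)
  also have "... = (\<integral>\<xi>. poisson z \<xi> \<partial>M)"
    by (rule Bochner_Integration.integral_cong) (auto simp: Re_herglotz_kernel[OF _ assms] space_circle)
  finally show ?thesis .
qed

lemma ennreal_Re_herglotz:
  assumes "norm z < 1" shows "ennreal (Re (herglotz M z)) = (\<integral>\<^sup>+\<xi>. poisson z \<xi> \<partial>M)"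
  unfolding Re_herglotz[OF assms] using poisson_pos[OF assms]
  by (intro nn_integral_eq_integral[symmetric] poisson_integrable assms) (auto simp: space_circle intro!: AE_I2 less_imp_le)

lemma Re_herglotz_pos:
  assumes "norm z < 1" "measure M (space M) > 0" shows "Re (herglotz M z) > 0"
proof -
  have "Re (herglotz M z) \<noteq> 0"
  proof
    assume "Re (herglotz M z) = 0"
    then have "(\<integral>\<xi>. poisson z \<xi> \<partial>M) = 0" by (simp add: Re_herglotz[OF assms(1)])
    moreover have "AE \<xi> in M. 0 \<le> poisson z \<xi>"
      using poisson_pos[OF assms(1)] by (intro AE_I2 less_imp_le) (auto simp: space_circle)
    ultimately have "AE \<xi> in M. poisson z \<xi> = 0"
      using integral_nonneg_eq_0_iff_AE[OF poisson_integrable[OF assms(1)]] by simp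
    then have "AE \<xi> in M. False"
    proof (rule AE_mp)
      show "AE \<xi> in M. poisson z \<xi> = 0 \<longrightarrow> False"
        using poisson_pos[OF assms(1)] by (intro AE_I2) (fastforce simp: space_circle)
    qed
    then have "emeasure M (space M) = 0" using AE_iff_measurable[of "space M" M "\<lambda>_. False"] by auto
    then show False using assms(2) by (simp add: emeasure_eq_measure)
  qed
  moreover have "Re (herglotz M z) \<ge> 0"
    unfolding Re_herglotz[OF assms(1)] using poisson_pos[OF assms(1)]
    by (intro integral_nonneg_AE AE_I2 less_imp_le) (auto simp: space_circle)
  ultimately show ?thesis by simp
qed

end

section \<open>The Poisson form of the Muckenhoupt condition\<close>

lemma sin_ge_linear:
  fixes x :: real
  assumes "0 \<le> x" "x \<le> pi / 2"
  shows "2 * x / pi \<le> sin x"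
proof -
  have "concave_on {0..pi} (sin :: real \<Rightarrow> real)"
    by (rule f''_le0_imp_concave[where f'=cos and f''="\<lambda>x. - sin x"])
       (auto intro!: derivative_eq_intros sin_ge_zero)
  from concave_onD[OF this, of "2 * x / pi" 0 "pi / 2"] show ?thesis
    using assms by (simp add: field_simps)
qed

lemma exists_dyadic_level:
  fixes d :: real
  assumes "0 < d" "d \<le> 1"
  obtains n :: nat where "1 / 2 ^ (n + 1) < d" "d \<le> 1 / 2 ^ n"
proof -
  have ex: "\<exists>n. (1/2) ^ n < d" using real_arch_pow_inv[of d "1/2"] assms by auto
  define m where "m = (LEAST n. (1/2) ^ n < d)"
  have m: "(1/2) ^ m < d" unfolding m_def by (rule LeastI_ex[OF ex])
  have "m \<noteq> 0" using m assms by (cases m) auto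
  then obtain n where n: "m = Suc n" by (cases m) auto
  have "\<not> (1/2) ^ n < d" using not_less_Least[of n "\<lambda>n. (1/2) ^ n < d"] n unfolding m_def by simp
  then show ?thesis using that[of n] m n by (simp add: power_one_over)
qed

text \<open>For \<open>k \<le> j\<close> the decay gives
  \<open>a k \<le> \<rho> ^ (j - k) * a j\<close>, so an off-diagonal product is controlled by the
  diagonal one at the larger index, and the double sum becomes a geometric series in
  \<open>j - k\<close> times one in \<open>k\<close>. The factor 8/3 is 2, for the two orders of
  \<open>k\<close> and \<open>j\<close>, times 4/3, the sum of the powers of 1/4.\<close>

lemma dyadic_sum_product_le:
  fixes a b :: "nat \<Rightarrow> real" and c \<rho> :: real
  assumes \<rho>: "0 \<le> \<rho>" "\<rho> < 1" and c: "0 \<le> c"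
    and nonneg: "\<And>k. 0 \<le> a k" "\<And>k. 0 \<le> b k"
    and a: "\<And>k. k < n \<Longrightarrow> a k \<le> \<rho> * a (Suc k)" and b: "\<And>k. k < n \<Longrightarrow> b k \<le> \<rho> * b (Suc k)"
    and ab: "\<And>k. k \<le> n \<Longrightarrow> a k * b k \<le> c * 4 ^ k"
  shows "(\<Sum>k\<le>n. a k / 4 ^ k) * (\<Sum>k\<le>n. b k / 4 ^ k) \<le> 8 / 3 * c / (1 - \<rho>)"
proof -
  have geo: "f k \<le> \<rho> ^ (j - k) * f j"
    if f: "\<And>k. k < n \<Longrightarrow> f k \<le> \<rho> * f (Suc k)" and "k \<le> j" "j \<le> n" for f :: "nat \<Rightarrow> real" and k j
    using \<open>k \<le> j\<close> \<open>j \<le> n\<close>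
  proof (induction j rule: dec_induct)
    case (step j)
    have "f k \<le> \<rho> ^ (j - k) * f j" using step by simp
    also have "... \<le> \<rho> ^ (j - k) * (\<rho> * f (Suc j))" using f[of j] step \<rho> by (intro mult_left_mono) auto
    also have "... = \<rho> ^ (Suc j - k) * f (Suc j)" using step by (simp add: Suc_diff_le)
    finally show ?case .
  qed simp
  define g where "g k j = (if k \<le> j then c * \<rho> ^ (j - k) / 4 ^ k else 0)" for k j :: nat
  have g0: "0 \<le> g k j" for k j using c \<rho> by (simp add: g_def)
  have one: "f k * h j / 4 ^ (k + j) \<le> g k j"
    if f: "\<And>k. k < n \<Longrightarrow> f k \<le> \<rho> * f (Suc k)" "\<And>k. 0 \<le> h k" "\<And>k. k \<le> n \<Longrightarrow> f k * h k \<le> c * 4 ^ k"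
      and kj: "k \<le> j" "j \<le> n" for f h :: "nat \<Rightarrow> real" and k j
  proof -
    have "f k * h j \<le> \<rho> ^ (j - k) * f j * h j" using geo[of f, OF f(1) kj] f(2) by (intro mult_right_mono) auto
    also have "... = \<rho> ^ (j - k) * (f j * h j)" by simp
    also have "... \<le> \<rho> ^ (j - k) * (c * 4 ^ j)" using f(3)[OF kj(2)] \<rho> by (intro mult_left_mono) auto
    finally show ?thesis using kj by (simp add: g_def power_add divide_simps mult_ac)
  qed
  have pair_le: "a k / 4 ^ k * (b j / 4 ^ j) \<le> g k j + g j k" if "k \<le> n" "j \<le> n" for k j
  proof (cases "k \<le> j")
    case True
    then show ?thesis using one[of a b, OF a nonneg(2) ab True \<open>j \<le> n\<close>] g0[of j k] by (simp add: power_add)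
  next
    case False
    then have "j \<le> k" by simp
    have ba: "b k * a k \<le> c * 4 ^ k" if "k \<le> n" for k using ab[OF that] by (simp add: mult.commute)
    show ?thesis using one[of b a, OF b nonneg(1) ba \<open>j \<le> k\<close> \<open>k \<le> n\<close>] g0[of k j] by (simp add: power_add mult.commute)
  qed
  have G: "(\<Sum>k\<le>n. \<Sum>j\<le>n. g k j) \<le> 4 / 3 * c / (1 - \<rho>)"
  proof -
    have inner: "(\<Sum>j\<le>n. g k j) \<le> c / (1 - \<rho>) * (1/4) ^ k" for k
    proof -
      have "(\<Sum>j\<in>{k..n}. \<rho> ^ (j - k)) = (\<Sum>i\<in>(\<lambda>j. j - k) ` {k..n}. \<rho> ^ i)"
        by (subst sum.reindex) (auto simp: inj_on_def)
      also have "... \<le> (\<Sum>i. \<rho> ^ i)" using \<rho> by (intro sum_le_suminf summable_geometric) auto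
      also have "... = 1 / (1 - \<rho>)" using \<rho> by (intro suminf_geometric) auto
      finally have "c / 4 ^ k * (\<Sum>j\<in>{k..n}. \<rho> ^ (j - k)) \<le> c / 4 ^ k * (1 / (1 - \<rho>))"
        using c by (intro mult_left_mono) auto
      moreover have "(\<Sum>j\<le>n. g k j) = (\<Sum>j\<in>{k..n}. g k j)" by (rule sum.mono_neutral_right) (auto simp: g_def)
      moreover have "... = (\<Sum>j\<in>{k..n}. c / 4 ^ k * \<rho> ^ (j - k))" by (intro sum.cong) (auto simp: g_def)
      ultimately show ?thesis by (simp add: sum_distrib_left power_one_over mult.commute)
    qed
    have "(\<Sum>k\<le>n. \<Sum>j\<le>n. g k j) \<le> (\<Sum>k\<le>n. c / (1 - \<rho>) * (1/4) ^ k)" by (intro sum_mono inner)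
    also have "... = c / (1 - \<rho>) * (\<Sum>k\<le>n. (1/4) ^ k)" by (simp add: sum_distrib_left)
    also have "... \<le> c / (1 - \<rho>) * (4/3)"
    proof (intro mult_left_mono)
      have "(\<Sum>k\<le>n. (1/4) ^ k) \<le> (\<Sum>k. (1/4::real) ^ k)" by (intro sum_le_suminf summable_geometric) auto
      also have "... = 4/3" by (subst suminf_geometric) auto
      finally show "(\<Sum>k\<le>n. (1/4::real) ^ k) \<le> 4/3" .
    qed (use c \<rho> in auto)
    finally show ?thesis by (simp add: mult.commute)
  qed
  have "(\<Sum>k\<le>n. a k / 4 ^ k) * (\<Sum>k\<le>n. b k / 4 ^ k) = (\<Sum>k\<le>n. \<Sum>j\<le>n. a k / 4 ^ k * (b j / 4 ^ j))"
    by (rule sum_product)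
  also have "... \<le> (\<Sum>k\<le>n. \<Sum>j\<le>n. g k j + g j k)" by (intro sum_mono pair_le) auto
  also have "... = (\<Sum>k\<le>n. \<Sum>j\<le>n. g k j) + (\<Sum>k\<le>n. \<Sum>j\<le>n. g k j)"
    by (simp add: sum.distrib sum.swap[of g])
  finally show ?thesis using G by simp
qed

section \<open>Dyadic upper bound for the Poisson kernel\<close>

lemma norm_cis_diff_sq:
  fixes r \<phi> \<theta> :: real
  shows "(norm (cis (\<theta> + \<phi>) - r * cis \<theta>))^2 = (1 - r)^2 + 4 * r * (sin (\<phi> / 2))^2"
proof -
  have "cis (\<theta> + \<phi>) - r * cis \<theta> = cis \<theta> * (cis \<phi> - of_real r)" by (simp add: cis_mult[symmetric] algebra_simps)
  then have "norm (cis (\<theta> + \<phi>) - r * cis \<theta>) = norm (cis \<phi> - of_real r)" by (simp add: norm_mult)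
  then have "(norm (cis (\<theta> + \<phi>) - r * cis \<theta>))^2 = (cos \<phi> - r)^2 + (sin \<phi>)^2" by (simp add: cmod_power2)
  also have "... = (1 - r)^2 + 2 * r * (1 - cos \<phi>)"
    using sin_cos_squared_add[of \<phi>] by (simp add: power2_eq_square algebra_simps)
  also have "cos \<phi> = 1 - 2 * (sin (\<phi> / 2))^2" using cos_double_sin[of "\<phi> / 2"] by simp
  finally show ?thesis by simp
qed

lemma poisson_cis:
  fixes r :: real
  assumes "0 \<le> r"
  shows "poisson (r * cis \<theta>) (cis (\<theta> + \<phi>)) = (1 - r^2) / ((1 - r)^2 + 4 * r * (sin (\<phi> / 2))^2)"
  unfolding poisson_def norm_cis_diff_sq using assms by (simp add: norm_mult)

text \<open>At height \<open>1 - r\<close> about \<open>2 ^ -n\<close> and angle about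
  \<open>2 ^ (k - n)\<close> the kernel is of order height over squared angle, that is
  \<open>2 ^ n / 4 ^ k\<close>. A single summand suffices, the one of the smallest arc containing
  \<open>\<xi>\<close>.\<close>

lemma poisson_le_dyadic_sum:
  fixes r :: real
  assumes r: "0 \<le> r" "r < 1" and n: "1 / 2 ^ (n + 1) < 1 - r" "1 - r \<le> 1 / 2 ^ n" and \<xi>: "norm \<xi> = 1"
  shows "poisson (r * cis \<theta>) \<xi> \<le>
    4 * 2 ^ n * (\<Sum>k\<le>n. indicator (mid_arc \<theta> (pi * 2 ^ k / 2 ^ n)) \<xi> / 4 ^ k)"
proof -
  define J where "J k = mid_arc \<theta> (pi * 2 ^ k / 2 ^ n)" for k
  obtain \<phi> where \<phi>: "\<xi> = cis (\<theta> + \<phi>)" "\<bar>\<phi>\<bar> \<le> pi"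
  proof -
    define \<phi> where "\<phi> = Arg (\<xi> / cis \<theta>)"
    have nz: "\<xi> / cis \<theta> \<noteq> 0" "norm (\<xi> / cis \<theta>) = 1" using \<xi> by (auto simp: norm_divide)
    have "cis \<phi> = \<xi> / cis \<theta>" unfolding \<phi>_def using cis_Arg[OF nz(1)] nz(2) by (simp add: sgn_eq)
    then have "\<xi> = cis (\<theta> + \<phi>)" by (simp add: cis_mult[symmetric])
    moreover have "\<bar>\<phi>\<bar> \<le> pi" unfolding \<phi>_def using Arg_bounded[of "\<xi> / cis \<theta>"] by auto
    ultimately show ?thesis by (rule that)
  qed
  have inJ: "\<xi> \<in> J k" if "\<bar>\<phi>\<bar> \<le> pi * 2 ^ k / 2 ^ n" for k
    unfolding J_def \<phi>(1) using that by (intro imageI) auto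
  have ex: "\<exists>k. \<bar>\<phi>\<bar> \<le> pi * 2 ^ k / 2 ^ n" using \<phi>(2) by (intro exI[of _ n]) simp
  define k where "k = (LEAST k. \<bar>\<phi>\<bar> \<le> pi * 2 ^ k / 2 ^ n)"
  have k: "\<bar>\<phi>\<bar> \<le> pi * 2 ^ k / 2 ^ n" unfolding k_def by (rule LeastI_ex[OF ex])
  have kn: "k \<le> n" unfolding k_def using \<phi>(2) by (intro Least_le) simp
  have "poisson (r * cis \<theta>) \<xi> \<le> 4 * 2 ^ n * (1 / 4 ^ k)"
  proof (cases k)
    case 0
    have "poisson (r * cis \<theta>) \<xi> \<le> (1 + r) / (1 - r)"
      using poisson_le[of "r * cis \<theta>" \<xi>] r \<xi> by (simp add: norm_mult)
    also have "... \<le> 2 / (1 / 2 ^ (n + 1))" using r n by (intro frac_le) auto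
    finally show ?thesis using 0 by simp
  next
    case (Suc m)
    have m: "\<not> \<bar>\<phi>\<bar> \<le> pi * 2 ^ m / 2 ^ n" using not_less_Least[of m "\<lambda>k. \<bar>\<phi>\<bar> \<le> pi * 2 ^ k / 2 ^ n"] Suc unfolding k_def by simp
    \<comment> \<open>A positive level forces \<open>n \<ge> 1\<close>, hence
      \<open>r \<ge> 1/2\<close>; this keeps the coefficient \<open>4 * r\<close> of the squared
      sine away from zero.\<close>
    have "n \<noteq> 0" using kn Suc by simp
    then have "(2::real) ^ n \<ge> 2" using self_le_power[of "2::real" n] by simp
    then have "1 / 2 ^ n \<le> (1/2::real)" by (simp add: divide_simps)
    then have r2: "r \<ge> 1/2" using n by linarith
    have sin: "(2 ^ m / 2 ^ n)^2 \<le> (sin (\<phi> / 2))^2"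
    proof -
      have "2 ^ m / 2 ^ n \<le> \<bar>\<phi>\<bar> / pi" using m by (simp add: field_simps)
      also have "... \<le> sin (\<bar>\<phi>\<bar> / 2)" using sin_ge_linear[of "\<bar>\<phi>\<bar> / 2"] \<phi>(2) by simp
      finally have "(2 ^ m / 2 ^ n)^2 \<le> (sin (\<bar>\<phi>\<bar> / 2))^2" by (intro power_mono) auto
      also have "(sin (\<bar>\<phi>\<bar> / 2))^2 = (sin (\<phi> / 2))^2" by (cases "\<phi> \<ge> 0") auto
      finally show ?thesis .
    qed
    have "2 * (2 ^ m / 2 ^ n)^2 \<le> (4 * r) * (sin (\<phi> / 2))^2" using sin r2 by (intro mult_mono) auto
    then have den: "2 * (2 ^ m / 2 ^ n)^2 \<le> (1 - r)^2 + 4 * r * (sin (\<phi> / 2))^2" by (simp add: add_increasing)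
    have "1 - r^2 = (1 - r) * (1 + r)" by (simp add: algebra_simps power2_eq_square)
    also have "... \<le> (1 / 2 ^ n) * 2" using r n by (intro mult_mono) auto
    finally have num: "1 - r^2 \<le> 2 / 2 ^ n" by simp
    have "poisson (r * cis \<theta>) \<xi> \<le> (2 / 2 ^ n) / (2 * (2 ^ m / 2 ^ n)^2)"
      unfolding \<phi>(1) poisson_cis[OF r(1)] using num den by (intro frac_le) auto
    also have "... = 4 * 2 ^ n * (1 / 4 ^ k)"
      by (simp add: Suc field_simps power2_eq_square power_mult_distrib[symmetric])
    finally show ?thesis .
  qed
  also have "1 / 4 ^ k = (indicator (J k) \<xi> / 4 ^ k :: real)" using inJ[OF k] by simp
  also have "4 * 2 ^ n * (indicator (J k) \<xi> / 4 ^ k :: real) \<le> 4 * 2 ^ n * (\<Sum>k\<le>n. indicator (J k) \<xi> / 4 ^ k)"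
    using kn by (intro mult_left_mono member_le_sum) auto
  finally show ?thesis by (simp add: J_def)
qed

text \<open>The choice \<open>s = c / x\<close> recovers Cauchy-Schwarz from a family of
  inequalities linear in \<open>x\<close> and \<open>y\<close>. Such a family is obtained by
  integrating the pointwise inequality \<open>2 \<le> s w + 1 / (s w)\<close>.\<close>

lemma le_mult_of_forall_amgm:
  fixes x y c :: real
  assumes "0 \<le> x" "0 \<le> y" "0 \<le> c" and le: "\<And>s. s > 0 \<Longrightarrow> 2 * c \<le> s * x + y / s"
  shows "c^2 \<le> x * y"
proof (cases "c = 0 \<or> x = 0")
  case True
  show ?thesis
  proof (cases "c = 0")
    case False
    then have "x = 0" using True by simp
    \<comment> \<open>With \<open>x = 0\<close> any large \<open>s\<close> contradicts
      \<open>c > 0\<close>; adding 1 to \<open>y\<close> keeps \<open>s\<close> positive when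
      \<open>y = 0\<close>.\<close>
    then have "2 * c \<le> y / ((y + 1) / c)" using le[of "(y + 1) / c"] False assms by simp
    also have "... = c * (y / (y + 1))" by simp
    also have "... \<le> c * 1" using assms by (intro mult_left_mono) auto
    finally show ?thesis using False assms by simp
  qed (use assms in auto)
next
  case False
  then have "2 * c \<le> c / x * x + y / (c / x)" using le[of "c / x"] assms by simp
  then have "c \<le> y * x / c" using False by simp
  then show ?thesis using False assms by (simp add: field_simps power2_eq_square)
qed

text \<open>\<open>upper\<close> is the \<open>A2\<close> condition, available for arcs only.
  \<open>lower\<close> is Cauchy-Schwarz for a weight and its reciprocal; it is asked on all
  measurable sets because it is applied to the difference of two arcs.\<close>

locale circle_A2_pair = M: circle_measure M + N: circle_measure N for M N :: "complex measure" +
  fixes A :: real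
  assumes A: "1 \<le> A"
    and upper: "\<And>a b. a < b \<Longrightarrow> b \<le> a + 2 * pi \<Longrightarrow>
      measure M (cis ` {a..b}) * measure N (cis ` {a..b}) \<le> A * ((b - a) / (2 * pi))^2"
    and lower: "\<And>E. E \<in> sets arc_length \<Longrightarrow> (measure arc_length E / (2 * pi))^2 \<le> measure M E * measure N E"
begin

lemma swap: "circle_A2_pair N M A"
  using A upper lower by unfold_locales (simp_all add: mult.commute)

text \<open>Crude dyadic summation of \<open>upper\<close> loses a logarithm; the geometric decay proved here recovers it.\<close>

lemma reverse_doubling:
  assumes h: "0 < h" "2 * h \<le> pi"
  shows "measure M (mid_arc \<theta> h) \<le> (1 - 1 / (4 * A)) * measure M (mid_arc \<theta> (2 * h))"
proof -
  let ?I = "mid_arc \<theta> h" and ?J = "mid_arc \<theta> (2 * h)"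
  have sub: "?I \<subseteq> ?J" using h by (intro image_mono) auto
  have sM: "?I \<in> sets M" "?J \<in> sets M" using arc_in_sets by (simp_all add: M.sets_circle sets_arc_length)
  have sN: "?I \<in> sets N" "?J \<in> sets N" using arc_in_sets by (simp_all add: N.sets_circle sets_arc_length)
  have arc: "measure arc_length (cis ` {a..b}) = b - a" if "a \<le> b" "b \<le> a + 2 * pi" for a b
    using emeasure_arc[OF that] that by (simp add: measure_def)
  \<comment> \<open>The difference has half the arc length of \<open>?J\<close>. Playing
    \<open>lower\<close> on it against \<open>upper\<close> on \<open>?J\<close> shows that it
    carries at least the fraction \<open>1 / (4 * A)\<close> of the mass.\<close>
  have "measure arc_length (?J - ?I) = 2 * h"
    using h by (subst arc_length.finite_measure_Diff[OF _ _ sub]) (simp_all add: arc)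
  with lower[of "?J - ?I"] have 1: "(h / pi)^2 \<le> measure M (?J - ?I) * measure N (?J - ?I)" by simp
  also have "... \<le> measure M (?J - ?I) * measure N ?J"
    using sN by (intro mult_left_mono N.finite_measure_mono) auto
  finally have 1: "(h / pi)^2 \<le> measure M (?J - ?I) * measure N ?J" .
  have "measure M ?J * measure N ?J \<le> A * (4 * h / (2 * pi))^2"
    using upper[of "\<theta> - 2 * h" "\<theta> + 2 * h"] h by simp
  also have "... = 4 * A * (h / pi)^2" by (simp add: power2_eq_square)
  also have "... \<le> 4 * A * (measure M (?J - ?I) * measure N ?J)" using 1 A by (intro mult_left_mono) auto
  finally have "measure M ?J * measure N ?J \<le> (4 * A * measure M (?J - ?I)) * measure N ?J" by simp
  moreover have "measure N ?J > 0"
  proof (rule ccontr)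
    assume "\<not> ?thesis"
    then have "measure N ?J = 0" using measure_nonneg[of N ?J] by linarith
    then have "(h / pi)^2 \<le> 0" using 1 by simp
    then show False using h by simp
  qed
  ultimately have "measure M ?J \<le> 4 * A * measure M (?J - ?I)" by simp
  also have "measure M (?J - ?I) = measure M ?J - measure M ?I" using sM sub by (intro M.finite_measure_Diff) auto
  finally show ?thesis using A by (simp add: field_simps)
qed

lemma Re_herglotz_le_dyadic:
  fixes r :: real
  assumes r: "0 \<le> r" "r < 1" and n: "1 / 2 ^ (n + 1) < 1 - r" "1 - r \<le> 1 / 2 ^ n"
  shows "Re (herglotz M (r * cis \<theta>)) \<le>
    4 * 2 ^ n * (\<Sum>k\<le>n. measure M (mid_arc \<theta> (pi * 2 ^ k / 2 ^ n)) / 4 ^ k)"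
proof -
  let ?J = "\<lambda>k. (mid_arc \<theta> (pi * 2 ^ k / 2 ^ n))"
  have z: "norm (r * cis \<theta>) < 1" using r by (simp add: norm_mult)
  have [measurable]: "?J k \<in> sets M" for k using arc_in_sets by (simp add: M.sets_circle sets_arc_length)
  have int: "integrable M (\<lambda>\<xi>. indicator (?J k) \<xi> / 4 ^ k :: real)" for k
    by (intro integrable_divide_zero integrable_real_indicator) (auto simp: M.emeasure_eq_measure)
  have "Re (herglotz M (r * cis \<theta>)) = (\<integral>\<xi>. poisson (r * cis \<theta>) \<xi> \<partial>M)" by (rule M.Re_herglotz[OF z])
  also have "... \<le> (\<integral>\<xi>. 4 * 2 ^ n * (\<Sum>k\<le>n. indicator (?J k) \<xi> / 4 ^ k) \<partial>M)"
    using poisson_le_dyadic_sum[OF assms]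
    by (intro integral_mono M.poisson_integrable z integrable_mult_right Bochner_Integration.integrable_sum int)
       (auto simp: M.space_circle)
  also have "... = 4 * 2 ^ n * (\<Sum>k\<le>n. measure M (?J k) / 4 ^ k)"
  proof -
    have "?J k \<inter> unit_circle = ?J k" for k by auto
    then show ?thesis using int by (simp add: M.space_circle)
  qed
  finally show ?thesis .
qed

lemma Re_herglotz_mult_le:
  assumes z: "norm z < 1"
  shows "Re (herglotz M z) * Re (herglotz N z) \<le> 512 / 3 * A^2"
proof -
  define r \<theta> where "r = norm z" and "\<theta> = Arg z"
  have zr: "z = r * cis \<theta>" unfolding r_def \<theta>_def by (metis rcis_cmod_Arg rcis_def)
  have r: "0 \<le> r" "r < 1" using z by (auto simp: r_def)
  obtain n where n: "1 / 2 ^ (n + 1) < 1 - r" "1 - r \<le> 1 / 2 ^ n"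
    using exists_dyadic_level[of "1 - r"] r by auto
  interpret S: circle_A2_pair N M A by (rule swap)
  define J where "J k = mid_arc \<theta> (pi * 2 ^ k / 2 ^ n)" for k
  define \<rho> where "\<rho> = 1 - 1 / (4 * A)"
  have \<rho>: "0 \<le> \<rho>" "\<rho> < 1" "1 - \<rho> = 1 / (4 * A)" using A by (auto simp: \<rho>_def field_simps)
  have h: "0 < pi * 2 ^ k / 2 ^ n" "2 * (pi * 2 ^ k / 2 ^ n) = pi * 2 ^ Suc k / 2 ^ n" for k by auto
  have h': "pi * 2 ^ k / 2 ^ n \<le> pi" if "k \<le> n" for k
    using power_increasing[OF that, of "2::real"] by (simp add: divide_le_eq)
  have dM: "measure M (J k) \<le> \<rho> * measure M (J (Suc k))" if "k < n" for k
    using reverse_doubling[of "pi * 2 ^ k / 2 ^ n" \<theta>] h'[of "Suc k"] that unfolding J_def \<rho>_def h(2) by simp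
  have dN: "measure N (J k) \<le> \<rho> * measure N (J (Suc k))" if "k < n" for k
    using S.reverse_doubling[of "pi * 2 ^ k / 2 ^ n" \<theta>] h'[of "Suc k"] that unfolding J_def \<rho>_def h(2) by simp
  have prod: "measure M (J k) * measure N (J k) \<le> (A / 4 ^ n) * 4 ^ k" if "k \<le> n" for k
  proof -
    have "measure M (J k) * measure N (J k) \<le> A * ((2 * (pi * 2 ^ k / 2 ^ n)) / (2 * pi))^2"
      using upper[of "\<theta> - pi * 2 ^ k / 2 ^ n" "\<theta> + pi * 2 ^ k / 2 ^ n"] h(1)[of k] h'[OF that] unfolding J_def by simp
    also have "((2 * (pi * 2 ^ k / 2 ^ n)) / (2 * pi))^2 = (2 ^ k / 2 ^ n)^2" by simp
    also have "... = 4 ^ k / (4::real) ^ n" by (simp add: power_divide power2_eq_square power_mult_distrib[symmetric])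
    finally show ?thesis by simp
  qed
  have "Re (herglotz M z) * Re (herglotz N z) \<le>
     (4 * 2 ^ n * (\<Sum>k\<le>n. measure M (J k) / 4 ^ k)) * (4 * 2 ^ n * (\<Sum>k\<le>n. measure N (J k) / 4 ^ k))"
  proof (rule mult_mono)
    show "Re (herglotz M z) \<le> 4 * 2 ^ n * (\<Sum>k\<le>n. measure M (J k) / 4 ^ k)"
      unfolding zr J_def by (rule Re_herglotz_le_dyadic[OF r n])
    show "Re (herglotz N z) \<le> 4 * 2 ^ n * (\<Sum>k\<le>n. measure N (J k) / 4 ^ k)"
      unfolding zr J_def by (rule S.Re_herglotz_le_dyadic[OF r n])
    show "0 \<le> Re (herglotz N z)"
      unfolding N.Re_herglotz[OF z] using poisson_pos[OF z]
      by (intro integral_nonneg_AE AE_I2 less_imp_le) (auto simp: N.space_circle)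
  qed (auto intro!: sum_nonneg mult_nonneg_nonneg)
  also have "... = 16 * 4 ^ n * ((\<Sum>k\<le>n. measure M (J k) / 4 ^ k) * (\<Sum>k\<le>n. measure N (J k) / 4 ^ k))"
    by (simp add: power_mult_distrib[symmetric])
  \<comment> \<open>The powers of 4 cancel since the diagonal products have constant
    \<open>A / 4 ^ n\<close>; the second factor \<open>A\<close> is the price
    \<open>1 / (1 - \<rho>) = 4 * A\<close> of the geometric decay.\<close>
  also have "... \<le> 16 * 4 ^ n * (8 / 3 * (A / 4 ^ n) / (1 - \<rho>))"
    using A by (intro mult_left_mono dyadic_sum_product_le \<rho> dM dN prod) auto
  also have "... = 512 / 3 * A^2" unfolding \<rho>(3) using A by (simp add: power2_eq_square)
  finally show ?thesis .
qed

end

section \<open>Mean values over the circle and the mass of the Poisson kernel\<close>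

lemma superharmonic_Re:
  assumes "f holomorphic_on S" "open S" shows "superharmonic S (\<lambda>s. Re (f s))"
  by (rule superharmonicI[OF dir_C2_holomorphic(1)[OF assms] dir_C2_holomorphic(1)[OF assms]]) simp

lemma exp_mem_ball: "0 < R \<Longrightarrow> exp s \<in> ball 0 R \<longleftrightarrow> Re s < ln R"
  by (simp add: norm_exp_eq_Re) (metis exp_less_cancel_iff exp_ln)

lemma holomorphic_exp_half_plane:
  assumes "f holomorphic_on ball 0 R" "0 < R"
  shows "(\<lambda>s. f (exp s)) holomorphic_on {s. Re s < ln R}"
proof -
  have "f \<circ> exp holomorphic_on {s. Re s < ln R}"
    by (rule holomorphic_on_compose_gen[OF _ assms(1)])
       (use exp_mem_ball[OF assms(2)] in \<open>auto intro!: holomorphic_intros\<close>)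
  then show ?thesis by (simp add: o_def)
qed

lemma open_left_half_plane: "open {s. Re s < c}"
  by (intro open_Collect_less continuous_intros)

lemma mean_value_Re:
  assumes f: "f holomorphic_on ball 0 R" and R: "R > 1"
  shows "integral {0..2*pi} (\<lambda>x. Re (f (cis x))) = 2 * pi * Re (f 0)"
proof -
  have le: "integral {0..2*pi} (\<lambda>x. Re (g (cis x))) \<le> 2 * pi * Re (g 0)" if g: "g holomorphic_on ball 0 R" for g
  proof (rule superharmonic_mean_disc[OF R])
    show "superharmonic {s. Re s < ln R} (\<lambda>s. Re (g (exp s)))"
      using R by (intro superharmonic_Re holomorphic_exp_half_plane open_left_half_plane that) auto
    show "isCont (\<lambda>z. Re (g z)) 0"
    proof (intro isCont_Re)
      show "isCont g 0" using holomorphic_on_imp_continuous_on[OF g] R by (simp add: continuous_on_eq_continuous_at)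
    qed
  qed
  have "(\<lambda>z. - f z) holomorphic_on ball 0 R" by (intro holomorphic_intros f)
  from le[OF f] le[OF this] show ?thesis by simp
qed

lemma measurable_arc_length_continuous:
  fixes f :: "complex \<Rightarrow> real"
  assumes "continuous_on unit_circle f" shows "f \<in> borel_measurable arc_length"
  using borel_measurable_continuous_on_restrict[OF assms] by (simp add: measurable_cong_sets[OF sets_arc_length refl])

text \<open>Bridge between the two integrals in use: mean value inequalities are proved for the
  gauge integral in the angle, statements on measures with \<open>nn_integral\<close>.\<close>

lemma nn_integral_arc_length_continuous:
  fixes g :: "complex \<Rightarrow> real"
  assumes g: "continuous_on unit_circle g" and nonneg: "\<And>\<xi>. norm \<xi> = 1 \<Longrightarrow> 0 \<le> g \<xi>"
  shows "(\<integral>\<^sup>+\<xi>. ennreal (g \<xi>) \<partial>arc_length) = ennreal (integral {0..2*pi} (\<lambda>x. g (cis x)))"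
proof -
  have meas: "g \<in> borel_measurable arc_length" by (rule measurable_arc_length_continuous[OF g])
  have cont: "continuous_on {0..2*pi} (\<lambda>x. g (cis x))"
    by (intro continuous_on_compose2[OF g] continuous_intros) auto
  have "(\<integral>\<^sup>+\<xi>. ennreal (g \<xi>) \<partial>arc_length) = (\<integral>\<^sup>+x\<in>{0..<0 + 2*pi}. ennreal (g (cis x)) \<partial>lborel)"
    by (rule nn_integral_arc_length) (use meas in measurable)
  also have "... = (\<integral>\<^sup>+x. ennreal (indicator {0..2*pi} x * g (cis x)) \<partial>lborel)"
  proof (rule nn_integral_cong_AE)
    have "AE x in lborel. x \<noteq> 2 * pi" by (rule AE_lborel_singleton)
    then show "AE x in lborel. ennreal (g (cis x)) * indicator {0..<0 + 2*pi} x = ennreal (indicator {0..2*pi} x * g (cis x))"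
      by eventually_elim (auto split: split_indicator)
  qed
  also have "... = integral {0..2*pi} (\<lambda>x. g (cis x))"
  proof -
    have I: "((\<lambda>x. indicator {0..2*pi} x * g (cis x)) has_integral integral {0..2*pi} (\<lambda>x. g (cis x))) UNIV"
    proof -
      have "((\<lambda>x. g (cis x)) has_integral integral {0..2*pi} (\<lambda>x. g (cis x))) {0..2*pi}"
        by (intro integrable_integral integrable_continuous_real cont)
      then have "((\<lambda>x. if x \<in> {0..2*pi} then g (cis x) else 0) has_integral integral {0..2*pi} (\<lambda>x. g (cis x))) UNIV"
        by (simp only: has_integral_restrict_UNIV)
      also have "(\<lambda>x. if x \<in> {0..2*pi} then g (cis x) else 0) = (\<lambda>x. indicator {0..2*pi} x * g (cis x))"
        by (auto simp: indicator_def)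
      finally show ?thesis .
    qed
    show ?thesis
    proof (rule nn_integral_has_integral_lborel[OF _ _ I])
      have [measurable]: "(\<lambda>x. g (cis x)) \<in> borel_measurable borel"
        using meas by measurable
      show "(\<lambda>x. indicator {0..2*pi} x * g (cis x)) \<in> borel_measurable borel" by measurable
      show "0 \<le> indicator {0..2*pi} x * g (cis x)" for x using nonneg by simp
    qed
  qed
  finally show ?thesis .
qed

lemma continuous_on_poisson: "norm z < 1 \<Longrightarrow> continuous_on unit_circle (poisson z)"
  unfolding poisson_def by (intro continuous_intros) auto

lemma measurable_poisson: "norm z < 1 \<Longrightarrow> poisson z \<in> borel_measurable arc_length"
  by (intro measurable_arc_length_continuous continuous_on_poisson)

text \<open>As a function of the boundary point the kernel is the real part of
  \<open>(1 + \<zeta> cnj z) / (1 - \<zeta> cnj z)\<close>, which is holomorphic beyond the closed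
  disc and equals 1 at the centre.\<close>

lemma nn_integral_poisson:
  assumes z: "norm z < 1"
  shows "(\<integral>\<^sup>+\<xi>. poisson z \<xi> \<partial>arc_length) = ennreal (2 * pi)"
proof -
  \<comment> \<open>A radius exceeding 1 with \<open>R * norm z < 1\<close>, which keeps the pole of
    \<open>f\<close> outside.\<close>
  define R where "R = 2 / (1 + norm z)"
  have R: "R > 1" using z by (auto simp: R_def field_simps add_pos_nonneg)
  define f where "f \<zeta> = (1 + \<zeta> * cnj z) / (1 - \<zeta> * cnj z)" for \<zeta>
  have nz: "1 - \<zeta> * cnj z \<noteq> 0" if "\<zeta> \<in> ball 0 R" for \<zeta>
  proof
    assume "1 - \<zeta> * cnj z = 0"
    then have eq: "norm (\<zeta> * cnj z) = 1" by simp
    have "norm (\<zeta> * cnj z) \<le> R * norm z" using that by (simp add: norm_mult mult_right_mono)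
    also have "... < 1" using z by (auto simp: R_def field_simps add_pos_nonneg)
    finally show False using eq by simp
  qed
  have f: "f holomorphic_on ball 0 R" unfolding f_def using nz by (intro holomorphic_intros) auto
  have "integral {0..2*pi} (\<lambda>x. poisson z (cis x)) = integral {0..2*pi} (\<lambda>x. Re (f (cis x)))"
  proof (rule integral_cong)
    fix x
    have "f (cis x) = cnj ((1 + cnj (cis x) * z) / (1 - cnj (cis x) * z))" by (simp add: f_def)
    then have "Re (f (cis x)) = Re ((1 + cnj (cis x) * z) / (1 - cnj (cis x) * z))" by (simp only: complex_cnj complex.sel cnj.sel)
    also have "... = poisson z (cis x)" by (rule Re_herglotz_kernel) (use z in auto)
    finally show "poisson z (cis x) = Re (f (cis x))" by simp
  qed
  also have "... = 2 * pi" unfolding mean_value_Re[OF f R] by (simp add: f_def)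
  finally show ?thesis
    using poisson_pos[OF z] by (subst nn_integral_arc_length_continuous[OF continuous_on_poisson[OF z]]) (auto simp: less_imp_le)
qed

text \<open>For \<open>x \<le> 0\<close> the convention \<open>inverse 0 = \<infinity>\<close> makes
  the right side infinite, so the inequality can be integrated with no positivity of the
  weight.\<close>

lemma two_le_amgm_ennreal:
  assumes "0 < s" shows "2 \<le> ennreal s * ennreal x + inverse (ennreal x) * ennreal (1 / s)"
proof (cases "x > 0")
  case True
  have "0 \<le> (s * x - 1)^2 / (s * x)" using True assms by simp
  also have "... = s * x + 1 / x * (1 / s) - 2" using True assms by (simp add: field_simps power2_eq_square)
  finally have "ennreal 2 \<le> ennreal (s * x + 1 / x * (1 / s))" by (intro ennreal_leI) simp
  also have "... = ennreal (s * x) + ennreal (1 / x * (1 / s))" using True assms by (intro ennreal_plus) auto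
  also have "... = ennreal s * ennreal x + ennreal (1 / x) * ennreal (1 / s)"
    using True assms by (intro arg_cong2[where f="(+)"] ennreal_mult) auto
  also have "ennreal (1 / x) = inverse (ennreal x)" using True by (simp add: inverse_ennreal inverse_eq_divide)
  finally show ?thesis by simp
next
  case False
  then show ?thesis using assms by (simp add: ennreal_neg ennreal_top_mult)
qed

lemma A2_arc:
  assumes "w \<in> A2" "a < b" "b \<le> a + 2 * pi"
  shows "(\<integral>\<^sup>+\<xi>\<in>cis ` {a..b}. ennreal (w \<xi>) \<partial>arc_length) * (\<integral>\<^sup>+\<xi>\<in>cis ` {a..b}. inverse (ennreal (w \<xi>)) \<partial>arc_length)
    \<le> A2_char w * ennreal ((b - a)^2)"
proof -
  let ?I = "cis ` {a..b}" and ?d = "ennreal (b - a)"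
  let ?x = "\<integral>\<^sup>+\<xi>\<in>?I. ennreal (w \<xi>) \<partial>arc_length" and ?y = "\<integral>\<^sup>+\<xi>\<in>?I. inverse (ennreal (w \<xi>)) \<partial>arc_length"
  have "?I \<in> arcs" using assms by (auto simp: arcs_def)
  then have "arc_avg (\<lambda>\<xi>. ennreal (w \<xi>)) ?I * arc_avg (\<lambda>\<xi>. inverse (ennreal (w \<xi>))) ?I \<le> A2_char w"
    unfolding A2_char_def by (rule SUP_upper)
  then have "(?x / ?d) * (?y / ?d) \<le> A2_char w"
    using emeasure_arc[of a b] assms by (simp add: arc_avg_def)
  then have "(?x / ?d) * (?y / ?d) * (?d * ?d) \<le> A2_char w * (?d * ?d)" by (rule mult_right_mono) simp
  also have "(?x / ?d) * (?y / ?d) * (?d * ?d) = (?x / ?d * ?d) * (?y / ?d * ?d)" by (simp add: mult_ac)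
  also have "... = ?x * ?y"
  proof -
    have "x / ?d * ?d = x" for x
      using assms unfolding ennreal_divide_times by (subst ennreal_divide_self) auto
    then show ?thesis by simp
  qed
  also have "?d * ?d = ennreal ((b - a)^2)" using assms by (simp add: ennreal_mult[symmetric] power2_eq_square)
  finally show ?thesis .
qed

section \<open>The measure conjugate to an \<open>A2\<close> weight\<close>

lemma nn_integral_density_multc:
  assumes [measurable]: "g \<in> borel_measurable M" "p \<in> borel_measurable M"
  shows "(\<integral>\<^sup>+x. p x \<partial>density M (\<lambda>x. g x * c)) = (\<integral>\<^sup>+x. g x * p x \<partial>M) * (c::ennreal)"
proof -
  have "(\<integral>\<^sup>+x. p x \<partial>density M (\<lambda>x. g x * c)) = (\<integral>\<^sup>+x. (g x * p x) * c \<partial>M)"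
    by (subst nn_integral_density) (auto simp: mult_ac)
  also have "... = (\<integral>\<^sup>+x. g x * p x \<partial>M) * c" by (rule nn_integral_multc) measurable
  finally show ?thesis .
qed

text \<open>\<open>N\<close> is the measure with density \<open>1 / (2 \<pi> w)\<close>. The lower
  bound is Cauchy-Schwarz weighted by the Poisson kernel, the upper one the dyadic summation. The
  computation stays in the extended reals until \<open>N\<close> is known to be finite.\<close>

lemma A2_conjugate_pair:
  assumes w: "w \<in> A2" and \<mu>: "\<mu> = density arc_length (\<lambda>\<xi>. ennreal (w \<xi> / (2 * pi)))" and prob: "circle_prob \<mu>"
  obtains N Q where "circle_measure N"
    "\<And>z. norm z < 1 \<Longrightarrow> 1 \<le> Re (herglotz \<mu> z) * Re (herglotz N z)"
    "\<And>z. norm z < 1 \<Longrightarrow> Re (herglotz \<mu> z) * Re (herglotz N z) \<le> Q"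
proof -
  let ?X = "\<lambda>p. \<integral>\<^sup>+\<xi>. inverse (ennreal (w \<xi>)) * p \<xi> \<partial>arc_length"
  let ?W = "\<lambda>p. \<integral>\<^sup>+\<xi>. ennreal (w \<xi>) * p \<xi> \<partial>arc_length"
  let ?L = "\<lambda>p. \<integral>\<^sup>+\<xi>. p \<xi> \<partial>arc_length"
  let ?c = "ennreal (1 / (2 * pi))"
  have [measurable]: "w \<in> borel_measurable arc_length" using w by (simp add: A2_def)
  define N where "N = density arc_length (\<lambda>\<xi>. inverse (ennreal (w \<xi>)) * ?c)"
  have sets\<mu>: "sets \<mu> = sets arc_length" and setsN: "sets N = sets arc_length" by (simp_all add: \<mu> N_def)
  have \<mu>eq: "\<mu> = density arc_length (\<lambda>\<xi>. ennreal (w \<xi>) * ?c)"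
  proof -
    have "ennreal (x / (2 * pi)) = ennreal x * ?c" for x
      by (cases "x \<ge> 0") (simp_all add: ennreal_mult[symmetric] ennreal_neg divide_nonpos_pos)
    then show ?thesis unfolding \<mu> by (intro arg_cong[where f="density arc_length"] ext)
  qed
  have dilate\<mu>: "(\<integral>\<^sup>+\<xi>. p \<xi> \<partial>\<mu>) = ?W p * ?c"
    if [measurable]: "p \<in> borel_measurable arc_length" for p
    unfolding \<mu>eq by (rule nn_integral_density_multc) measurable
  have nnN: "(\<integral>\<^sup>+\<xi>. p \<xi> \<partial>N) = ?X p * ?c"
    if [measurable]: "p \<in> borel_measurable arc_length" for p
    unfolding N_def by (rule nn_integral_density_multc) measurable
  have em: "emeasure \<mu> E = (\<integral>\<^sup>+\<xi>\<in>E. ennreal (w \<xi>) \<partial>arc_length) * ?c"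
    "emeasure N E = (\<integral>\<^sup>+\<xi>\<in>E. inverse (ennreal (w \<xi>)) \<partial>arc_length) * ?c"
    if "E \<in> sets arc_length" for E
    using dilate\<mu>[of "indicator E"] nnN[of "indicator E"] that sets\<mu> setsN by simp_all
  have A2w: "A2_char w < \<infinity>" using w by (simp add: A2_def)
  have up: "emeasure \<mu> (cis ` {a..b}) * emeasure N (cis ` {a..b}) \<le> A2_char w * ennreal (((b - a) / (2 * pi))^2)"
    if "a < b" "b \<le> a + 2 * pi" for a b
  proof -
    have "emeasure \<mu> (cis ` {a..b}) * emeasure N (cis ` {a..b}) =
      ((\<integral>\<^sup>+\<xi>\<in>cis ` {a..b}. ennreal (w \<xi>) \<partial>arc_length) * (\<integral>\<^sup>+\<xi>\<in>cis ` {a..b}. inverse (ennreal (w \<xi>)) \<partial>arc_length))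
       * (?c * ?c)"
      by (simp add: em mult_ac)
    also have "... \<le> (A2_char w * ennreal ((b - a)^2)) * (?c * ?c)"
      by (intro mult_right_mono A2_arc w that) simp
    also have "... = A2_char w * ennreal (((b - a) / (2 * pi))^2)"
      unfolding mult.assoc by (simp add: ennreal_mult[symmetric] power2_eq_square)
    finally show ?thesis .
  qed
  interpret P: prob_space \<mu> using prob by (simp add: circle_prob_def)
  have "emeasure \<mu> unit_circle = 1"
    using P.emeasure_space_1 sets_eq_imp_space_eq[OF sets\<mu>] by (simp add: space_arc_length)
  \<comment> \<open>The full circle is itself an arc and has \<open>\<mu>\<close>-mass 1, so the
    \<open>A2\<close> bound on it limits the mass of \<open>N\<close>.\<close>
  with up[of 0 "2*pi"] have "emeasure N unit_circle \<le> A2_char w" by (simp add: circle_eq_arc)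
  then have "emeasure N (space N) \<noteq> \<infinity>"
    using A2w sets_eq_imp_space_eq[OF setsN] by (auto simp: space_arc_length top_unique)
  then interpret N: finite_measure N by (intro finite_measureI)
  have cM: "circle_measure \<mu>" using sets\<mu> by unfold_locales (simp add: sets_arc_length)
  have cN: "circle_measure N" using setsN by unfold_locales (simp add: sets_arc_length)
  \<comment> \<open>The weight \<open>p\<close> is left free: indicators give \<open>lower\<close>
    of the pair, Poisson kernels give the lower bound in the disc.\<close>
  have amgm: "2 * ?L p * ?c \<le> ennreal s * (\<integral>\<^sup>+\<xi>. p \<xi> \<partial>\<mu>) + (\<integral>\<^sup>+\<xi>. p \<xi> \<partial>N) * ennreal (1 / s)"
    if [measurable]: "p \<in> borel_measurable arc_length" and s: "s > 0" for p s
  proof -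
    have "2 * ?L p = (\<integral>\<^sup>+\<xi>. 2 * p \<xi> \<partial>arc_length)" by (simp add: nn_integral_cmult)
    also have "... \<le> (\<integral>\<^sup>+\<xi>. (ennreal s * ennreal (w \<xi>) + inverse (ennreal (w \<xi>)) * ennreal (1 / s)) * p \<xi> \<partial>arc_length)"
      by (intro nn_integral_mono mult_right_mono two_le_amgm_ennreal s) simp
    also have "... = (\<integral>\<^sup>+\<xi>. ennreal s * (ennreal (w \<xi>) * p \<xi>) + ennreal (1 / s) * (inverse (ennreal (w \<xi>)) * p \<xi>) \<partial>arc_length)"
      by (intro nn_integral_cong) (simp add: distrib_left distrib_right mult_ac)
    also have "... = ennreal s * ?W p + ennreal (1 / s) * ?X p"
      by (subst nn_integral_add) (auto simp: nn_integral_cmult)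
    finally have "2 * ?L p * ?c \<le> (ennreal s * ?W p + ennreal (1 / s) * ?X p) * ?c"
      by (rule mult_right_mono) simp
    also have "... = ennreal s * (\<integral>\<^sup>+\<xi>. p \<xi> \<partial>\<mu>) + (\<integral>\<^sup>+\<xi>. p \<xi> \<partial>N) * ennreal (1 / s)"
      unfolding dilate\<mu>[OF that(1)] nnN[OF that(1)] by (simp add: distrib_left distrib_right mult_ac)
    finally show ?thesis .
  qed
  interpret cM: circle_measure \<mu> by (rule cM)
  interpret cN: circle_measure N by (rule cN)
  define A where "A = max 1 (enn2real (A2_char w))"
  have AA: "A2_char w \<le> ennreal A" using A2w unfolding A_def by (cases "A2_char w") (auto simp: max_def)
  have pair: "circle_A2_pair \<mu> N A"
  proof
    show "1 \<le> A" by (simp add: A_def)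
    show "measure \<mu> (cis ` {a..b}) * measure N (cis ` {a..b}) \<le> A * ((b - a) / (2 * pi))^2"
      if "a < b" "b \<le> a + 2 * pi" for a b
    proof -
      have "emeasure \<mu> (cis ` {a..b}) * emeasure N (cis ` {a..b}) \<le> ennreal A * ennreal (((b - a) / (2 * pi))^2)"
        using up[OF that] mult_right_mono[OF AA] by (rule order_trans) simp
      then show ?thesis
        unfolding P.emeasure_eq_measure N.emeasure_eq_measure
        by (simp add: ennreal_mult[symmetric] A_def)
    qed
    show "(measure arc_length E / (2 * pi))^2 \<le> measure \<mu> E * measure N E" if E: "E \<in> sets arc_length" for E
    proof (rule le_mult_of_forall_amgm)
      fix s :: real assume s: "s > 0"
      have "2 * emeasure arc_length E * ?c \<le> ennreal s * emeasure \<mu> E + emeasure N E * ennreal (1 / s)"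
        using amgm[of "indicator E" s] E s sets\<mu> setsN by simp
      also have "2 * emeasure arc_length E * ?c = ennreal (2 * (measure arc_length E / (2 * pi)))"
      proof -
        have "2 * emeasure arc_length E * ?c = ennreal 2 * ennreal (measure arc_length E) * ?c"
          by (simp add: arc_length.emeasure_eq_measure)
        also have "... = ennreal (2 * (measure arc_length E / (2 * pi)))"
          by (simp add: ennreal_mult[symmetric] del: ennreal_numeral)
        finally show ?thesis .
      qed
      also have "ennreal s * emeasure \<mu> E + emeasure N E * ennreal (1 / s) = ennreal (s * measure \<mu> E + measure N E / s)"
        using s unfolding P.emeasure_eq_measure N.emeasure_eq_measure by (simp add: ennreal_mult[symmetric] flip: ennreal_plus)
      finally show "2 * (measure arc_length E / (2 * pi)) \<le> s * measure \<mu> E + measure N E / s"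
        using s by (subst (asm) ennreal_le_iff) auto
    qed auto
  qed
  have lower: "1 \<le> Re (herglotz \<mu> z) * Re (herglotz N z)" if z: "norm z < 1" for z
  proof -
    have pos: "0 \<le> Re (herglotz \<mu> z)" "0 \<le> Re (herglotz N z)"
      unfolding cM.Re_herglotz[OF z] cN.Re_herglotz[OF z] using poisson_pos[OF z]
      by (intro integral_nonneg_AE AE_I2 less_imp_le; simp add: cM.space_circle cN.space_circle)+
    have "1^2 \<le> Re (herglotz \<mu> z) * Re (herglotz N z)"
    proof (rule le_mult_of_forall_amgm[OF pos])
      fix s :: real assume s: "s > 0"
      have "2 * ?L (poisson z) * ?c \<le> ennreal s * (\<integral>\<^sup>+\<xi>. poisson z \<xi> \<partial>\<mu>) + (\<integral>\<^sup>+\<xi>. poisson z \<xi> \<partial>N) * ennreal (1 / s)"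
        using measurable_poisson[OF z] s by (intro amgm) auto
      also have "2 * ?L (poisson z) * ?c = ennreal 2"
        unfolding nn_integral_poisson[OF z] by (simp add: mult.assoc ennreal_mult[symmetric])
      also have "ennreal s * (\<integral>\<^sup>+\<xi>. poisson z \<xi> \<partial>\<mu>) + (\<integral>\<^sup>+\<xi>. poisson z \<xi> \<partial>N) * ennreal (1 / s)
        = ennreal (s * Re (herglotz \<mu> z) + Re (herglotz N z) / s)"
        using s pos unfolding cM.ennreal_Re_herglotz[OF z, symmetric] cN.ennreal_Re_herglotz[OF z, symmetric]
        by (simp add: ennreal_mult[symmetric] flip: ennreal_plus)
      finally show "2 * 1 \<le> s * Re (herglotz \<mu> z) + Re (herglotz N z) / s"
        using s pos by (subst (asm) ennreal_le_iff) auto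
    qed simp
    then show ?thesis by simp
  qed
  show ?thesis
    by (rule that[OF cN lower circle_A2_pair.Re_herglotz_mult_le[OF pair]])
qed

section \<open>Moebius transport of circular means\<close>

lemma one_minus_i_mult_neq_0: "1 - \<i> * of_real y \<noteq> 0"
  by (simp add: complex_eq_iff)

lemma cis_two_arctan: "cis (2 * arctan y) = (1 + \<i> * y) / (1 - \<i> * y)"
proof -
  have pos: "sqrt (1 + y^2) > 0" by (simp add: add_pos_nonneg)
  have sq: "sqrt (1 + y^2) * sqrt (1 + y^2) = 1 + y^2" by (simp add: add_nonneg_nonneg)
  have "cis (arctan y) = (1 + \<i> * y) / of_real (sqrt (1 + y^2))"
    by (simp add: complex_eq_iff cos_arctan sin_arctan Re_divide_of_real Im_divide_of_real)
  then have "cis (arctan y) * cis (arctan y) = (1 + \<i> * y) * (1 + \<i> * y) / of_real (1 + y^2)"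
    by (simp add: sq flip: of_real_mult)
  also have "of_real (1 + y^2) = (1 + \<i> * y) * (1 - \<i> * y)"
    by (simp add: complex_eq_iff power2_eq_square)
  finally show ?thesis
    using one_minus_i_mult_neq_0[of "-y"] by (simp add: cis_mult)
qed

text \<open>The disc automorphism taking \<open>0\<close> to \<open>x cis \<theta>\<close> and
  \<open>1\<close> to \<open>cis \<theta>\<close>. It carries normalised arc length to the Poisson
  kernel at \<open>x cis \<theta>\<close>, which for \<open>x = 1 - h / pi\<close> lives mainly on
  the arc of half-width \<open>h\<close> about \<open>cis \<theta>\<close>.\<close>

definition moebius :: "real \<Rightarrow> real \<Rightarrow> complex \<Rightarrow> complex"
  where "moebius \<theta> x \<zeta> = cis \<theta> * ((\<zeta> + x) / (1 + x * \<zeta>))"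

lemma moebius_denominator:
  assumes "0 \<le> x" "x * norm \<zeta> < 1" shows "1 + of_real x * \<zeta> \<noteq> (0::complex)"
proof
  assume "1 + of_real x * \<zeta> = 0"
  then have "of_real x * \<zeta> = - 1" by (simp add: add_eq_0_iff)
  then have "norm (of_real x * \<zeta>) = 1" by simp
  then show False using assms by (simp add: norm_mult)
qed

lemma norm_moebius_sq:
  assumes "0 \<le> x" "x * norm \<zeta> < 1"
  shows "(norm (moebius \<theta> x \<zeta>))^2 = 1 + (1 - x^2) * ((norm \<zeta>)^2 - 1) / (norm (1 + x * \<zeta>))^2"
proof -
  have "norm (1 + of_real x * \<zeta>) \<noteq> 0" using moebius_denominator[OF assms] by simp
  moreover have "(norm (\<zeta> + of_real x))^2 = (norm (1 + of_real x * \<zeta>))^2 + (1 - x^2) * ((norm \<zeta>)^2 - 1)"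
    unfolding cmod_power2 by (simp add: algebra_simps power2_eq_square)
  moreover have "(norm (moebius \<theta> x \<zeta>))^2 = (norm (\<zeta> + of_real x))^2 / (norm (1 + of_real x * \<zeta>))^2"
    by (simp only: moebius_def norm_mult norm_divide power_divide norm_cis mult_1)
  ultimately show ?thesis by (simp add: add_divide_distrib)
qed

lemma holomorphic_moebius:
  assumes "0 \<le> x" "x * R \<le> 1" "0 < R" shows "moebius \<theta> x holomorphic_on ball 0 R"
proof -
  have "x * norm \<zeta> < 1" if "norm \<zeta> < R" for \<zeta> :: complex
  proof (cases "x = 0")
    case False
    then have "x * norm \<zeta> < x * R" using that assms by simp
    then show ?thesis using assms by simp
  qed simp
  then show ?thesis
    unfolding moebius_def[abs_def] using moebius_denominator[OF assms(1)]
    by (intro holomorphic_intros) auto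
qed

text \<open>The mean value inequality needs a map defined beyond the unit circle with values in the
  open disc; the factor \<open>r < 1\<close> makes room for it. Here \<open>q R\<close> bounds the
  squared norm of the automorphism on \<open>norm \<zeta> < R\<close>, and it tends to 1 as
  \<open>R\<close> decreases to 1.\<close>

lemma moebius_ball:
  fixes r x \<theta> :: real
  assumes x: "0 \<le> x" "x < 1" and r: "0 < r" "r < 1"
  obtains R where "R > 1" "moebius \<theta> x holomorphic_on ball 0 R"
    "\<And>\<zeta>. norm \<zeta> < R \<Longrightarrow> norm (r * moebius \<theta> x \<zeta>) < 1"
proof -
  define q where "q R = 1 + (1 - x^2) * (R^2 - 1) / (1 - x * R)^2" for R
  have "((\<lambda>R. q R) \<longlongrightarrow> 1 + (1 - x^2) * (1^2 - 1) / (1 - x * 1)^2) (at_right 1)"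
    unfolding q_def using x by (intro tendsto_intros) auto
  moreover have "r^2 < 1" using power_strict_mono[of r 1 2] r by simp
  then have "1 + (1 - x^2) * (1^2 - 1) / (1 - x * 1)^2 < 1 / r^2" using r by (simp add: less_divide_eq)
  ultimately have 1: "eventually (\<lambda>R. q R < 1 / r^2) (at_right 1)" by (rule order_tendstoD(2))
  have "((\<lambda>R. x * R) \<longlongrightarrow> x * 1) (at_right (1::real))" by (intro tendsto_intros)
  then have 2: "eventually (\<lambda>R. x * R < 1) (at_right 1)" using x by (intro order_tendstoD(2)) auto
  have 3: "eventually (\<lambda>R. R > (1::real)) (at_right 1)" by (simp add: eventually_at_right_less)
  obtain R where R: "q R < 1 / r^2" "x * R < 1" "R > 1"
    using eventually_happens[OF eventually_conj[OF 1 eventually_conj[OF 2 3]]] by auto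
  have "norm (r * moebius \<theta> x \<zeta>) < 1" if \<zeta>: "norm \<zeta> < R" for \<zeta>
  proof -
    have xz: "x * norm \<zeta> \<le> x * R" using \<zeta> x by (intro mult_left_mono) auto
    have "(norm (moebius \<theta> x \<zeta>))^2 \<le> q R"
    proof -
      have "(1 - x^2) * ((norm \<zeta>)^2 - 1) / (norm (1 + x * \<zeta>))^2 \<le> (1 - x^2) * (R^2 - 1) / (1 - x * R)^2"
      proof (cases "norm \<zeta> \<le> 1")
        case True
        have "(1 - x^2) * ((norm \<zeta>)^2 - 1) / (norm (1 + x * \<zeta>))^2 \<le> 0"
          using True x by (intro divide_nonpos_nonneg mult_nonneg_nonpos) (auto simp: abs_square_le_1 power_le_one)
        also have "0 \<le> (1 - x^2) * (R^2 - 1) / (1 - x * R)^2"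
          using R x by (intro divide_nonneg_nonneg mult_nonneg_nonneg) (auto simp: abs_square_le_1 one_le_power)
        finally show ?thesis .
      next
        case False
        have "norm \<zeta> ^ 2 \<le> R ^ 2" using \<zeta> by (intro power_mono) auto
        moreover have "1 - x * R \<le> norm (1 + of_real x * \<zeta>)"
          using norm_triangle_ineq2[of 1 "- (of_real x * \<zeta>)"] xz x by (simp add: norm_mult)
        then have "(1 - x * R)^2 \<le> (norm (1 + of_real x * \<zeta>))^2" using R by (intro power_mono) auto
        ultimately show ?thesis
          using False x R by (intro frac_le mult_left_mono mult_nonneg_nonneg) (auto simp: abs_square_le_1 one_le_power)
      qed
      then show ?thesis using norm_moebius_sq[of x \<zeta> \<theta>] x xz R by (simp add: q_def)
    qed
    then have "(norm (moebius \<theta> x \<zeta>))^2 < 1 / r^2" using R by simp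
    then have "(norm (r * moebius \<theta> x \<zeta>))^2 < 1" using r by (simp add: norm_mult power_mult_distrib field_simps)
    then show ?thesis by (simp add: abs_square_less_1)
  qed
  with R show ?thesis by (intro that[of R] holomorphic_moebius x) auto
qed

lemma norm_moebius_circle:
  assumes "0 \<le> x" "x < 1" "norm \<zeta> = 1" shows "norm (moebius \<theta> x \<zeta>) = 1"
proof -
  have "(norm (moebius \<theta> x \<zeta>))^2 = 1" using norm_moebius_sq[of x \<zeta> \<theta>] assms by simp
  then show ?thesis using power2_eq_1_iff[of "norm (moebius \<theta> x \<zeta>)"] norm_ge_zero[of "moebius \<theta> x \<zeta>"] by linarith
qed

text \<open>In the coordinate \<open>tan (t / 2)\<close> on the circle the automorphism is
  multiplication by \<open>(1 - x) / (1 + x)\<close>, followed by the rotation by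
  \<open>\<theta>\<close>.\<close>

lemma moebius_half_angle:
  assumes x: "0 \<le> x" "x < 1" and \<phi>: "\<bar>\<phi>\<bar> < pi"
  shows "moebius \<theta> x (cis (2 * arctan ((1 + x) / (1 - x) * tan (\<phi> / 2)))) = cis (\<theta> + \<phi>)"
proof -
  define \<tau> where "\<tau> = tan (\<phi> / 2)"
  define \<kappa> where "\<kappa> = (1 + x) / (1 - x)"
  have k: "\<kappa> * (1 - x) = 1 + x" using x by (simp add: \<kappa>_def)
  have "\<phi> = 2 * arctan \<tau>" using arctan_tan[of "\<phi> / 2"] \<phi> by (simp add: \<tau>_def abs_less_iff)
  then have c\<phi>: "cis \<phi> = (1 + \<i> * \<tau>) / (1 - \<i> * \<tau>)" using cis_two_arctan by simp
  define P where "P = 1 + \<i> * of_real (\<kappa> * \<tau>)"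
  define Q where "Q = 1 - \<i> * of_real (\<kappa> * \<tau>)"
  have Q: "Q \<noteq> 0" using one_minus_i_mult_neq_0[of "\<kappa> * \<tau>"] by (simp add: Q_def)
  have c: "cis (2 * arctan (\<kappa> * \<tau>)) = P / Q" unfolding cis_two_arctan P_def Q_def by simp
  have kt: "\<kappa> * \<tau> - x * (\<kappa> * \<tau>) = \<tau> + x * \<tau>"
  proof -
    have "\<kappa> * \<tau> - x * (\<kappa> * \<tau>) = (\<kappa> * (1 - x)) * \<tau>" by (simp add: algebra_simps)
    also have "... = \<tau> + x * \<tau>" unfolding k by (simp add: distrib_right)
    finally show ?thesis .
  qed
  have num: "P + of_real x * Q = of_real (1 + x) * (1 + \<i> * \<tau>)" "Q + of_real x * P = of_real (1 + x) * (1 - \<i> * \<tau>)"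
  proof -
    have "P + of_real x * Q = of_real (1 + x) + \<i> * of_real (\<kappa> * \<tau> - x * (\<kappa> * \<tau>))"
      "Q + of_real x * P = of_real (1 + x) - \<i> * of_real (\<kappa> * \<tau> - x * (\<kappa> * \<tau>))"
      by (simp_all add: P_def Q_def complex_eq_iff)
    then show "P + of_real x * Q = of_real (1 + x) * (1 + \<i> * \<tau>)" "Q + of_real x * P = of_real (1 + x) * (1 - \<i> * \<tau>)"
      unfolding kt by (simp_all add: complex_eq_iff algebra_simps)
  qed
  have "(P / Q + x) / (1 + x * (P / Q)) = (P + x * Q) / (Q + x * P)"
    using Q by (simp add: divide_simps)
  also have "... = cis \<phi>"
    unfolding num c\<phi> using x by (simp flip: of_real_add)
  finally show ?thesis
    unfolding moebius_def \<tau>_def[symmetric] \<kappa>_def[symmetric] c by (simp add: cis_mult)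
qed

text \<open>The derivative is the Poisson kernel at \<open>x\<close>, so substituting this angle
  turns a Poisson mean of \<open>G\<close> into a uniform mean of \<open>G\<close> composed with the
  automorphism.\<close>

lemma moebius_angle_deriv:
  assumes x: "0 \<le> x" "x < 1" and \<phi>: "\<bar>\<phi>\<bar> < pi"
  shows "((\<lambda>\<phi>. 2 * arctan ((1 + x) / (1 - x) * tan (\<phi> / 2))) has_real_derivative
    (1 - x^2) / ((1 - x)^2 + 4 * x * (sin (\<phi> / 2))^2)) (at \<phi>)"
proof -
  define \<kappa> where "\<kappa> = (1 + x) / (1 - x)"
  define s c where "s = sin (\<phi> / 2)" and "c = cos (\<phi> / 2)"
  have c: "c > 0" unfolding c_def using \<phi> by (intro cos_gt_zero_pi) auto
  have sc: "s^2 + c^2 = 1" by (simp add: s_def c_def)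
  have den: "0 < (1 - x)^2 + 4 * x * s^2" using x by (intro add_pos_nonneg) auto
  have k: "\<kappa> * (1 - x) = 1 + x" using x by (simp add: \<kappa>_def)
  have "((\<lambda>\<phi>. 2 * arctan (\<kappa> * tan (\<phi> / 2))) has_real_derivative
     2 * (inverse (1 + (\<kappa> * tan (\<phi> / 2))^2) * (\<kappa> * (inverse ((cos (\<phi> / 2))^2) * (1/2))))) (at \<phi>)"
    using c by (auto intro!: derivative_eq_intros simp: c_def)
  also have "2 * (inverse (1 + (\<kappa> * tan (\<phi> / 2))^2) * (\<kappa> * (inverse ((cos (\<phi> / 2))^2) * (1/2)))) = \<kappa> / (c^2 + \<kappa>^2 * s^2)"
  proof -
    have "1 + (\<kappa> * tan (\<phi> / 2))^2 = (c^2 + \<kappa>^2 * s^2) / c^2"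
      using c unfolding tan_def c_def[symmetric] s_def[symmetric]
      by (simp add: power_mult_distrib power_divide add_divide_distrib)
    then show ?thesis using c unfolding c_def[symmetric] by (simp add: divide_simps)
  qed
  also have "... = (1 - x^2) / ((1 - x)^2 + 4 * x * s^2)"
  proof -
    have "(1 - x)^2 + 4 * x * s^2 = (1 - x)^2 * (s^2 + c^2) + 4 * x * s^2" by (simp add: sc)
    also have "... = (1 - x)^2 * c^2 + (1 + x)^2 * s^2"
      by (simp add: algebra_simps power2_eq_square)
    also have "(1 + x)^2 = (1 - x)^2 * \<kappa>^2" using x by (simp add: \<kappa>_def power_divide)
    also have "(1 - x)^2 * c^2 + (1 - x)^2 * \<kappa>^2 * s^2 = (1 - x)^2 * (c^2 + \<kappa>^2 * s^2)"
      by (simp add: algebra_simps)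
    finally have e: "(1 - x)^2 + 4 * x * s^2 = (1 - x)^2 * (c^2 + \<kappa>^2 * s^2)" .
    have "1 - x^2 = (1 - x) * (\<kappa> * (1 - x))" unfolding k by (simp add: power2_eq_square algebra_simps)
    then have "1 - x^2 = (1 - x)^2 * \<kappa>" by (simp add: power2_eq_square)
    then show ?thesis unfolding e using x by simp
  qed
  finally show ?thesis by (simp add: \<kappa>_def s_def)
qed

text \<open>At distance \<open>h / pi\<close> from the circle the numerator is at least
  \<open>h / pi\<close>, and on the arc the denominator is at most \<open>2 * h^2\<close>. Dividing
  by \<open>pi\<close> keeps the radius nonnegative up to \<open>h = pi\<close>, where the point is
  the centre.\<close>

lemma poisson_ge_on_arc:
  fixes h \<phi> :: real
  assumes h: "0 < h" "h \<le> pi" and \<phi>: "\<bar>\<phi>\<bar> \<le> h"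
  shows "1 / (2 * pi * h) \<le> (1 - (1 - h / pi)^2) / ((1 - (1 - h / pi))^2 + 4 * (1 - h / pi) * (sin (\<phi> / 2))^2)"
proof -
  define x where "x = 1 - h / pi"
  let ?d = "(1 - x)^2 + 4 * x * (sin (\<phi> / 2))^2"
  have x: "0 \<le> x" "x < 1" using h by (auto simp: x_def)
  have den: "0 < ?d" using x by (intro add_pos_nonneg) auto
  have "(sin (\<phi> / 2))^2 \<le> (\<phi> / 2)^2" using abs_sin_x_le_abs_x[of "\<phi> / 2"] by (simp only: abs_le_square_iff)
  also have "... \<le> h^2 / 4"
  proof -
    have "\<phi>^2 \<le> h^2" using \<phi> h by (simp add: abs_le_square_iff[symmetric])
    then show ?thesis by (simp add: power_divide)
  qed
  finally have s: "4 * (sin (\<phi> / 2))^2 \<le> h^2" by simp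
  have "?d \<le> (h / pi)^2 + h^2"
  proof (rule add_mono)
    have "x * (4 * (sin (\<phi> / 2))^2) \<le> 1 * h^2" using s x by (intro mult_mono) auto
    then show "4 * x * (sin (\<phi> / 2))^2 \<le> h^2" by simp
  qed (simp add: x_def)
  also have "(h / pi)^2 \<le> h^2" using pi_gt3 by (simp add: power_divide divide_le_eq mult_le_cancel_left1)
  finally have d: "?d \<le> 2 * h^2" by simp
  have "h / pi \<le> (1 - x) * (1 + x)" using x h by (simp add: x_def mult_le_cancel_left1 divide_le_eq)
  then have n: "h / pi \<le> 1 - x^2" by (simp add: algebra_simps power2_eq_square)
  have "1 / (2 * pi * h) = (h / pi) / (2 * h^2)" using h by (simp add: power2_eq_square)
  also have "... \<le> (1 - x^2) / (?d)" using n d h den x by (intro frac_le) (auto simp: power_le_one)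
  finally show ?thesis by (simp add: x_def)
qed

text \<open>On the arc the Poisson kernel is at least \<open>1 / (2 * pi * h)\<close>, so the
  integral over the arc is at most \<open>2 * pi * h\<close> times a Poisson integral, which the
  substitution turns into a circular mean. The bound \<open>h < pi\<close> is strict because
  \<open>tan (\<phi> / 2)\<close> blows up at \<open>pi\<close>.\<close>

lemma nn_integral_arc_le_moebius:
  fixes G :: "complex \<Rightarrow> real"
  assumes G: "continuous_on unit_circle G" and pos: "\<And>\<xi>. norm \<xi> = 1 \<Longrightarrow> 0 \<le> G \<xi>" and h: "0 < h" "h < pi"
  shows "(\<integral>\<^sup>+y\<in>{\<theta> - h..\<theta> + h}. G (cis y) \<partial>lborel) \<le>
    ennreal (2 * pi * h) * ennreal (integral {0..2*pi} (\<lambda>t. G (moebius \<theta> (1 - h / pi) (cis t))))"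
proof -
  define x where "x = 1 - h / pi"
  have x: "0 \<le> x" "x < 1" using h by (auto simp: x_def)
  define g where "g \<phi> = 2 * arctan ((1 + x) / (1 - x) * tan (\<phi> / 2))" for \<phi>
  define g' where "g' \<phi> = (1 - x^2) / ((1 - x)^2 + 4 * x * (sin (\<phi> / 2))^2)" for \<phi>
  define f where "f t = G (moebius \<theta> x (cis t))" for t
  let ?F = "\<lambda>\<phi>. ennreal (f (g \<phi>) * g' \<phi> * indicator {-h..h} \<phi>)"
  have den: "0 < (1 - x)^2 + 4 * x * (sin (\<phi> / 2))^2" for \<phi> using x by (intro add_pos_nonneg) auto
  have g'_ge: "1 / (2 * pi * h) \<le> g' \<phi>" if "\<bar>\<phi>\<bar> \<le> h" for \<phi>
    unfolding g'_def using poisson_ge_on_arc[of h \<phi>] h that by (simp add: x_def)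
  have contG: "continuous_on unit_circle (\<lambda>\<xi>. G (moebius \<theta> x \<xi>))"
  proof (rule continuous_on_compose2[OF G])
    show "continuous_on unit_circle (moebius \<theta> x)"
      unfolding moebius_def[abs_def] using x moebius_denominator[OF x(1)] by (intro continuous_intros) auto
  qed (use norm_moebius_circle[OF x] in auto)
  have f0: "0 \<le> f t" for t unfolding f_def by (intro pos norm_moebius_circle x) simp
  have [measurable]: "(\<lambda>y. G (cis y)) \<in> borel_measurable borel" "f \<in> borel_measurable borel"
    unfolding f_def
    by (intro borel_measurable_continuous_onI continuous_on_compose2[OF G] continuous_on_compose2[OF contG] continuous_intros; auto)+
  have fg: "f (g \<phi>) = G (cis (\<theta> + \<phi>))" if "\<bar>\<phi>\<bar> \<le> h" for \<phi>
    unfolding f_def g_def using moebius_half_angle[OF x, of \<phi> \<theta>] that h by simp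
  have gb: "- pi \<le> g \<phi>" "g \<phi> \<le> pi" for \<phi>
    unfolding g_def using arctan_bounded[of "(1 + x) / (1 - x) * tan (\<phi> / 2)"] by auto
  have "(\<integral>\<^sup>+y\<in>{\<theta> - h..\<theta> + h}. G (cis y) \<partial>lborel) = (\<integral>\<^sup>+\<phi>. ennreal (G (cis (\<theta> + 1 * \<phi>))) * indicator {\<theta> - h..\<theta> + h} (\<theta> + 1 * \<phi>) \<partial>lborel)"
    by (subst nn_integral_real_affine[where c=1 and t=\<theta>]) auto
  also have "... \<le> (\<integral>\<^sup>+\<phi>. ennreal (2 * pi * h) * ?F \<phi> \<partial>lborel)"
  proof (rule nn_integral_mono)
    fix \<phi> :: real
    show "ennreal (G (cis (\<theta> + 1 * \<phi>))) * indicator {\<theta> - h..\<theta> + h} (\<theta> + 1 * \<phi>) \<le> ennreal (2 * pi * h) * ?F \<phi>"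
    proof (cases "\<bar>\<phi>\<bar> \<le> h")
      case True
      have "1 \<le> 2 * pi * h * g' \<phi>" using g'_ge[OF True] h by (simp add: divide_le_eq mult.commute)
      then have "f (g \<phi>) * 1 \<le> f (g \<phi>) * (2 * pi * h * g' \<phi>)" by (intro mult_left_mono f0)
      then have "ennreal (f (g \<phi>)) \<le> ennreal (2 * pi * h * (f (g \<phi>) * g' \<phi>))" by (intro ennreal_leI) (simp add: mult_ac)
      also have "... = ennreal (2 * pi * h) * ennreal (f (g \<phi>) * g' \<phi>)"
        using h f0 g'_ge[OF True] by (intro ennreal_mult mult_nonneg_nonneg) (auto intro: order_trans[rotated])
      finally show ?thesis using True fg[OF True] by (auto simp: indicator_def abs_le_iff)
    next
      case False
      then show ?thesis by (auto simp: indicator_def)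
    qed
  qed
  also have "... = ennreal (2 * pi * h) * (\<integral>\<^sup>+\<phi>. ?F \<phi> \<partial>lborel)"
  proof (rule nn_integral_cmult)
    have "g \<in> borel_measurable borel" unfolding g_def[abs_def] tan_def by measurable
    moreover have "g' \<in> borel_measurable borel" unfolding g'_def[abs_def] by measurable
    ultimately show "(\<lambda>\<phi>. ?F \<phi>) \<in> borel_measurable lborel" by measurable
  qed
  also have "(\<integral>\<^sup>+\<phi>. ?F \<phi> \<partial>lborel) = (\<integral>\<^sup>+t. ennreal (f t * indicator {g (-h)..g h} t) \<partial>lborel)"
  proof (rule nn_integral_substitution[symmetric])
    show "set_borel_measurable borel {g (- h)..g h} f" unfolding set_borel_measurable_def by measurable
    show "(g has_real_derivative g' \<phi>) (at \<phi>)" if "\<phi> \<in> {-h..h}" for \<phi>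
      unfolding g_def[abs_def] g'_def using that h by (intro moebius_angle_deriv x) auto
    show "continuous_on {-h..h} g'" unfolding g'_def[abs_def] using den by (intro continuous_intros) (auto simp: less_imp_neq[symmetric] dest: order_less_imp_not_eq2)
    show "0 \<le> g' \<phi>" if "\<phi> \<in> {-h..h}" for \<phi>
      unfolding g'_def using den[of \<phi>] x by (intro divide_nonneg_pos) (auto simp: abs_square_le_1)
  qed (use h in auto)
  also have "... \<le> (\<integral>\<^sup>+t\<in>{-pi..pi}. ennreal (f t) \<partial>lborel)"
    using gb[of h] gb[of "-h"] f0 by (intro nn_integral_mono) (auto split: split_indicator)
  also have "... = (\<integral>\<^sup>+t\<in>{-pi..pi}. ennreal ((\<lambda>\<xi>. G (moebius \<theta> x \<xi>)) (cis t)) \<partial>lborel)" by (simp add: f_def)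
  also have "... = (\<integral>\<^sup>+\<xi>\<in>cis ` {-pi..pi}. ennreal (G (moebius \<theta> x \<xi>)) \<partial>arc_length)"
  proof (rule nn_integral_arc[symmetric])
    note measurable_arc_length_continuous[OF contG, measurable]
    show "(\<lambda>\<xi>. ennreal (G (moebius \<theta> x \<xi>))) \<in> borel_measurable arc_length" by measurable
  qed auto
  also have "... \<le> (\<integral>\<^sup>+\<xi>. ennreal (G (moebius \<theta> x \<xi>)) \<partial>arc_length)"
    by (intro nn_integral_mono) (auto split: split_indicator)
  also have "... = ennreal (integral {0..2*pi} (\<lambda>t. G (moebius \<theta> x (cis t))))"
    by (intro nn_integral_arc_length_continuous contG pos norm_moebius_circle x)
  finally show ?thesis by (simp add: x_def mult_left_mono)
qed

section \<open>Measures with a Lyapunov function\<close>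

text \<open>Cruder than the sharp bound \<open>- 1 / e\<close>, but it lets
  \<open>u ln u + 1\<close> serve as a nonnegative integrand.\<close>

lemma xlnx_ge_minus_one:
  fixes x :: real assumes "0 < x" shows "- 1 \<le> x * ln x"
proof -
  have "ln (1 / x) \<le> 1 / x - 1" using assms by (intro ln_le_minus_one) auto
  then have "x * - ln x \<le> x * (1 / x - 1)" using assms by (intro mult_left_mono) (auto simp: ln_div)
  then show ?thesis using assms by (simp add: algebra_simps)
qed

text \<open>Outer regularity, applied to the image of arc length under the inclusion of the circle
  in the plane.\<close>

lemma arc_length_outer_open:
  assumes E: "E \<in> sets arc_length" and \<epsilon>: "0 < \<epsilon>"
  obtains O' where "open O'" "E \<subseteq> O'" "O' \<inter> unit_circle \<in> sets arc_length"
    "measure arc_length (O' \<inter> unit_circle - E) < \<epsilon>"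
proof -
  have id: "(\<lambda>x. x) \<in> arc_length \<rightarrow>\<^sub>M borel"
    unfolding measurable_cong_sets[OF sets_arc_length refl] by (rule measurable_restrict_space1) simp
  define L' where "L' = distr arc_length borel (\<lambda>x. x)"
  have L': "emeasure L' B = emeasure arc_length (B \<inter> unit_circle)" if "B \<in> sets borel" for B
    unfolding L'_def using that by (subst emeasure_distr[OF id]) (auto simp: space_arc_length)
  have Eb: "E \<in> sets borel" "E \<subseteq> unit_circle"
    using E sets.sets_into_space[OF E] by (auto simp: sets_arc_length sets_restrict_space_iff space_arc_length)
  have Ei: "E \<inter> unit_circle = E" using Eb by auto
  have fin: "emeasure L' (space L') \<noteq> \<infinity>"
    by (simp add: L'_def L'[unfolded L'_def] emeasure_arc_length_circle)
  have "emeasure L' E < emeasure L' E + ennreal \<epsilon>"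
    unfolding L'[OF Eb(1)] Ei arc_length.emeasure_eq_measure
    using \<epsilon> by (simp add: ennreal_less_iff flip: ennreal_plus)
  then have "(INF U\<in>{U. E \<subseteq> U \<and> open U}. emeasure L' U) < emeasure L' E + ennreal \<epsilon>"
    using outer_regular[OF _ fin Eb(1)] by (simp add: L'_def)
  then obtain U where U: "E \<subseteq> U" "open U" "emeasure L' U < emeasure L' E + ennreal \<epsilon>"
    unfolding INF_less_iff by auto
  have Us: "U \<inter> unit_circle \<in> sets arc_length" using U(2) by (auto simp: sets_arc_length sets_restrict_space_iff)
  have "emeasure arc_length (U \<inter> unit_circle) < emeasure arc_length E + ennreal \<epsilon>"
    using U L'[of U] L'[OF Eb(1)] Ei by simp
  then have "measure arc_length (U \<inter> unit_circle) < measure arc_length E + \<epsilon>"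
    using \<epsilon> unfolding arc_length.emeasure_eq_measure by (simp add: ennreal_plus[symmetric] ennreal_less_iff del: ennreal_plus)
  then have "measure arc_length (U \<inter> unit_circle - E) < \<epsilon>"
    using U Eb Us E by (subst arc_length.finite_measure_Diff) auto
  then show ?thesis using that U Us by blast
qed

lemma continuous_on_circle_dilate:
  assumes f: "continuous_on (ball 0 1) f" and r: "0 < r" "r < 1"
  shows "continuous_on unit_circle (\<lambda>\<xi>. f (of_real r * \<xi>))"
  by (rule continuous_on_compose2[OF f]) (use r in \<open>auto intro!: continuous_intros simp: norm_mult\<close>)

lemma norm_circle_dilate: "0 < r \<Longrightarrow> r < 1 \<Longrightarrow> norm \<xi> = 1 \<Longrightarrow> norm (of_real r * \<xi> :: complex) < 1"
  by (simp add: norm_mult)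

lemma norm_arc_point:
  assumes "0 < h" "h \<le> pi" shows "norm (of_real (1 - h / pi) * cis \<theta>) < 1"
  unfolding norm_mult norm_of_real norm_cis using assms by (simp add: abs_if)

text \<open>The interface retains neither \<open>\<mu>\<close> nor \<open>\<alpha>\<close>. Of
  superharmonicity it keeps the mean value inequality along holomorphic maps into the disc, general
  enough for the composition of a dilation with an automorphism, together with its consequence for
  the entropy.\<close>

locale clark_lyapunov = circle_measure \<nu> for \<nu> :: "complex measure" +
  fixes U :: "complex \<Rightarrow> real" and V :: "complex \<Rightarrow> real" and C :: real
  assumes total: "measure \<nu> (space \<nu>) = 1"
    and U_eq: "\<And>z. U z = Re (herglotz \<nu> z)"
    and V_cont: "continuous_on (ball 0 1) V"
    and V_pos: "\<And>z. norm z < 1 \<Longrightarrow> 0 < V z"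
    and UV_ge: "\<And>z. norm z < 1 \<Longrightarrow> 1 \<le> U z * V z"
    and UV_le: "\<And>z. norm z < 1 \<Longrightarrow> U z * V z \<le> C"
    and V_mean: "\<And>\<psi> R. R > 1 \<Longrightarrow> \<psi> holomorphic_on ball 0 R \<Longrightarrow> (\<And>z. norm z < R \<Longrightarrow> norm (\<psi> z) < 1) \<Longrightarrow>
       integral {0..2*pi} (\<lambda>x. V (\<psi> (cis x))) \<le> 2 * pi * V (\<psi> 0)"
    and entropy: "\<And>r. 0 < r \<Longrightarrow> r < 1 \<Longrightarrow>
       integral {0..2*pi} (\<lambda>x. U (of_real r * cis x) * ln (U (of_real r * cis x))) \<le> 2 * pi * C^2"
begin

lemma U_pos: "norm z < 1 \<Longrightarrow> 0 < U z"
  unfolding U_eq by (rule Re_herglotz_pos) (simp_all add: total)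

lemma C_ge_1: "1 \<le> C"
  using UV_ge[of 0] UV_le[of 0] by simp

lemma U_0: "U 0 = 1"
  by (simp add: U_eq herglotz_0 total)

lemma U_cont: "continuous_on (ball 0 1) U"
  unfolding U_eq by (intro continuous_intros holomorphic_on_imp_continuous_on herglotz_holomorphic)

text \<open>\<open>1 / U\<close> is replaced by \<open>V\<close>, the arc by a Poisson mean, the
  mean by the value of \<open>V\<close> at the image of the centre, and that value by
  \<open>C / U\<close>. The constant is \<open>2 * pi * h\<close> from the arc,
  \<open>2 * pi\<close> from the mean, and \<open>C\<close>; none depends on
  \<open>r\<close>.\<close>

lemma arc_inverse_bound:
  assumes r: "0 < r" "r < 1" and h: "0 < h" "h \<le> pi"
  shows "(\<integral>\<^sup>+\<xi>\<in>mid_arc \<theta> h. ennreal (1 / U (of_real r * \<xi>)) \<partial>arc_length) \<le>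
    ennreal (4 * pi^2 * h * C / U (of_real r * (of_real (1 - h / pi) * cis \<theta>)))"
proof -
  define x where "x = 1 - h / pi"
  let ?J = "mid_arc \<theta> h"
  let ?z = "of_real r * (of_real x * cis \<theta>) :: complex"
  have x: "0 \<le> x" "x < 1" using h by (auto simp: x_def)
  have z0: "norm (?z) < 1"
  proof -
    have "r * x \<le> r * 1" using r x by (intro mult_left_mono) auto
    then have "r * x < 1" using r by linarith
    then show ?thesis using r x by (simp add: norm_mult)
  qed
  have inv_le: "1 / U z \<le> V z" "V z \<le> C / U z" if "norm z < 1" for z
    using UV_ge[OF that] UV_le[OF that] U_pos[OF that] by (auto simp: field_simps)
  have cont: "continuous_on unit_circle (\<lambda>\<xi>. V (of_real r * \<xi>))" by (rule continuous_on_circle_dilate[OF V_cont r])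
  have V0: "0 \<le> V (of_real r * \<xi>)" if "norm \<xi> = 1" for \<xi> using V_pos[OF norm_circle_dilate[OF r that]] by simp
  have meas [measurable]: "(\<lambda>\<xi>. V (of_real r * \<xi>)) \<in> borel_measurable arc_length" by (rule measurable_arc_length_continuous[OF cont])
  have "(\<integral>\<^sup>+\<xi>\<in>?J. ennreal (1 / U (of_real r * \<xi>)) \<partial>arc_length)
     \<le> (\<integral>\<^sup>+\<xi>\<in>?J. ennreal (V (of_real r * \<xi>)) \<partial>arc_length)"
    using inv_le(1)[OF norm_circle_dilate[OF r]]
    by (intro nn_integral_mono mult_right_mono ennreal_leI) (auto simp: space_arc_length)
  also have "... \<le> ennreal (2 * pi * h) * ennreal (2 * pi * V (?z))"
  \<comment> \<open>For \<open>h = pi\<close> the half-angle substitution is singular, but the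
    interior point is the centre, and the plain mean over the circle suffices with room to
    spare.\<close>
  proof (cases "h = pi")
    case True
    have "(\<integral>\<^sup>+\<xi>\<in>?J. ennreal (V (of_real r * \<xi>)) \<partial>arc_length) \<le> (\<integral>\<^sup>+\<xi>. ennreal (V (of_real r * \<xi>)) \<partial>arc_length)"
      by (intro nn_integral_mono) (auto split: split_indicator)
    also have "... = ennreal (integral {0..2*pi} (\<lambda>t. V (of_real r * cis t)))"
      by (rule nn_integral_arc_length_continuous[OF cont V0])
    also have "integral {0..2*pi} (\<lambda>t. V (of_real r * cis t)) \<le> 2 * pi * V (of_real r * 0)"
      using r by (intro V_mean[of "1 / r" "\<lambda>z. of_real r * z"]) (auto intro!: holomorphic_intros simp: norm_mult field_simps)
    also have "of_real r * 0 = ?z" using True by (simp add: x_def)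
    also have "ennreal (2 * pi * V (?z)) = ennreal 1 * ennreal (2 * pi * V (?z))" by simp
    also have "... \<le> ennreal (2 * pi * h) * ennreal (2 * pi * V (?z))"
    proof (intro mult_right_mono ennreal_leI)
      have "1 * 1 \<le> (2 * pi) * pi" using pi_gt3 by (intro mult_mono) auto
      then show "1 \<le> 2 * pi * h" using True by simp
    qed simp
    finally show ?thesis by (simp add: ennreal_leI)
  next
    case False
    with h have h': "h < pi" by simp
    have "(\<integral>\<^sup>+\<xi>\<in>?J. ennreal (V (of_real r * \<xi>)) \<partial>arc_length) = (\<integral>\<^sup>+y\<in>{\<theta> - h..\<theta> + h}. V (of_real r * cis y) \<partial>lborel)"
      using h by (intro nn_integral_arc) auto
    also have "... \<le> ennreal (2 * pi * h) * ennreal (integral {0..2*pi} (\<lambda>t. V (of_real r * moebius \<theta> (1 - h / pi) (cis t))))"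
      by (rule nn_integral_arc_le_moebius[OF cont V0 h(1) h'])
    also have "... \<le> ennreal (2 * pi * h) * ennreal (2 * pi * V (of_real r * moebius \<theta> (1 - h / pi) 0))"
    proof (intro mult_left_mono ennreal_leI)
      obtain R where R: "R > 1" "moebius \<theta> x holomorphic_on ball 0 R"
        "\<And>\<zeta>. norm \<zeta> < R \<Longrightarrow> norm (of_real r * moebius \<theta> x \<zeta>) < 1"
        using moebius_ball[OF x r] by metis
      show "integral {0..2*pi} (\<lambda>t. V (of_real r * moebius \<theta> (1 - h / pi) (cis t))) \<le> 2 * pi * V (of_real r * moebius \<theta> (1 - h / pi) 0)"
        using R unfolding x_def[symmetric]
        by (intro V_mean[of R "\<lambda>z. of_real r * moebius \<theta> x z"] holomorphic_intros) auto
    qed simp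
    also have "moebius \<theta> (1 - h / pi) 0 = of_real x * cis \<theta>" by (simp add: moebius_def x_def)
    finally show ?thesis .
  qed
  also have "... \<le> ennreal (2 * pi * h) * ennreal (2 * pi * (C / U (?z)))"
    using inv_le(2)[OF z0] by (intro mult_left_mono ennreal_leI) auto
  also have "... = ennreal (4 * pi^2 * h * C / U (?z))"
    using h C_ge_1 U_pos[OF z0] by (subst ennreal_mult[symmetric]) (auto simp: power2_eq_square)
  finally show ?thesis by (simp add: x_def)
qed

section \<open>Dilates and their weak limit\<close>

definition radius :: "nat \<Rightarrow> real" where "radius n = 1 - 1 / (real n + 2)"

lemma radius: "0 < radius n" "radius n < 1"
  by (auto simp: radius_def field_simps)

lemma radius_tendsto: "radius \<longlonglongrightarrow> 1"
  unfolding radius_def by real_asymp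

abbreviation U_dil :: "nat \<Rightarrow> complex \<Rightarrow> real"
  where "U_dil n \<xi> \<equiv> U (of_real (radius n) * \<xi>)"

text \<open>The dilates converge weakly to \<open>\<nu>\<close>.\<close>

definition dilate :: "nat \<Rightarrow> complex measure"
  where "dilate n = density arc_length (\<lambda>\<xi>. ennreal (U_dil n \<xi> / (2 * pi)))"

lemma U_radius_cont: "continuous_on unit_circle (\<lambda>\<xi>. U_dil n \<xi>)"
  by (rule continuous_on_circle_dilate[OF U_cont radius])

lemma U_radius_measurable [measurable]: "(\<lambda>\<xi>. U_dil n \<xi>) \<in> borel_measurable arc_length"
  by (rule measurable_arc_length_continuous[OF U_radius_cont])

lemma U_radius_pos: "norm \<xi> = 1 \<Longrightarrow> 0 < U_dil n \<xi>"
  by (rule U_pos[OF norm_circle_dilate[OF radius]])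

lemma integral_U_radius: "integral {0..2*pi} (\<lambda>x. U_dil n (cis x)) = 2 * pi"
proof -
  define R where "R = 1 / radius n"
  have R: "R > 1" using radius[of n] by (simp add: R_def)
  have "(\<lambda>z. herglotz \<nu> (of_real (radius n) * z)) holomorphic_on ball 0 R"
    by (rule holomorphic_on_compose_gen[OF _ herglotz_holomorphic, unfolded o_def])
       (use radius[of n] in \<open>auto intro!: holomorphic_intros simp: norm_mult R_def field_simps\<close>)
  from mean_value_Re[OF this R] show ?thesis using U_0 by (simp add: U_eq)
qed

lemma sets_dilate [simp]: "sets (dilate n) = sets arc_length" by (simp add: dilate_def)

lemma space_dilate [simp]: "space (dilate n) = unit_circle" by (simp add: dilate_def space_arc_length)

lemma emeasure_dilate: "E \<in> sets arc_length \<Longrightarrow> emeasure (dilate n) E = (\<integral>\<^sup>+\<xi>\<in>E. ennreal (U_dil n \<xi> / (2 * pi)) \<partial>arc_length)"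
  unfolding dilate_def by (subst emeasure_density) auto

lemma prob_space_dilate: "prob_space (dilate n)"
proof
  have "emeasure (dilate n) (space (dilate n)) = (\<integral>\<^sup>+\<xi>. ennreal (U_dil n \<xi> / (2 * pi)) \<partial>arc_length)"
    using emeasure_dilate[of "space arc_length" n] by (simp add: space_arc_length[symmetric] cong: nn_integral_cong)
  also have "... = ennreal (integral {0..2*pi} (\<lambda>x. U_dil n (cis x) / (2 * pi)))"
    using U_radius_pos by (intro nn_integral_arc_length_continuous continuous_intros U_radius_cont) (auto simp: less_imp_le)
  also have "... = 1" using integral_U_radius[of n] by simp
  finally show "emeasure (dilate n) (space (dilate n)) = 1" .
qed

text \<open>Truncation at the level \<open>k\<close>: where \<open>u > k\<close> one has
  \<open>u ln k \<le> u ln u\<close>, and the entropy bound controls that part. Nothing on the right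
  depends on \<open>n\<close>, so this is uniform integrability in the manner of de la Vallee
  Poussin.\<close>

lemma measure_dilate_le:
  assumes E: "E \<in> sets arc_length" and k: "1 < k"
  shows "measure (dilate n) E \<le> k * measure arc_length E / (2 * pi) + (C^2 + 1) / ln k"
proof -
  interpret P: prob_space "dilate n" by (rule prob_space_dilate)
  define u where "u \<xi> = U_dil n \<xi>" for \<xi>
  let ?e = "\<lambda>\<xi>. (u \<xi> * ln (u \<xi>) + 1) / (2 * pi * ln k)"
  have ln_pos: "ln k > 0" using k by simp
  have cont: "continuous_on unit_circle (\<lambda>\<xi>. ?e \<xi>)"
    unfolding u_def using U_radius_pos ln_pos by (intro continuous_intros U_radius_cont) (auto simp: less_imp_neq[symmetric] dest: order_less_imp_not_eq2)
  have nn0: "0 \<le> ?e \<xi>" if "norm \<xi> = 1" for \<xi>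
    using xlnx_ge_minus_one[OF U_radius_pos[OF that, of n]] ln_pos by (intro divide_nonneg_pos) (auto simp: u_def)
  have ptw: "u \<xi> / (2 * pi) \<le> k / (2 * pi) + ?e \<xi>" if "norm \<xi> = 1" for \<xi>
  proof (cases "u \<xi> \<le> k")
    case True
    then have "u \<xi> / (2 * pi) \<le> k / (2 * pi)" by (simp add: divide_right_mono)
    then show ?thesis using nn0[OF that] by linarith
  next
    case False
    then have "u \<xi> * ln k \<le> u \<xi> * ln (u \<xi>)" using k by (intro mult_left_mono) auto
    then have "u \<xi> \<le> (u \<xi> * ln (u \<xi>) + 1) / ln k" using ln_pos by (simp add: le_divide_eq)
    then have "u \<xi> / (2 * pi) \<le> (u \<xi> * ln (u \<xi>) + 1) / ln k / (2 * pi)" by (intro divide_right_mono) auto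
    also have "... = ?e \<xi>" by simp
    finally show ?thesis using k by (simp add: add_increasing)
  qed
  have "emeasure (dilate n) E = (\<integral>\<^sup>+\<xi>\<in>E. ennreal (u \<xi> / (2 * pi)) \<partial>arc_length)" unfolding u_def by (rule emeasure_dilate[OF E])
  also have "... \<le> (\<integral>\<^sup>+\<xi>. ennreal (k / (2 * pi)) * indicator E \<xi> + ennreal (?e \<xi>) \<partial>arc_length)"
  proof (rule nn_integral_mono)
    fix \<xi> assume "\<xi> \<in> space arc_length"
    then have n: "norm \<xi> = 1" by (simp add: space_arc_length)
    show "ennreal (u \<xi> / (2 * pi)) * indicator E \<xi> \<le> ennreal (k / (2 * pi)) * indicator E \<xi> + ennreal (?e \<xi>)"
    proof (cases "\<xi> \<in> E")
      case True
      have "ennreal (u \<xi> / (2 * pi)) \<le> ennreal (k / (2 * pi) + ?e \<xi>)"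
        by (intro ennreal_leI ptw n)
      also have "... = ennreal (k / (2 * pi)) + ennreal (?e \<xi>)"
        using k nn0[OF n] by (intro ennreal_plus) auto
      finally show ?thesis using True by simp
    qed simp
  qed
  also have "... = ennreal (k / (2 * pi)) * emeasure arc_length E + (\<integral>\<^sup>+\<xi>. ennreal (?e \<xi>) \<partial>arc_length)"
    using E measurable_arc_length_continuous[OF cont] by (subst nn_integral_add) (auto simp: nn_integral_cmult_indicator)
  also have "(\<integral>\<^sup>+\<xi>. ennreal (?e \<xi>) \<partial>arc_length) = ennreal (integral {0..2*pi} (\<lambda>x. ?e (cis x)))"
    by (rule nn_integral_arc_length_continuous[OF cont nn0])
  also have "integral {0..2*pi} (\<lambda>x. ?e (cis x)) \<le> (C^2 + 1) / ln k"
  proof -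
    have "continuous_on {0..2*pi} (\<lambda>x. U_dil n (cis x))"
      by (rule continuous_on_compose2[OF U_radius_cont]) (auto intro!: continuous_intros)
    then have "continuous_on {0..2*pi} (\<lambda>x. u (cis x) * ln (u (cis x)))"
      unfolding u_def
    proof (intro continuous_intros ballI)
      fix x show "U_dil n (cis x) \<noteq> 0" using U_radius_pos[of "cis x" n] by simp
    qed
    then have int: "(\<lambda>x. u (cis x) * ln (u (cis x))) integrable_on {0..2*pi}" by (rule integrable_continuous_real)
    have "integral {0..2*pi} (\<lambda>x. ?e (cis x)) = integral {0..2*pi} (\<lambda>x. u (cis x) * ln (u (cis x)) + 1) / (2 * pi * ln k)"
      by (rule integral_divide)
    also have "integral {0..2*pi} (\<lambda>x. u (cis x) * ln (u (cis x)) + 1) = integral {0..2*pi} (\<lambda>x. u (cis x) * ln (u (cis x))) + 2 * pi"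
      using int by (subst integral_add) (auto intro: integrable_const_ivl)
    also have "... / (2 * pi * ln k) \<le> (2 * pi * C^2 + 2 * pi) / (2 * pi * ln k)"
      using entropy[OF radius, of n] ln_pos by (intro divide_right_mono add_right_mono) (auto simp: u_def)
    also have "2 * pi * C^2 + 2 * pi = 2 * pi * (C^2 + 1)" by (simp add: algebra_simps)
    also have "2 * pi * (C^2 + 1) / (2 * pi * ln k) = (C^2 + 1) / ln k" by simp
    finally show ?thesis .
  qed
  finally have "emeasure (dilate n) E \<le> ennreal (k / (2 * pi)) * emeasure arc_length E + ennreal ((C^2 + 1) / ln k)"
    by (simp add: ennreal_leI add_left_mono)
  also have "... = ennreal (k * measure arc_length E / (2 * pi) + (C^2 + 1) / ln k)"
    using k unfolding arc_length.emeasure_eq_measure by (simp add: ennreal_mult[symmetric] flip: ennreal_plus)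
  finally show ?thesis
    using k unfolding P.emeasure_eq_measure by (subst (asm) ennreal_le_iff) auto
qed

text \<open>The Poisson kernels concentrate at \<open>\<xi>\<close>, so Fatou's lemma gives the half of weak
  convergence that concerns open sets.\<close>

lemma emeasure_open_le_liminf:
  assumes "open O'"
  shows "emeasure \<nu> (O' \<inter> unit_circle) \<le> liminf (\<lambda>n. emeasure (dilate n) (O' \<inter> unit_circle))"
proof -
  let ?c = "ennreal (1 / (2 * pi))"
  interpret pair_sigma_finite \<nu> arc_length by unfold_locales
  define E where "E = O' \<inter> unit_circle"
  let ?I = "\<lambda>z. \<integral>\<^sup>+\<eta>. ennreal (poisson z \<eta>) * indicator E \<eta> \<partial>arc_length"
  let ?p = "\<lambda>n \<xi> \<eta>. ennreal (poisson (of_real (radius n) * \<xi>) \<eta> / (2 * pi)) * indicator E \<eta>"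
  have E [measurable]: "E \<in> sets arc_length" using assms by (auto simp: E_def sets_arc_length sets_restrict_space_iff)
  then have E\<nu>: "E \<in> sets \<nu>" by (simp add: sets_circle sets_arc_length)
  \<comment> \<open>The Poisson extension of the indicator of \<open>E\<close> at the point
    \<open>radius n\<close> times \<open>\<xi>\<close>. Its integral against \<open>\<nu>\<close> is
    the mass that the dilate gives to \<open>E\<close>, and it tends to 1 at points of the
    relatively open set \<open>E\<close>.\<close>
  define \<Phi> where "\<Phi> n \<xi> = (\<integral>\<^sup>+\<eta>. ?p n \<xi> \<eta> \<partial>arc_length)" for n \<xi>
  have idm: "(\<lambda>x. x) \<in> arc_length \<rightarrow>\<^sub>M borel" "(\<lambda>x. x) \<in> \<nu> \<rightarrow>\<^sub>M borel"
    unfolding measurable_cong_sets[OF sets_arc_length refl] measurable_cong_sets[OF sets_circle refl]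
    by (rule measurable_restrict_space1, simp)+
  have [measurable]: "fst \<in> borel_measurable (\<nu> \<Otimes>\<^sub>M arc_length)" "snd \<in> borel_measurable (\<nu> \<Otimes>\<^sub>M arc_length)"
    by (rule measurable_compose[OF measurable_fst idm(2)], rule measurable_compose[OF measurable_snd idm(1)])
  have Es: "(\<lambda>p. indicator E (snd p) :: ennreal) \<in> borel_measurable (\<nu> \<Otimes>\<^sub>M arc_length)"
    by (rule measurable_compose[OF measurable_snd borel_measurable_indicator[OF E]])
  have pm: "(\<lambda>(\<xi>, \<eta>). ?p n \<xi> \<eta>) \<in> borel_measurable (\<nu> \<Otimes>\<^sub>M arc_length)" for n
  proof -
    have "(\<lambda>p. poisson (of_real (radius n) * fst p) (snd p)) \<in> borel_measurable (\<nu> \<Otimes>\<^sub>M arc_length)"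
      unfolding poisson_def by measurable
    with Es show ?thesis unfolding split_beta by measurable
  qed
  have \<Phi>_int: "(\<integral>\<^sup>+\<xi>. \<Phi> n \<xi> \<partial>\<nu>) = emeasure (dilate n) E" for n
  proof -
    have "(\<integral>\<^sup>+\<xi>. \<Phi> n \<xi> \<partial>\<nu>) = (\<integral>\<^sup>+\<eta>. (\<integral>\<^sup>+\<xi>. ?p n \<xi> \<eta> \<partial>\<nu>) \<partial>arc_length)"
      unfolding \<Phi>_def by (rule Fubini'[symmetric]) (rule pm)
    also have "... = (\<integral>\<^sup>+\<eta>. ennreal (U_dil n \<eta> / (2 * pi)) * indicator E \<eta> \<partial>arc_length)"
    proof (rule nn_integral_cong)
      fix \<eta> assume "\<eta> \<in> space arc_length"
      then have \<eta>: "norm \<eta> = 1" by (simp add: space_arc_length)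
      have b: "norm (of_real (radius n) * \<eta>) < 1" by (rule norm_circle_dilate[OF radius \<eta>])
      have [measurable]: "poisson (of_real (radius n) * \<eta>) \<in> borel_measurable \<nu>"
        using poisson_integrable[OF b] by (rule borel_measurable_integrable)
      have half: "ennreal (y / (2 * pi)) = ennreal y * ?c" if "0 \<le> y" for y
        using that by (simp add: ennreal_mult[symmetric])
      have "(\<integral>\<^sup>+\<xi>. ?p n \<xi> \<eta> \<partial>\<nu>) =
        (\<integral>\<^sup>+\<xi>. ennreal (poisson (of_real (radius n) * \<eta>) \<xi>) * (?c * indicator E \<eta>) \<partial>\<nu>)"
      proof (rule nn_integral_cong)
        fix \<xi> assume "\<xi> \<in> space \<nu>"
        then have \<xi>: "norm \<xi> = 1" by (simp add: space_circle)
        show "?p n \<xi> \<eta> =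
           ennreal (poisson (of_real (radius n) * \<eta>) \<xi>) * (?c * indicator E \<eta>)"
          unfolding poisson_swap[OF \<xi> \<eta>, symmetric]
          using half[OF less_imp_le[OF poisson_pos[OF b \<xi>]]] by (simp only: mult.assoc)
      qed
      also have "... = ennreal (U_dil n \<eta>) * (?c * indicator E \<eta>)"
        unfolding U_eq ennreal_Re_herglotz[OF b] by (rule nn_integral_multc) measurable
      also have "... = ennreal (U_dil n \<eta> / (2 * pi)) * indicator E \<eta>"
        using half[OF less_imp_le[OF U_radius_pos[OF \<eta>]]] by (simp only: mult.assoc)
      finally show "(\<integral>\<^sup>+\<xi>. ?p n \<xi> \<eta> \<partial>\<nu>) = ..." .
    qed
    also have "... = emeasure (dilate n) E" by (rule emeasure_dilate[OF E, symmetric])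
    finally show ?thesis .
  qed
  have lim: "indicator E \<xi> \<le> liminf (\<lambda>n. \<Phi> n \<xi>)" if "\<xi> \<in> space \<nu>" for \<xi>
  proof (cases "\<xi> \<in> E")
    case True
    then have \<xi>: "norm \<xi> = 1" "\<xi> \<in> O'" by (auto simp: E_def)
    obtain \<delta> where \<delta>: "\<delta> > 0" "ball \<xi> \<delta> \<subseteq> O'" using assms \<xi>(2) openE by blast
    \<comment> \<open>Bounds the kernel outside the ball of radius \<open>\<delta>\<close> about
      \<open>\<xi>\<close>: the centre of the kernel is at distance \<open>1 - radius n\<close> from
      \<open>\<xi>\<close>, so at least \<open>\<delta> - (1 - radius n)\<close> remains. It tends
      to zero.\<close>
    define K where "K n = (1 - (radius n)^2) / (\<delta> - (1 - radius n))^2" for n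
    have Klim: "(\<lambda>n. ennreal (1 - K n)) \<longlonglongrightarrow> ennreal (1 - (1 - 1^2) / (\<delta> - (1 - 1))^2)"
      unfolding K_def using \<delta>(1) by (intro tendsto_intros tendsto_ennrealI radius_tendsto) auto
    have "eventually (\<lambda>n. 1 - \<delta> < radius n) sequentially" using \<delta>(1) by (intro order_tendstoD(1)[OF radius_tendsto]) auto
    then have ev: "eventually (\<lambda>n. ennreal (1 - K n) \<le> \<Phi> n \<xi>) sequentially"
    proof eventually_elim
      case (elim n)
      define z where "z = of_real (radius n) * \<xi>"
      have z: "norm z < 1" "norm z = radius n" unfolding z_def using norm_circle_dilate[OF radius \<xi>(1)] \<xi> radius[of n] by (auto simp: norm_mult)
      have [measurable]: "poisson z \<in> borel_measurable arc_length" by (rule measurable_poisson[OF z(1)])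
      have K0: "0 \<le> K n" unfolding K_def using radius[of n] by (intro divide_nonneg_nonneg) (auto simp: power_le_one)
      have far: "poisson z \<eta> \<le> K n" if \<eta>: "norm \<eta> = 1" "\<eta> \<notin> E" for \<eta>
      proof -
        have "\<eta> \<notin> ball \<xi> \<delta>" using \<eta> \<delta>(2) by (auto simp: E_def)
        then have d: "\<delta> \<le> norm (\<eta> - \<xi>)" by (simp add: dist_norm norm_minus_commute)
        have "norm (\<xi> - z) = 1 - radius n"
        proof -
          have "\<xi> - z = of_real (1 - radius n) * \<xi>" by (simp add: z_def algebra_simps)
          then show ?thesis using \<xi> radius[of n] by (simp only: norm_mult norm_of_real) simp
        qed
        then have "\<delta> - (1 - radius n) \<le> norm (\<eta> - z)"
          using d norm_triangle_ineq[of "\<eta> - z" "z - \<xi>"] by (simp add: norm_minus_commute)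
        then have "(\<delta> - (1 - radius n))^2 \<le> (norm (\<eta> - z))^2" using elim by (intro power_mono) auto
        then show ?thesis unfolding poisson_def K_def z(2) using elim radius[of n]
          by (intro frac_le) (auto simp: power_le_one)
      qed
      have "ennreal (2 * pi) = (\<integral>\<^sup>+\<eta>. poisson z \<eta> \<partial>arc_length)" by (rule nn_integral_poisson[OF z(1), symmetric])
      also have "... \<le> (\<integral>\<^sup>+\<eta>. ennreal (poisson z \<eta>) * indicator E \<eta> + ennreal (K n) \<partial>arc_length)"
        using far by (intro nn_integral_mono) (auto simp: space_arc_length indicator_def ennreal_leI)
      also have "... = ?I z + ennreal (K n) * ennreal (2 * pi)"
        using E by (subst nn_integral_add) (auto simp: space_arc_length emeasure_arc_length_circle)
      finally have "ennreal (2 * pi) * ?c \<le> (?I z + ennreal (K n) * ennreal (2 * pi)) * ?c"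
        by (rule mult_right_mono) simp
      also have "ennreal (2 * pi) * ?c = ennreal 1" by (simp add: ennreal_mult[symmetric])
      also have "(?I z + ennreal (K n) * ennreal (2 * pi)) * ?c
         = ?I z * ?c + ennreal (K n)"
        unfolding distrib_right mult.assoc by (simp add: ennreal_mult[symmetric])
      also have "?I z * ?c = \<Phi> n \<xi>"
      proof -
        have "\<Phi> n \<xi> = (\<integral>\<^sup>+\<eta>. (ennreal (poisson z \<eta>) * indicator E \<eta>) * ?c \<partial>arc_length)"
          unfolding \<Phi>_def z_def[symmetric]
        proof (rule nn_integral_cong)
          fix \<eta> assume "\<eta> \<in> space arc_length"
          then have "0 \<le> poisson z \<eta>" using poisson_pos[OF z(1), of \<eta>] by (simp add: space_arc_length)
          then show "ennreal (poisson z \<eta> / (2 * pi)) * indicator E \<eta> = (ennreal (poisson z \<eta>) * indicator E \<eta>) * ?c"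
            by (auto simp: ennreal_mult[symmetric] indicator_def)
        qed
        also have "... = ?I z * ?c"
          by (rule nn_integral_multc) measurable
        finally show ?thesis by simp
      qed
      finally have "ennreal 1 \<le> \<Phi> n \<xi> + ennreal (K n)" .
      then have "ennreal 1 - ennreal (K n) \<le> \<Phi> n \<xi>" by (simp add: ennreal_minus_le_iff add.commute)
      then show ?case using ennreal_minus[OF K0, of 1] by simp
    qed
    have "ennreal 1 = liminf (\<lambda>n. ennreal (1 - K n))" using lim_imp_Liminf[OF _ Klim] by simp
    also have "... \<le> liminf (\<lambda>n. \<Phi> n \<xi>)" by (rule Liminf_mono[OF ev])
    finally show ?thesis using True by simp
  qed simp
  have "emeasure \<nu> E = (\<integral>\<^sup>+\<xi>. indicator E \<xi> \<partial>\<nu>)" using E\<nu> by simp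
  also have "... \<le> (\<integral>\<^sup>+\<xi>. liminf (\<lambda>n. \<Phi> n \<xi>) \<partial>\<nu>)" by (intro nn_integral_mono lim)
  also have "... \<le> liminf (\<lambda>n. \<integral>\<^sup>+\<xi>. \<Phi> n \<xi> \<partial>\<nu>)"
  proof (rule nn_integral_liminf)
    show "\<Phi> n \<in> borel_measurable \<nu>" for n
      unfolding \<Phi>_def[abs_def] using pm[of n] by (intro arc_length.borel_measurable_nn_integral) auto
  qed
  also have "... = liminf (\<lambda>n. emeasure (dilate n) E)" by (simp add: \<Phi>_int)
  finally show ?thesis by (simp add: E_def)
qed

lemma measure_open_eventually:
  assumes "open O'" "0 < \<epsilon>"
  shows "eventually (\<lambda>n. measure \<nu> (O' \<inter> unit_circle) - \<epsilon> < measure (dilate n) (O' \<inter> unit_circle)) sequentially"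
proof (cases "measure \<nu> (O' \<inter> unit_circle) - \<epsilon> < 0")
  case True
  then have "measure \<nu> (O' \<inter> unit_circle) - \<epsilon> < measure (dilate n) (O' \<inter> unit_circle)" for n
    using measure_nonneg[of "dilate n" "O' \<inter> unit_circle"] by linarith
  then show ?thesis by simp
next
  case False
  have "ennreal (measure \<nu> (O' \<inter> unit_circle) - \<epsilon>) < emeasure \<nu> (O' \<inter> unit_circle)"
    using False assms(2) unfolding emeasure_eq_measure by (simp add: ennreal_less_iff)
  then have "eventually (\<lambda>n. ennreal (measure \<nu> (O' \<inter> unit_circle) - \<epsilon>) < emeasure (dilate n) (O' \<inter> unit_circle)) sequentially"
    using emeasure_open_le_liminf[OF assms(1)] unfolding le_Liminf_iff by blast
  then show ?thesis
  proof eventually_elim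
    case (elim n)
    interpret P: prob_space "dilate n" by (rule prob_space_dilate)
    show ?case using elim False unfolding P.emeasure_eq_measure by (simp add: ennreal_less_iff)
  qed
qed

section \<open>Uniform integrability and absolute continuity\<close>

lemma exists_truncation:
  assumes "0 < \<epsilon>" obtains k :: real where "1 < k" "(C^2 + 1) / ln k < \<epsilon>"
proof -
  define k where "k = exp ((C^2 + 1) / \<epsilon> + 1)"
  have p: "0 < (C^2 + 1) / \<epsilon>" using assms by (intro divide_pos_pos add_nonneg_pos) auto
  have ln_pos: "ln k = (C^2 + 1) / \<epsilon> + 1" by (simp add: k_def)
  have "\<epsilon> * ln k = C^2 + 1 + \<epsilon>" unfolding ln_pos distrib_left using assms by simp
  moreover have "0 < ln k" using p ln_pos by linarith
  ultimately have "(C^2 + 1) / ln k < \<epsilon>" using assms by (simp add: pos_divide_less_eq)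
  moreover have "1 < k" using p by (simp add: k_def)
  ultimately show ?thesis using that by blast
qed

lemma uniformly_small_dilates:
  assumes "0 < \<epsilon>"
  obtains \<delta> where "0 < \<delta>" "\<And>E n. E \<in> sets arc_length \<Longrightarrow> measure arc_length E < \<delta> \<Longrightarrow> measure (dilate n) E < \<epsilon>"
proof -
  obtain k where k: "1 < k" "(C^2 + 1) / ln k < \<epsilon> / 2" using exists_truncation[of "\<epsilon> / 2"] assms by auto
  show ?thesis
  proof (rule that[of "\<epsilon> / 2 * (2 * pi) / k"])
    show "0 < \<epsilon> / 2 * (2 * pi) / k" using assms k by simp
    fix E n assume E: "E \<in> sets arc_length" "measure arc_length E < \<epsilon> / 2 * (2 * pi) / k"
    then have "k * measure arc_length E / (2 * pi) < \<epsilon> / 2" using k by (simp add: field_simps)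
    then show "measure (dilate n) E < \<epsilon>" using measure_dilate_le[OF E(1) k(1), of n] k(2) by linarith
  qed
qed

text \<open>A null set is covered by an open set of small arc length. All dilates are uniformly
  small there, and the inequality for open sets hands this smallness to
  \<open>\<nu>\<close>.\<close>

lemma absolutely_continuous_clark: "absolutely_continuous arc_length \<nu>"
  unfolding absolutely_continuous_def
proof
  fix N assume N: "N \<in> null_sets arc_length"
  then have sN: "N \<in> sets arc_length" by auto
  then have s\<nu>: "N \<in> sets \<nu>" by (simp add: sets_circle sets_arc_length)
  have "measure \<nu> N \<le> 0 + \<epsilon>" if \<epsilon>: "0 < \<epsilon>" for \<epsilon>
  proof -
    obtain \<delta> where \<delta>: "0 < \<delta>" "\<And>E n. E \<in> sets arc_length \<Longrightarrow> measure arc_length E < \<delta> \<Longrightarrow> measure (dilate n) E < \<epsilon> / 2"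
      using uniformly_small_dilates[of "\<epsilon> / 2"] \<epsilon> by auto
    obtain O' where O': "open O'" "N \<subseteq> O'" "O' \<inter> unit_circle \<in> sets arc_length" "measure arc_length (O' \<inter> unit_circle - N) < \<delta>"
      by (rule arc_length_outer_open[OF sN \<delta>(1)])
    have "measure arc_length (O' \<inter> unit_circle) = measure arc_length (O' \<inter> unit_circle - N)"
      using measure_Diff_null_set[OF O'(3) N] by simp
    then have small: "measure (dilate n) (O' \<inter> unit_circle) < \<epsilon> / 2" for n using \<delta>(2)[OF O'(3)] O'(4) by simp
    obtain n where "measure \<nu> (O' \<inter> unit_circle) - \<epsilon> / 2 < measure (dilate n) (O' \<inter> unit_circle)"
      using eventually_happens[OF measure_open_eventually[OF O'(1), of "\<epsilon> / 2"]] \<epsilon> by auto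
    moreover have "measure \<nu> N \<le> measure \<nu> (O' \<inter> unit_circle)"
      using O' sets.sets_into_space[OF s\<nu>] by (intro finite_measure_mono) (auto simp: space_circle sets_circle sets_arc_length)
    ultimately show ?thesis using small[of n] by simp
  qed
  then have "measure \<nu> N \<le> 0" by (rule field_le_epsilon)
  then have "measure \<nu> N = 0" using measure_nonneg[of \<nu> N] by linarith
  then show "N \<in> null_sets \<nu>" using s\<nu> by (auto simp: null_sets_def emeasure_eq_measure)
qed

text \<open>Weak convergence alone gives such a bound for closed sets. For arbitrary
  \<open>E\<close> the complement is enlarged to an open set of almost the same arc length; uniform
  integrability makes the excess negligible for every dilate, and all total masses are 1.\<close>

lemma measure_dilate_eventually_le:
  assumes E: "E \<in> sets arc_length" and \<epsilon>: "0 < \<epsilon>"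
  shows "eventually (\<lambda>n. measure (dilate n) E \<le> measure \<nu> E + \<epsilon>) sequentially"
proof -
  define F where "F = unit_circle - E"
  have F: "F \<in> sets arc_length" using E sets.compl_sets[OF E] by (simp add: F_def space_arc_length)
  have \<nu>s: "E \<in> sets \<nu>" "F \<in> sets \<nu>" using E F by (simp_all add: sets_circle sets_arc_length)
  obtain \<delta> where \<delta>: "0 < \<delta>" "\<And>E n. E \<in> sets arc_length \<Longrightarrow> measure arc_length E < \<delta> \<Longrightarrow> measure (dilate n) E < \<epsilon> / 2"
    using uniformly_small_dilates[of "\<epsilon> / 2"] \<epsilon> by auto
  obtain O' where O': "open O'" "F \<subseteq> O'" "O' \<inter> unit_circle \<in> sets arc_length" "measure arc_length (O' \<inter> unit_circle - F) < \<delta>"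
    by (rule arc_length_outer_open[OF F \<delta>(1)])
  have "eventually (\<lambda>n. measure \<nu> (O' \<inter> unit_circle) - \<epsilon> / 2 < measure (dilate n) (O' \<inter> unit_circle)) sequentially"
    using \<epsilon> by (intro measure_open_eventually O') auto
  then show ?thesis
  proof eventually_elim
    case (elim n)
    interpret P: prob_space "dilate n" by (rule prob_space_dilate)
    have FO: "F \<subseteq> O' \<inter> unit_circle" using O' by (auto simp: F_def)
    have "measure (dilate n) (O' \<inter> unit_circle - F) < \<epsilon> / 2" using O' F by (intro \<delta>(2)) auto
    moreover have "measure (dilate n) (O' \<inter> unit_circle - F) = measure (dilate n) (O' \<inter> unit_circle) - measure (dilate n) F"
      using O' F FO by (intro P.finite_measure_Diff) auto
    moreover have "measure \<nu> F \<le> measure \<nu> (O' \<inter> unit_circle)"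
      using FO O'(3) by (intro finite_measure_mono) (auto simp: sets_circle sets_arc_length)
    moreover have "measure (dilate n) F = 1 - measure (dilate n) E"
      using P.prob_compl[of E] E by (simp add: F_def)
    moreover have "measure \<nu> F = 1 - measure \<nu> E"
      using finite_measure_compl[OF \<nu>s(1)] total by (simp add: F_def space_circle)
    ultimately show ?case using elim by linarith
  qed
qed

text \<open>The tangent to the convex function \<open>1 / u\<close> at \<open>u = 1 / y\<close>,
  integrated over \<open>A\<close>. The factor \<open>2 * pi\<close> undoes the normalisation of the
  dilate.\<close>

lemma set_integral_inverse_dilate_ge:
  assumes A [measurable]: "A \<in> sets arc_length" and y: "0 \<le> y"
  shows "ennreal (2 * y * measure arc_length A) \<le>
    (\<integral>\<^sup>+\<xi>\<in>A. ennreal (1 / U_dil n \<xi>) \<partial>arc_length) + ennreal (y^2 * (2 * pi) * measure (dilate n) A)"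
proof -
  let ?c = "y^2 * (2 * pi)"
  interpret P: prob_space "dilate n" by (rule prob_space_dilate)
  define u where "u \<xi> = U_dil n \<xi>" for \<xi>
  have [measurable]: "u \<in> borel_measurable arc_length" unfolding u_def[abs_def] by measurable
  have ptw: "2 * y \<le> 1 / u \<xi> + ?c * (u \<xi> / (2 * pi))" if "norm \<xi> = 1" for \<xi>
  proof -
    have "0 < u \<xi>" unfolding u_def by (rule U_radius_pos[OF that])
    then have "0 \<le> (1 - y * u \<xi>)^2 / u \<xi>" by simp
    also have "... = 1 / u \<xi> + y^2 * u \<xi> - 2 * y" using \<open>0 < u \<xi>\<close> by (simp add: field_simps power2_eq_square)
    finally show ?thesis by simp
  qed
  have "ennreal (2 * y * measure arc_length A) = ennreal (2 * y) * emeasure arc_length A"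
    using y by (simp add: arc_length.emeasure_eq_measure ennreal_mult)
  also have "... = (\<integral>\<^sup>+\<xi>. ennreal (2 * y) * indicator A \<xi> \<partial>arc_length)" by (simp add: nn_integral_cmult_indicator)
  also have "... \<le> (\<integral>\<^sup>+\<xi>. ennreal (1 / u \<xi>) * indicator A \<xi> + ennreal (?c) * (ennreal (u \<xi> / (2 * pi)) * indicator A \<xi>) \<partial>arc_length)"
  proof (rule nn_integral_mono)
    fix \<xi> assume "\<xi> \<in> space arc_length"
    then have n: "norm \<xi> = 1" by (simp add: space_arc_length)
    have u0: "0 < u \<xi>" unfolding u_def by (rule U_radius_pos[OF n])
    have "ennreal (2 * y) \<le> ennreal (1 / u \<xi> + ?c * (u \<xi> / (2 * pi)))" by (intro ennreal_leI ptw n)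
    also have "... = ennreal (1 / u \<xi>) + ennreal (?c * (u \<xi> / (2 * pi)))" using u0 by (intro ennreal_plus) auto
    also have "ennreal (?c * (u \<xi> / (2 * pi))) = ennreal (?c) * ennreal (u \<xi> / (2 * pi))" using u0 by (intro ennreal_mult) auto
    finally show "ennreal (2 * y) * indicator A \<xi> \<le> ennreal (1 / u \<xi>) * indicator A \<xi> + ennreal (?c) * (ennreal (u \<xi> / (2 * pi)) * indicator A \<xi>)"
      by (auto simp: indicator_def)
  qed
  also have "... = (\<integral>\<^sup>+\<xi>\<in>A. ennreal (1 / u \<xi>) \<partial>arc_length) + ennreal (?c) * (\<integral>\<^sup>+\<xi>\<in>A. ennreal (u \<xi> / (2 * pi)) \<partial>arc_length)"
    by (subst nn_integral_add) (auto simp: nn_integral_cmult)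
  also have "(\<integral>\<^sup>+\<xi>\<in>A. ennreal (u \<xi> / (2 * pi)) \<partial>arc_length) = emeasure (dilate n) A" unfolding u_def by (rule emeasure_dilate[OF A, symmetric])
  also have "ennreal (?c) * emeasure (dilate n) A = ennreal (?c * measure (dilate n) A)"
    unfolding P.emeasure_eq_measure by (rule ennreal_mult[symmetric]) auto
  finally show ?thesis by (simp add: u_def)
qed

text \<open>Lower semicontinuity of the integral of \<open>1 / w\<close> along the dilates, by convexity: on the level sets of a
  simple function below \<open>1 / w\<close>, integrate the tangent line inequality \<open>2 y - y\<^sup>2 U \<le> 1 / U\<close>.\<close>

lemma nn_integral_inverse_density_le:
  assumes w [measurable]: "w \<in> borel_measurable arc_length" and w0: "\<And>\<xi>. 0 \<le> w \<xi>"
    and dens: "\<nu> = density arc_length (\<lambda>\<xi>. ennreal (w \<xi> / (2 * pi)))"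
    and h: "0 < h" "h \<le> pi"
  shows "(\<integral>\<^sup>+\<xi>\<in>mid_arc \<theta> h. inverse (ennreal (w \<xi>)) \<partial>arc_length) \<le>
    ennreal (4 * pi^2 * h * C / U (of_real (1 - h / pi) * cis \<theta>))"
proof -
  let ?q = "\<lambda>y. (enn2real y)^2 * (2 * pi)"
  let ?m = "measure arc_length"
  let ?r = "enn2real"
  define I where "I = mid_arc \<theta> h"
  have I [measurable]: "I \<in> sets arc_length" by (simp add: I_def arc_in_sets)
  define z where "z = of_real (1 - h / pi) * cis \<theta>"
  have z: "norm z < 1" unfolding z_def by (rule norm_arc_point[OF h])
  define B where "B = 4 * pi^2 * h * C / U z"
  define Bn where "Bn n = 4 * pi^2 * h * C / U_dil n z" for n
  have rz: "norm (of_real (radius n) * z) < 1" for n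
  proof -
    have "radius n * norm z \<le> 1 * norm z" using radius[of n] by (intro mult_right_mono) auto
    then show ?thesis using z radius[of n] by (simp add: norm_mult)
  qed
  have Bn0: "0 \<le> Bn n" for n unfolding Bn_def using h C_ge_1 U_pos[OF rz, of n] by simp
  have Bn_lim: "Bn \<longlonglongrightarrow> B"
  proof -
    have "isCont U z" using U_cont z by (simp add: continuous_on_eq_continuous_at)
    moreover have "(\<lambda>n. of_real (radius n) * z) \<longlonglongrightarrow> of_real 1 * z" by (intro tendsto_intros radius_tendsto)
    ultimately have "(\<lambda>n. U_dil n z) \<longlonglongrightarrow> U z" by (intro isCont_tendsto_compose[of z U]) auto
    then show ?thesis unfolding Bn_def[abs_def] B_def using U_pos[OF z] by (intro tendsto_intros) auto
  qed
  have bound: "(\<integral>\<^sup>+\<xi>\<in>I. ennreal (1 / U_dil n \<xi>) \<partial>arc_length) \<le> ennreal (Bn n)" for n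
    unfolding I_def Bn_def z_def by (rule arc_inverse_bound[OF radius h])
  \<comment> \<open>Simple functions with finite values suffice, and finiteness makes
    \<open>enn2real\<close> faithful on those values, even where \<open>1 / w\<close> is
    infinite.\<close>
  have main: "integral\<^sup>S arc_length s \<le> ennreal B"
    if s: "simple_function arc_length s" "s \<le> (\<lambda>\<xi>. inverse (ennreal (w \<xi>)) * indicator I \<xi>)" "\<And>\<xi>. s \<xi> < top" for s
  proof -
    define Y where "Y = s ` space arc_length - {0}"
    have finY: "finite Y" using s(1) by (simp add: Y_def simple_function_def)
    define A where "A y = s -` {y} \<inter> space arc_length" for y
    have A [measurable]: "A y \<in> sets arc_length" for y unfolding A_def using s(1) by (rule simple_functionD(2))
    have y: "y = ennreal (?r y)" "0 < ?r y" if "y \<in> Y" for y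
    proof -
      have "y \<noteq> 0" "y < top" using that s(3) by (auto simp: Y_def)
      then show "y = ennreal (?r y)" "0 < ?r y" by (auto simp: enn2real_positive_iff zero_less_iff_neq_zero)
    qed
    have Ap: "\<xi> \<in> I \<and> w \<xi> \<le> 1 / ?r y" if "y \<in> Y" "\<xi> \<in> A y" for y \<xi>
    proof -
      have sx: "s \<xi> = y" using that by (simp add: A_def)
      have le: "y \<le> inverse (ennreal (w \<xi>)) * indicator I \<xi>" using s(2) sx by (auto simp: le_fun_def)
      have "y \<noteq> 0" using that by (simp add: Y_def)
      with le have xI: "\<xi> \<in> I" by (cases "\<xi> \<in> I") auto
      have "w \<xi> \<le> 1 / ?r y"
      proof (cases "w \<xi> = 0")
        case False
        then have wp: "0 < w \<xi>" using w0[of \<xi>] by simp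
        have "ennreal (?r y) \<le> ennreal (1 / w \<xi>)"
          using le xI wp y[OF that(1)] by (simp add: inverse_ennreal inverse_eq_divide)
        then have "?r y \<le> 1 / w \<xi>" using wp by (subst (asm) ennreal_le_iff) auto
        then show ?thesis using wp y(2)[OF that(1)] by (simp add: field_simps)
      qed (use y(2)[OF that(1)] in simp)
      with xI show ?thesis by simp
    qed
    \<comment> \<open>On the level set of value \<open>y\<close> the density \<open>w\<close> is at
      most \<open>1 / y\<close>, the point of tangency, so the quadratic term costs at most half of
      the linear term \<open>2 y\<close>.\<close>
    have \<nu>A: "?q y * measure \<nu> (A y) \<le> ?r y * ?m (A y)" if "y \<in> Y" for y
    proof -
      define t where "t = ?r y"
      have t: "0 < t" using y(2)[OF that] by (simp add: t_def)
      have "emeasure \<nu> (A y) = (\<integral>\<^sup>+\<xi>\<in>A y. ennreal (w \<xi> / (2 * pi)) \<partial>arc_length)"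
        unfolding dens by (subst emeasure_density) auto
      also have "... \<le> (\<integral>\<^sup>+\<xi>. ennreal (1 / t / (2 * pi)) * indicator (A y) \<xi> \<partial>arc_length)"
      proof (rule nn_integral_mono)
        fix \<xi>
        show "ennreal (w \<xi> / (2 * pi)) * indicator (A y) \<xi> \<le> ennreal (1 / t / (2 * pi)) * indicator (A y) \<xi>"
        proof (cases "\<xi> \<in> A y")
          case True
          have "w \<xi> / (2 * pi) \<le> 1 / t / (2 * pi)" using Ap[OF that True] unfolding t_def by (intro divide_right_mono) auto
          then show ?thesis by (intro mult_right_mono ennreal_leI) auto
        qed simp
      qed
      also have "... = ennreal (1 / t / (2 * pi) * ?m (A y))"
        using t by (simp add: nn_integral_cmult_indicator arc_length.emeasure_eq_measure ennreal_mult[symmetric])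
      finally have "measure \<nu> (A y) \<le> 1 / t / (2 * pi) * ?m (A y)"
        using t unfolding emeasure_eq_measure by (subst (asm) ennreal_le_iff) auto
      then have "t^2 * (2 * pi) * measure \<nu> (A y) \<le> t^2 * (2 * pi) * (1 / t / (2 * pi) * ?m (A y))"
        by (intro mult_left_mono) auto
      also have "... = t * ?m (A y)" using t by (simp add: power2_eq_square)
      finally show ?thesis by (simp add: t_def)
    qed
    define S where "S = (\<Sum>y\<in>Y. ?r y * ?m (A y))"
    define D where "D = 1 + (\<Sum>y\<in>Y. ?q y)"
    have D: "D > 0" unfolding D_def by (intro add_pos_nonneg sum_nonneg) auto
    \<comment> \<open>Summed over the level sets, the tangent inequality reads
      \<open>2 S \<le> B + S\<close> up to errors; \<open>D\<close> collects the coefficients of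
      \<open>\<epsilon>\<close>.\<close>
    have step: "S \<le> B + D * \<epsilon>" if \<epsilon>: "0 < \<epsilon>" for \<epsilon>
    proof -
      have "eventually (\<lambda>n. Bn n < B + \<epsilon>) sequentially" using \<epsilon> by (intro order_tendstoD(2)[OF Bn_lim]) auto
      moreover have "eventually (\<lambda>n. \<forall>y\<in>Y. measure (dilate n) (A y) \<le> measure \<nu> (A y) + \<epsilon>) sequentially"
        by (intro eventually_ball_finite finY ballI measure_dilate_eventually_le A \<epsilon>)
      ultimately obtain n where n: "Bn n < B + \<epsilon>" "\<And>y. y \<in> Y \<Longrightarrow> measure (dilate n) (A y) \<le> measure \<nu> (A y) + \<epsilon>"
        using eventually_happens[OF eventually_conj] by fastforce
      let ?u = "\<lambda>\<xi>. ennreal (1 / U_dil n \<xi>)"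
      have "ennreal (\<Sum>y\<in>Y. 2 * ?r y * ?m (A y)) = (\<Sum>y\<in>Y. ennreal (2 * ?r y * ?m (A y)))"
        by (rule sum_ennreal[symmetric]) simp
      also have "... \<le> (\<Sum>y\<in>Y. (\<integral>\<^sup>+\<xi>\<in>A y. ?u \<xi> \<partial>arc_length) + ennreal (?q y * measure (dilate n) (A y)))"
        by (intro sum_mono set_integral_inverse_dilate_ge A) simp
      also have "... = (\<Sum>y\<in>Y. \<integral>\<^sup>+\<xi>\<in>A y. ?u \<xi> \<partial>arc_length) + ennreal (\<Sum>y\<in>Y. ?q y * measure (dilate n) (A y))"
        unfolding sum.distrib by (subst sum_ennreal) auto
      also have "(\<Sum>y\<in>Y. \<integral>\<^sup>+\<xi>\<in>A y. ?u \<xi> \<partial>arc_length) \<le> ennreal (Bn n)"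
      proof -
        have "(\<Sum>y\<in>Y. \<integral>\<^sup>+\<xi>\<in>A y. ?u \<xi> \<partial>arc_length) = (\<integral>\<^sup>+\<xi>. (\<Sum>y\<in>Y. ?u \<xi> * indicator (A y) \<xi>) \<partial>arc_length)"
          by (rule nn_integral_sum[symmetric]) measurable
        also have "... \<le> (\<integral>\<^sup>+\<xi>\<in>I. ?u \<xi> \<partial>arc_length)"
        proof (rule nn_integral_mono)
          fix \<xi> assume \<xi>: "\<xi> \<in> space arc_length"
          have "(\<Sum>y\<in>Y. ?u \<xi> * indicator (A y) \<xi>) = (\<Sum>y\<in>Y. if y = s \<xi> then ?u \<xi> else 0)"
            using \<xi> by (intro sum.cong) (auto simp: A_def indicator_def)
          also have "... = (if s \<xi> \<in> Y then ?u \<xi> else 0)" using finY by simp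
          also have "... \<le> ?u \<xi> * indicator I \<xi>" using Ap[of "s \<xi>" \<xi>] \<xi> by (auto simp: A_def)
          finally show "(\<Sum>y\<in>Y. ?u \<xi> * indicator (A y) \<xi>) \<le> ?u \<xi> * indicator I \<xi>" .
        qed
        also have "... \<le> ennreal (Bn n)" by (rule bound)
        finally show ?thesis .
      qed
      finally have "ennreal (\<Sum>y\<in>Y. 2 * ?r y * ?m (A y)) \<le> ennreal (Bn n) + ennreal (\<Sum>y\<in>Y. ?q y * measure (dilate n) (A y))"
        by (simp add: add_right_mono)
      also have "... = ennreal (Bn n + (\<Sum>y\<in>Y. ?q y * measure (dilate n) (A y)))"
        using Bn0 by (intro ennreal_plus[symmetric] sum_nonneg) auto
      finally have "(\<Sum>y\<in>Y. 2 * ?r y * ?m (A y)) \<le> Bn n + (\<Sum>y\<in>Y. ?q y * measure (dilate n) (A y))"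
        using Bn0[of n] by (subst (asm) ennreal_le_iff) (auto intro!: add_nonneg_nonneg sum_nonneg)
      also have "... \<le> (B + \<epsilon>) + (\<Sum>y\<in>Y. ?r y * ?m (A y) + ?q y * \<epsilon>)"
      proof (intro add_mono sum_mono)
        show "Bn n \<le> B + \<epsilon>" using n(1) by simp
        fix y assume "y \<in> Y"
        have "?q y * measure (dilate n) (A y) \<le> ?q y * (measure \<nu> (A y) + \<epsilon>)"
          using n(2)[OF \<open>y \<in> Y\<close>] by (intro mult_left_mono) auto
        also have "... \<le> ?r y * ?m (A y) + ?q y * \<epsilon>"
          using \<nu>A[OF \<open>y \<in> Y\<close>] by (simp add: distrib_left)
        finally show "?q y * measure (dilate n) (A y) \<le> ?r y * ?m (A y) + ?q y * \<epsilon>" .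
      qed
      also have "... = B + D * \<epsilon> + S" unfolding sum.distrib S_def D_def by (simp add: sum_distrib_right distrib_right)
      also have "(\<Sum>y\<in>Y. 2 * ?r y * ?m (A y)) = 2 * S" by (simp add: S_def sum_distrib_left mult.assoc)
      finally show ?thesis by simp
    qed
    have "S \<le> B"
    proof (rule field_le_epsilon)
      fix e :: real assume "0 < e"
      then show "S \<le> B + e" using step[of "e / D"] D by simp
    qed
    have "integral\<^sup>S arc_length s = (\<Sum>y\<in>s ` space arc_length. y * emeasure arc_length (A y))"
      by (simp add: simple_integral_def A_def)
    also have "... = (\<Sum>y\<in>Y. y * emeasure arc_length (A y))"
      using s(1) by (intro sum.mono_neutral_right) (auto simp: Y_def simple_function_def)
    also have "... = (\<Sum>y\<in>Y. ennreal (?r y * ?m (A y)))"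
      by (intro sum.cong refl) (subst y(1), auto simp: arc_length.emeasure_eq_measure ennreal_mult)
    also have "... = ennreal S" unfolding S_def by (rule sum_ennreal) simp
    finally show ?thesis using \<open>S \<le> B\<close> by (simp add: ennreal_leI)
  qed
  have "(\<integral>\<^sup>+\<xi>\<in>I. inverse (ennreal (w \<xi>)) \<partial>arc_length) \<le> ennreal B"
    unfolding nn_integral_def_finite by (rule SUP_least) (use main in blast)
  then show ?thesis by (simp add: I_def B_def z_def)
qed

text \<open>Counterpart for \<open>w\<close> of the bound for \<open>1 / w\<close>, at the same
  interior point: there the Poisson kernel is at least \<open>1 / (2 * pi * h)\<close> on the
  arc.\<close>

lemma measure_arc_le:
  assumes h: "0 < h" "h \<le> pi"
  shows "measure \<nu> (mid_arc \<theta> h) \<le> 2 * pi * h * U (of_real (1 - h / pi) * cis \<theta>)"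
proof -
  define x where "x = 1 - h / pi"
  have x: "0 \<le> x" "x < 1" using h by (auto simp: x_def)
  define I where "I = mid_arc \<theta> h"
  have I: "I \<in> sets \<nu>" using arc_in_sets by (simp add: I_def sets_circle sets_arc_length)
  have z: "norm (of_real x * cis \<theta>) < 1" using x by (simp add: norm_mult)
  have p: "1 / (2 * pi * h) * indicator I \<xi> \<le> poisson (of_real x * cis \<theta>) \<xi>" if \<xi>: "norm \<xi> = 1" for \<xi>
  proof (cases "\<xi> \<in> I")
    case True
    then obtain t where t: "\<xi> = cis t" "\<theta> - h \<le> t" "t \<le> \<theta> + h" by (auto simp: I_def)
    then show ?thesis
      using poisson_ge_on_arc[OF h, of "t - \<theta>"] poisson_cis[OF x(1), of \<theta> "t - \<theta>"] True
      by (simp add: x_def abs_le_iff)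
  qed (use poisson_pos[OF z \<xi>] in simp)
  have "(\<integral>\<xi>. 1 / (2 * pi * h) * indicator I \<xi> \<partial>\<nu>) \<le> (\<integral>\<xi>. poisson (of_real x * cis \<theta>) \<xi> \<partial>\<nu>)"
    using I p by (intro integral_mono poisson_integrable z integrable_mult_right integrable_real_indicator)
      (auto simp: space_circle emeasure_eq_measure)
  also have "... = U (of_real x * cis \<theta>)" by (simp add: U_eq Re_herglotz[OF z])
  also have "(\<integral>\<xi>. 1 / (2 * pi * h) * indicator I \<xi> \<partial>\<nu>) = 1 / (2 * pi * h) * measure \<nu> I"
    using sets.sets_into_space[OF I] by (simp add: Int_absorb2)
  finally show ?thesis using h by (simp add: I_def x_def field_simps)
qed

text \<open>The averages of \<open>w\<close> and \<open>1 / w\<close> are at most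
  \<open>2 * pi^2 * y\<close> and \<open>2 * pi^2 * C / y\<close> with the same \<open>y\<close>,
  the value of \<open>U\<close> at the interior point belonging to the arc; it cancels, and
  \<open>4 * pi ^ 4 * C\<close> bounds the characteristic.\<close>

lemma density_in_A2:
  assumes w [measurable]: "w \<in> borel_measurable arc_length" and w0: "\<And>\<xi>. 0 \<le> w \<xi>"
    and dens: "\<nu> = density arc_length (\<lambda>\<xi>. ennreal (w \<xi> / (2 * pi)))"
  shows "w \<in> A2"
proof -
  have intw: "(\<integral>\<^sup>+\<xi>\<in>E. ennreal (w \<xi>) \<partial>arc_length) = ennreal (2 * pi * measure \<nu> E)" if [measurable]: "E \<in> sets arc_length" for E
  proof -
    have "ennreal (2 * pi * measure \<nu> E) = ennreal (2 * pi) * emeasure \<nu> E"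
      by (simp add: emeasure_eq_measure ennreal_mult)
    also have "emeasure \<nu> E = (\<integral>\<^sup>+\<xi>\<in>E. ennreal (w \<xi> / (2 * pi)) \<partial>arc_length)"
      unfolding dens by (subst emeasure_density) auto
    also have "ennreal (2 * pi) * ... = (\<integral>\<^sup>+\<xi>. ennreal (2 * pi) * (ennreal (w \<xi> / (2 * pi)) * indicator E \<xi>) \<partial>arc_length)"
      by (rule nn_integral_cmult[symmetric]) measurable
    also have "... = (\<integral>\<^sup>+\<xi>\<in>E. ennreal (w \<xi>) \<partial>arc_length)"
      using w0 by (intro nn_integral_cong) (simp add: mult.assoc[symmetric] ennreal_mult[symmetric])
    finally show ?thesis by simp
  qed
  have "AE \<xi> in arc_length. 0 < w \<xi>"
  proof -
    \<comment> \<open>The full circle, written as the arc of half-width \<open>pi\<close> about the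
      angle \<open>pi\<close>. Finiteness of this integral excludes a set of positive measure on
      which \<open>w\<close> vanishes.\<close>
    have "(\<integral>\<^sup>+\<xi>. inverse (ennreal (w \<xi>)) \<partial>arc_length) = (\<integral>\<^sup>+\<xi>\<in>cis ` {pi - pi..pi + pi}. inverse (ennreal (w \<xi>)) \<partial>arc_length)"
      by (intro nn_integral_cong) (simp add: space_arc_length circle_eq_arc flip: mult_2)
    also have "... \<noteq> \<infinity>" using nn_integral_inverse_density_le[OF w w0 dens, of pi pi] by (auto simp: top_unique)
    finally have "AE \<xi> in arc_length. inverse (ennreal (w \<xi>)) \<noteq> \<infinity>"
      by (intro nn_integral_PInf_AE) auto
    then show ?thesis
    proof eventually_elim
      case (elim \<xi>)
      then show ?case using w0[of \<xi>] by (cases "w \<xi> = 0") auto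
    qed
  qed
  moreover have "A2_char w < \<infinity>"
  proof -
    have "A2_char w \<le> ennreal (4 * pi ^ 4 * C)"
      unfolding A2_char_def
    proof (rule SUP_least)
      fix I assume "I \<in> arcs"
      then obtain a b where ab: "I = cis ` {a..b}" "a < b" "b \<le> a + 2 * pi" by (auto simp: arcs_def)
      define \<theta> h where "\<theta> = (a + b) / 2" and "h = (b - a) / 2"
      have "a = \<theta> - h" "b = \<theta> + h" by (simp_all add: \<theta>_def h_def field_simps)
      then have I: "I = mid_arc \<theta> h" using ab(1) by simp
      have h: "0 < h" "h \<le> pi" using ab by (auto simp: h_def)
      define y where "y = U (of_real (1 - h / pi) * cis \<theta>)"
      have y: "0 < y" unfolding y_def by (intro U_pos norm_arc_point h)
      have len: "emeasure arc_length I = ennreal (2 * h)"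
        using emeasure_arc[of "\<theta> - h" "\<theta> + h"] h by (simp add: I)
      have "arc_avg (\<lambda>\<xi>. ennreal (w \<xi>)) I \<le> ennreal (2 * pi * (2 * pi * h * y)) / ennreal (2 * h)"
        unfolding arc_avg_def len using measure_arc_le[OF h, of \<theta>] arc_in_sets
        by (intro divide_right_mono_ennreal) (simp add: I intw y_def ennreal_leI)
      also have "... = ennreal (2 * pi^2 * y)"
        using h y by (subst divide_ennreal) (auto simp: power2_eq_square)
      finally have 1: "arc_avg (\<lambda>\<xi>. ennreal (w \<xi>)) I \<le> ennreal (2 * pi^2 * y)" .
      have "arc_avg (\<lambda>\<xi>. inverse (ennreal (w \<xi>))) I \<le> ennreal (4 * pi^2 * h * C / y) / ennreal (2 * h)"
        unfolding arc_avg_def len using nn_integral_inverse_density_le[OF w w0 dens h, of \<theta>]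
        by (intro divide_right_mono_ennreal) (simp add: I y_def)
      also have "... = ennreal (2 * pi^2 * C / y)"
        using h y C_ge_1 by (subst divide_ennreal) auto
      finally have 2: "arc_avg (\<lambda>\<xi>. inverse (ennreal (w \<xi>))) I \<le> ennreal (2 * pi^2 * C / y)" .
      have "arc_avg (\<lambda>\<xi>. ennreal (w \<xi>)) I * arc_avg (\<lambda>\<xi>. inverse (ennreal (w \<xi>))) I \<le> ennreal (2 * pi^2 * y) * ennreal (2 * pi^2 * C / y)"
        by (intro mult_mono 1 2) auto
      also have "... = ennreal (4 * pi ^ 4 * C)"
        using y C_ge_1 by (subst ennreal_mult[symmetric]) (auto simp: power4_eq_xxxx power2_eq_square)
      finally show "arc_avg (\<lambda>\<xi>. ennreal (w \<xi>)) I * arc_avg (\<lambda>\<xi>. inverse (ennreal (w \<xi>))) I \<le> ennreal (4 * pi ^ 4 * C)" .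
    qed
    then show ?thesis using le_less_trans[OF _ ennreal_less_top] by simp
  qed
  ultimately show ?thesis unfolding A2_def using w by blast
qed

lemma exists_A2_density:
  "\<exists>w \<in> A2. \<nu> = density arc_length (\<lambda>\<xi>. ennreal (w \<xi> / (2 * pi)))"
proof -
  have "sets \<nu> = sets arc_length" by (simp add: sets_circle sets_arc_length)
  from arc_length.Radon_Nikodym[OF absolutely_continuous_clark this]
  obtain g where g [measurable]: "g \<in> borel_measurable arc_length" and dens: "density arc_length g = \<nu>" by blast
  \<comment> \<open>\<open>enn2real\<close> makes the weight real and nonnegative everywhere; the
    points where \<open>g\<close> is infinite form a null set because \<open>\<nu>\<close> is
    finite.\<close>
  define w where "w \<xi> = 2 * pi * enn2real (g \<xi>)" for \<xi>
  have [measurable]: "w \<in> borel_measurable arc_length" unfolding w_def[abs_def] by measurable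
  have "(\<integral>\<^sup>+\<xi>. g \<xi> \<partial>arc_length) = emeasure \<nu> (space arc_length)"
    unfolding dens[symmetric] by (subst emeasure_density) (auto intro!: nn_integral_cong)
  also have "... \<noteq> \<infinity>" by (simp add: emeasure_eq_measure)
  finally have "AE \<xi> in arc_length. g \<xi> \<noteq> \<infinity>" by (intro nn_integral_PInf_AE) auto
  then have "AE \<xi> in arc_length. g \<xi> = ennreal (w \<xi> / (2 * pi))"
    by eventually_elim (simp add: w_def ennreal_enn2real_if)
  then have \<nu>: "\<nu> = density arc_length (\<lambda>\<xi>. ennreal (w \<xi> / (2 * pi)))"
    unfolding dens[symmetric] by (intro density_cong) auto
  moreover have "w \<in> A2" by (rule density_in_A2[OF _ _ \<nu>]) (simp_all add: w_def)
  ultimately show ?thesis by blast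
qed

end

section \<open>Aleksandrov--Clark measures\<close>

lemma Re_divide_mult_norm_sq:
  assumes "y \<noteq> 0" shows "Re (x / y) * (norm y)^2 = Re (x * cnj y)"
proof -
  have "(Re y)^2 + (Im y)^2 \<noteq> 0" using assms by (simp add: complex_eq_iff sum_power2_eq_zero_iff)
  then show ?thesis by (simp add: Re_divide cmod_power2)
qed

text \<open>For \<open>\<alpha> \<noteq> -1\<close> on the circle \<open>\<zeta> = \<i> t\<close>,
  and \<open>Re ((\<zeta> + F) cnj (1 + \<zeta> F)) = (1 + t^2) Re F\<close>; dividing
  \<open>1 + \<zeta> F\<close> by \<open>s = sqrt (1 + t^2)\<close> gives \<open>K\<close>. The
  second claim compares \<open>|K|\<close> with its imaginary part, which is
  \<open>t Re F / s\<close>. For \<open>\<alpha> = -1\<close> simply \<open>K = F\<close>.\<close>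

lemma clark_transform_factor:
  assumes \<alpha>: "norm \<alpha> = 1"
  obtains a b :: complex where
    "\<And>z. 0 < Re (herglotz \<mu> z) \<Longrightarrow> Re (clark_transform \<mu> \<alpha> z) * (norm (a + b * herglotz \<mu> z))^2 = Re (herglotz \<mu> z)"
    "\<And>z. 0 < Re (herglotz \<mu> z) \<Longrightarrow> norm b * Re (herglotz \<mu> z) \<le> norm (a + b * herglotz \<mu> z)"
proof (cases "\<alpha> = -1")
  case True
  have "Re (1 / f) * (norm f)^2 = Re f" if "0 < Re f" for f
    using Re_divide_mult_norm_sq[of f 1] that by fastforce
  then show ?thesis using True complex_Re_le_cmod
    by (intro that[of 0 1]) (simp_all add: clark_transform_def)
next
  case False
  define \<zeta> where "\<zeta> = (1 - \<alpha>) / (1 + \<alpha>)"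
  define t where "t = Im \<zeta>"
  define s where "s = sqrt (1 + t^2)"
  have s: "s > 0" "s^2 = 1 + t^2" by (auto simp: s_def add_pos_nonneg)
  have \<alpha>2: "(Re \<alpha>)^2 + (Im \<alpha>)^2 = 1" using \<alpha> cmod_power2[of \<alpha>] by simp
  have "Re \<zeta> = 0"
  proof -
    have "Re \<zeta> = ((1 - Re \<alpha>) * (1 + Re \<alpha>) - Im \<alpha> * Im \<alpha>) / ((1 + Re \<alpha>)^2 + (Im \<alpha>)^2)"
      by (simp add: \<zeta>_def Re_divide)
    also have "(1 - Re \<alpha>) * (1 + Re \<alpha>) - Im \<alpha> * Im \<alpha> = 0" using \<alpha>2 by (simp add: algebra_simps power2_eq_square)
    finally show ?thesis by simp
  qed
  then have \<zeta>: "\<zeta> = \<i> * t" by (simp add: t_def complex_eq_iff)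
  have K: "of_real (1 / s) + (\<zeta> / of_real s) * f = (1 + \<zeta> * f) / of_real s" for f
    by (simp add: add_divide_distrib)
  have ct: "clark_transform \<mu> \<alpha> z = (\<zeta> + herglotz \<mu> z) / (1 + \<zeta> * herglotz \<mu> z)" for z
    using False by (simp add: clark_transform_def \<zeta>_def Let_def)
  have 1: "Re ((\<zeta> + f) / (1 + \<zeta> * f)) * (norm ((1 + \<zeta> * f) / of_real s))^2 = Re f" if f: "0 < Re f" for f
  proof -
    have nz: "1 + \<zeta> * f \<noteq> 0"
    proof
      assume *: "1 + \<zeta> * f = 0"
      then have "Im (1 + \<zeta> * f) = 0" "Re (1 + \<zeta> * f) = 0" by simp_all
      then show False using f by (simp add: \<zeta>)
    qed
    have "Re ((\<zeta> + f) / (1 + \<zeta> * f)) * (norm (1 + \<zeta> * f))^2 = Re ((\<zeta> + f) * cnj (1 + \<zeta> * f))"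
      by (rule Re_divide_mult_norm_sq[OF nz])
    also have "... = s^2 * Re f" unfolding s \<zeta> by (simp add: algebra_simps power2_eq_square)
    finally show ?thesis using s(1) by (simp add: norm_divide power_divide)
  qed
  have 2: "norm (\<zeta> / of_real s) * Re f \<le> norm ((1 + \<zeta> * f) / of_real s)" if f: "0 < Re f" for f
  proof -
    have "\<bar>t\<bar> * Re f = \<bar>Im (1 + \<zeta> * f)\<bar>" using f by (simp add: \<zeta> abs_mult)
    also have "... \<le> norm (1 + \<zeta> * f)" by (rule abs_Im_le_cmod)
    finally show ?thesis using s(1) by (simp add: norm_divide \<zeta> norm_mult divide_right_mono)
  qed
  show ?thesis
    by (rule that[of "of_real (1 / s)" "\<zeta> / of_real s"]) (use 1 2 in \<open>simp_all only: K ct\<close>)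
qed

lemma clark_lyapunov_lyap:
  assumes N: "circle_measure N" and \<mu>: "circle_measure \<mu>" and \<nu>: "circle_measure \<nu>"
    and total: "measure \<nu> (space \<nu>) = 1" and \<mu>_total: "measure \<mu> (space \<mu>) = 1"
    and lower: "\<And>z. norm z < 1 \<Longrightarrow> 1 \<le> Re (herglotz \<mu> z) * Re (herglotz N z)"
    and upper: "\<And>z. norm z < 1 \<Longrightarrow> Re (herglotz \<mu> z) * Re (herglotz N z) \<le> Q"
    and factor: "\<And>z. norm z < 1 \<Longrightarrow> Re (herglotz \<nu> z) * (norm (a + b * herglotz \<mu> z))^2 = Re (herglotz \<mu> z)"
    and b: "\<And>z. norm z < 1 \<Longrightarrow> norm b * Re (herglotz \<mu> z) \<le> norm (a + b * herglotz \<mu> z)"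
  shows "clark_lyapunov \<nu> (\<lambda>z. Re (herglotz \<nu> z)) (\<lambda>z. lyap Q a b (herglotz \<mu> z) (herglotz N z)) (2 * Q + 80 * Q ^ 5)"
proof -
  interpret \<mu>: circle_measure \<mu> by fact
  interpret N: circle_measure N by fact
  interpret \<nu>: circle_measure \<nu> by fact
  define F G H where "F = herglotz \<mu>" and "G = herglotz N" and "H = herglotz \<nu>"
  define C where "C = 2 * Q + 80 * Q ^ 5"
  let ?E = "\<lambda>W u z. C^2 * (1 / ((W z)^2 * u z)) :: real"
  define V where "V z = lyap Q a b (F z) (G z)" for z
  have hol: "F holomorphic_on ball 0 1" "G holomorphic_on ball 0 1" "H holomorphic_on ball 0 1"
    unfolding F_def G_def H_def by (rule \<mu>.herglotz_holomorphic N.herglotz_holomorphic \<nu>.herglotz_holomorphic)+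
  have F0: "0 < Re (F z)" if "norm z < 1" for z
    unfolding F_def using \<mu>.Re_herglotz_pos[OF that] \<mu>_total by simp
  have H0: "0 < Re (H z)" if "norm z < 1" for z
    unfolding H_def using \<nu>.Re_herglotz_pos[OF that] total by simp
  have G0: "0 < Re (G z)" if "norm z < 1" for z
  proof -
    have "0 < Re (F z) * Re (G z)" using lower[OF that] by (simp add: F_def G_def)
    then show ?thesis using F0[OF that] by (simp add: zero_less_mult_iff)
  qed
  have FG: "1 \<le> Re (F z) * Re (G z)" "Re (F z) * Re (G z) \<le> Q" if "norm z < 1" for z
    using lower[OF that] upper[OF that] by (simp_all add: F_def G_def)
  have ratio: "(norm (a + b * F z))^2 / Re (F z) = 1 / Re (H z)" if "norm z < 1" for z
  proof -
    have "Re (H z) * (norm (a + b * F z))^2 = Re (F z)" using factor[OF that] by (simp add: F_def H_def)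
    then show ?thesis using F0[OF that] H0[OF that] by (simp add: field_simps)
  qed
  have V: "1 / Re (H z) \<le> V z" "V z \<le> C * (1 / Re (H z))" if "norm z < 1" for z
    using lyap_bounds[OF F0[OF that] G0[OF that] FG[OF that], of b a] b[OF that]
    unfolding V_def C_def ratio[OF that] F_def[symmetric] by simp_all
  have V0: "0 < V z" if "norm z < 1" for z
    using V(1)[OF that] H0[OF that] by (meson less_le_trans zero_less_divide_1_iff)
  have HV: "1 \<le> Re (H z) * V z" "Re (H z) * V z \<le> C" if "norm z < 1" for z
    using V[OF that] H0[OF that] by (simp_all add: field_simps)
  have Vcont: "continuous_on (ball 0 1) V"
    unfolding V_def lyap_def
  proof (intro continuous_intros holomorphic_on_imp_continuous_on hol ballI)
    fix z :: complex assume "z \<in> ball 0 1"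
    then show "(Re (F z))^2 * Re (G z) \<noteq> 0" "(Re (G z))^2 * Re (F z) \<noteq> 0"
      using F0[of z] G0[of z] by simp_all
  qed
  \<comment> \<open>Composition with \<open>\<psi>\<close> and \<open>exp\<close> affects only the
    arguments of \<open>lyap\<close>, which remain holomorphic and keep the bounds on the product of
    their real parts; this is the conformal invariance behind the transport to arcs.\<close>
  have sup: "superharmonic {s. Re s < ln R} (\<lambda>s. V (\<psi> (exp s)))"
    if "R > 1" "\<psi> holomorphic_on ball 0 R" "\<And>z. norm z < R \<Longrightarrow> norm (\<psi> z) < 1" for R \<psi>
  proof -
    have comp: "(\<lambda>z. f (\<psi> z)) holomorphic_on ball 0 R" if "f holomorphic_on ball 0 1" for f
      by (rule holomorphic_on_compose_gen[OF \<open>\<psi> holomorphic_on ball 0 R\<close> that, unfolded o_def])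
         (use \<open>\<And>z. norm z < R \<Longrightarrow> norm (\<psi> z) < 1\<close> in auto)
    have in_disc: "norm (\<psi> (exp s)) < 1" if "s \<in> {s. Re s < ln R}" for s
      using exp_mem_ball[of R s] that \<open>R > 1\<close> \<open>\<And>z. norm z < R \<Longrightarrow> norm (\<psi> z) < 1\<close> by simp
    show ?thesis
      unfolding V_def
    proof (rule superharmonic_lyap[OF open_left_half_plane])
      show "(\<lambda>s. F (\<psi> (exp s))) holomorphic_on {s. Re s < ln R}"
        using holomorphic_exp_half_plane[OF comp[OF hol(1)]] \<open>R > 1\<close> by simp
      show "(\<lambda>s. G (\<psi> (exp s))) holomorphic_on {s. Re s < ln R}"
        using holomorphic_exp_half_plane[OF comp[OF hol(2)]] \<open>R > 1\<close> by simp
    qed (use in_disc F0 G0 FG in auto)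
  qed
  have mean: "integral {0..2*pi} (\<lambda>x. V (\<psi> (cis x))) \<le> 2 * pi * V (\<psi> 0)"
    if R: "R > 1" and \<psi>: "\<psi> holomorphic_on ball 0 R" "\<And>z. norm z < R \<Longrightarrow> norm (\<psi> z) < 1" for R \<psi>
  proof (rule superharmonic_mean_disc[OF R sup[OF R \<psi>]])
    have "continuous_on (ball 0 R) (\<lambda>z. V (\<psi> z))"
      by (rule continuous_on_compose2[OF Vcont holomorphic_on_imp_continuous_on[OF \<psi>(1)]]) (use \<psi>(2) in auto)
    then show "isCont (\<lambda>z. V (\<psi> z)) 0" using R by (simp add: continuous_on_eq_continuous_at)
  qed
  have entropy: "integral {0..2*pi} (\<lambda>x. Re (H (of_real r * cis x)) * ln (Re (H (of_real r * cis x)))) \<le> 2 * pi * C^2"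
    if r: "0 < r" "r < 1" for r :: real
  proof -
    define R where "R = 1 / r"
    have R: "R > 1" using r by (simp add: R_def)
    define \<psi> where "\<psi> z = of_real r * z" for z :: complex
    have \<psi>: "\<psi> holomorphic_on ball 0 R" "\<And>z. norm z < R \<Longrightarrow> norm (\<psi> z) < 1"
      using r by (auto simp: \<psi>_def[abs_def] R_def norm_mult field_simps intro!: holomorphic_intros)
    have H\<psi>: "(\<lambda>z. H (\<psi> z)) holomorphic_on ball 0 R"
      by (rule holomorphic_on_compose_gen[OF \<psi>(1) hol(3), unfolded o_def]) (use \<psi>(2) in auto)
    define u W where "u z = Re (H (\<psi> z))" and "W z = V (\<psi> z)" for z
    have u0: "0 < u z" and W0: "0 < W z" and uW: "1 \<le> u z * W z" "u z * W z \<le> C" if "norm z < R" for z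
      using H0 V0 HV \<psi>(2)[OF that] by (auto simp: u_def W_def)
    have cu: "continuous_on (ball 0 R) u" unfolding u_def by (intro continuous_intros holomorphic_on_imp_continuous_on H\<psi>)
    have cW: "continuous_on (ball 0 R) W"
      unfolding W_def by (rule continuous_on_compose2[OF Vcont holomorphic_on_imp_continuous_on[OF \<psi>(1)]]) (use \<psi>(2) in auto)
    have cE: "continuous_on (ball 0 R) (\<lambda>z. ?E W u z)"
    proof (intro continuous_intros cu cW ballI)
      fix z :: complex assume "z \<in> ball 0 R"
      then show "(W z)^2 * u z \<noteq> 0" using u0[of z] W0[of z] by simp
    qed
    have cUl: "continuous_on (ball 0 R) (\<lambda>z. u z * ln (u z))"
    proof (intro continuous_intros cu ballI)
      fix z :: complex assume "z \<in> ball 0 R"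
      then show "u z \<noteq> 0" using u0[of z] by simp
    qed
    have on_circle: "(\<lambda>x. f (cis x)) integrable_on {0..2*pi}" if "continuous_on (ball 0 R) f" for f :: "complex \<Rightarrow> real"
      by (intro integrable_continuous_real continuous_on_compose2[OF that] continuous_intros) (use R in auto)
    have "integral {0..2*pi} (\<lambda>x. u (cis x) * ln (u (cis x)) - ?E W u (cis x))
      \<le> 2 * pi * (u 0 * ln (u 0) - ?E W u 0)"
    proof (rule superharmonic_mean_disc[OF R])
      show "superharmonic {s. Re s < ln R} (\<lambda>s. u (exp s) * ln (u (exp s)) - ?E W u (exp s))"
        unfolding u_def
      proof (rule superharmonic_entropy[OF open_left_half_plane])
        show "(\<lambda>s. H (\<psi> (exp s))) holomorphic_on {s. Re s < ln R}"
          using holomorphic_exp_half_plane[OF H\<psi>] R by simp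
        show "superharmonic {s. Re s < ln R} (\<lambda>s. W (exp s))" unfolding W_def by (rule sup[OF R \<psi>])
      qed (use exp_mem_ball[of R] R u0 W0 uW in \<open>auto simp: u_def\<close>)
      have "continuous_on (ball 0 R) (\<lambda>z. u z * ln (u z) - ?E W u z)"
        by (intro continuous_on_diff cUl cE)
      then show "isCont (\<lambda>z. u z * ln (u z) - ?E W u z) 0"
        using R by (simp add: continuous_on_eq_continuous_at)
    qed
    \<comment> \<open>At the centre \<open>u = 1\<close>, so \<open>u ln u\<close> vanishes there
      and only the subtracted nonnegative term is left.\<close>
    also have "... \<le> 0"
    proof -
      have "u 0 = 1" by (simp add: u_def \<psi>_def H_def \<nu>.herglotz_0 total)
      then show ?thesis by simp
    qed
    also have "integral {0..2*pi} (\<lambda>x. u (cis x) * ln (u (cis x)) - ?E W u (cis x))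
       = integral {0..2*pi} (\<lambda>x. u (cis x) * ln (u (cis x))) - integral {0..2*pi} (\<lambda>x. ?E W u (cis x))"
      by (rule integral_diff[OF on_circle[OF cUl] on_circle[OF cE]])
    finally have "integral {0..2*pi} (\<lambda>x. u (cis x) * ln (u (cis x))) \<le> integral {0..2*pi} (\<lambda>x. ?E W u (cis x))"
      by simp
    \<comment> \<open>From \<open>u W \<ge> 1\<close> the compensating term is at most
      \<open>C^2 u\<close>, whose mean is known exactly; this closes the entropy bound.\<close>
    also have "... \<le> integral {0..2*pi} (\<lambda>x. C^2 * u (cis x))"
    proof (intro integral_le on_circle[OF cE] on_circle[of "\<lambda>z. C^2 * u z"] continuous_intros cu)
      fix x
      have c: "norm (cis x) < R" using R by simp
      have "1 \<le> (u (cis x) * W (cis x))^2" using uW(1)[OF c] by (rule one_le_power)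
      then have "1 / ((W (cis x))^2 * u (cis x)) \<le> u (cis x)"
        using u0[OF c] W0[OF c] by (simp add: divide_le_eq power2_eq_square mult_ac)
      then show "?E W u (cis x) \<le> C^2 * u (cis x)" by (rule mult_left_mono) simp
    qed
    also have "... = C^2 * (2 * pi * u 0)" unfolding u_def using mean_value_Re[OF H\<psi> R] by simp
    also have "u 0 = 1" by (simp add: u_def \<psi>_def H_def \<nu>.herglotz_0 total)
    finally show ?thesis by (simp add: u_def \<psi>_def mult_ac)
  qed
  have "clark_lyapunov \<nu> (\<lambda>z. Re (H z)) V C"
    by unfold_locales (use total Vcont V0 HV mean entropy in \<open>auto simp: H_def\<close>)
  then show ?thesis by (simp add: H_def V_def[abs_def] F_def G_def C_def)
qed

theorem theorem3:
  fixes w :: "complex \<Rightarrow> real" and \<mu> :: "complex measure"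
  assumes "w \<in> A2"
    and "\<mu> = density arc_length (\<lambda>\<xi>. ennreal (w \<xi> / (2 * pi)))"
    and "circle_prob \<mu>"
  shows "\<forall>\<alpha> \<in> unit_circle. \<forall>\<nu>. is_aleksandrov_clark \<mu> \<alpha> \<nu> \<longrightarrow>
    absolutely_continuous arc_length \<nu> \<and>
    (\<exists>w\<^sub>\<alpha> \<in> A2. \<nu> = density arc_length (\<lambda>\<xi>. ennreal (w\<^sub>\<alpha> \<xi> / (2 * pi))))"
proof (intro ballI allI impI)
  fix \<alpha> :: complex and \<nu> :: "complex measure"
  assume \<alpha>: "\<alpha> \<in> unit_circle" and clark: "is_aleksandrov_clark \<mu> \<alpha> \<nu>"
  have circle: "circle_measure M" "measure M (space M) = 1" if "circle_prob M" for M
  proof -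
    interpret prob_space M using that by (simp add: circle_prob_def)
    show "circle_measure M" using that by unfold_locales (simp add: circle_prob_def)
    show "measure M (space M) = 1" by (rule prob_space)
  qed
  have \<nu>: "circle_prob \<nu>" "\<And>z. norm z < 1 \<Longrightarrow> herglotz \<nu> z = clark_transform \<mu> \<alpha> z"
    using clark by (auto simp: is_aleksandrov_clark_def)
  obtain N Q where N: "circle_measure N"
    "\<And>z. norm z < 1 \<Longrightarrow> 1 \<le> Re (herglotz \<mu> z) * Re (herglotz N z)"
    "\<And>z. norm z < 1 \<Longrightarrow> Re (herglotz \<mu> z) * Re (herglotz N z) \<le> Q"
    by (rule A2_conjugate_pair[OF assms]) blast
  obtain a b where ab:
    "\<And>z. 0 < Re (herglotz \<mu> z) \<Longrightarrow> Re (clark_transform \<mu> \<alpha> z) * (norm (a + b * herglotz \<mu> z))^2 = Re (herglotz \<mu> z)"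
    "\<And>z. 0 < Re (herglotz \<mu> z) \<Longrightarrow> norm b * Re (herglotz \<mu> z) \<le> norm (a + b * herglotz \<mu> z)"
    using clark_transform_factor[of \<alpha> \<mu>] \<alpha> by auto
  interpret \<mu>: circle_measure \<mu> by (rule circle(1)[OF assms(3)])
  have pos: "0 < Re (herglotz \<mu> z)" if "norm z < 1" for z
    using \<mu>.Re_herglotz_pos[OF that] circle(2)[OF assms(3)] by simp
  \<comment> \<open>The parameter \<open>\<alpha>\<close> enters only through \<open>a\<close> and
    \<open>b\<close>; the constant depends on \<open>Q\<close> alone.\<close>
  interpret clark_lyapunov \<nu> "\<lambda>z. Re (herglotz \<nu> z)" "\<lambda>z. lyap Q a b (herglotz \<mu> z) (herglotz N z)" "2 * Q + 80 * Q ^ 5"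
    using ab pos \<nu>(2)
    by (intro clark_lyapunov_lyap[OF N(1) circle(1)[OF assms(3)] circle(1,2)[OF \<nu>(1)] circle(2)[OF assms(3)] N(2,3)]) auto
  show "absolutely_continuous arc_length \<nu> \<and>
    (\<exists>w\<^sub>\<alpha> \<in> A2. \<nu> = density arc_length (\<lambda>\<xi>. ennreal (w\<^sub>\<alpha> \<xi> / (2 * pi))))"
    using absolutely_continuous_clark exists_A2_density by blast
qed

end
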